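(* Let $(S,X,T)\sim P_{S,X,T}$ be discrete random variables, and for $r\geq 0$, $\epsilon\ge 0$ let $$g^{r}_{\epsilon}(P_{S,X,T})=\sup_{P_{Y\mid S,X,T}:\ I(Y;S)\leq \epsilon,\ I(X;Y)\leq r} I(Y;T).$$ Then for all $r\geq 0$, $\epsilon\geq 0$: $$g^{r}_{\epsilon}(P_{S,X,T})\leq \min\{H(T\mid S)+\epsilon,\ H(T\mid X)+r\}.$$ Moreover, with $L_0 = H(T\mid X,S)-\big(\log(I(X,S;T)+5.51)+1.06\big)$, the following lower bounds hold: 1. If $0\leq r\leq H(X\mid S)+\epsilon$: $\max\{L_0, L_1^{r,\epsilon}, L_2^{r,\epsilon}\}\leq g^{r}_{\epsilon}(P_{S,X,T})$, where, with $\alpha=\frac{r}{H(X\mid S)+\epsilon}$, $L_1^{r,\epsilon} = H(T\mid X,S)+r-H(X,S\mid T)$, $L_2^{r,\epsilon} = H(T\mid X,S)+r-\alpha H(X,S\mid T)-1.06-\log\big((1-\alpha)I(X,S;T)+\alpha\min\{H(T),H(X,S)\}+5.51\big)$. 2. If $H(X\mid S)+\epsilon\leq r< H(X)$: $\max\{L_0, {L'}_1^{r,\epsilon}\}\leq g^{r}_{\epsilon}(P_{S,X,T})$, where ${L'}_1^{r,\epsilon} = H(T\mid S)-H(S\mid T)+\epsilon$. 3. If $r\leq \epsilon\leq H(S\mid X)+r$: $\max\{L_0, L_3^{r,\epsilon}, L_4^{r,\epsilon}\}\leq g^{r}_{\epsilon}(P_{S,X,T})$, where, with $\tilde{\alpha}=\frac{\epsilon}{H(S\mid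 X)+r}$, $L_3^{r,\epsilon} = H(T\mid X,S)+\epsilon-H(X,S\mid T)$, $L_4^{r,\epsilon} = H(T\mid X,S)+\epsilon-\tilde{\alpha} H(X,S\mid T)-1.06-\log\big((1-\tilde{\alpha})I(X,S;T)+\tilde{\alpha}\min\{H(T),H(X,S)\}+5.51\big)$. 4. If $H(S\mid X)+r\leq \epsilon< H(S)$: $\max\{L_0, {L'}_3^{r,\epsilon}\}\leq g^{r}_{\epsilon}(P_{S,X,T})$, where ${L'}_3^{r,\epsilon} = H(T\mid X)-H(X\mid T)+r$.
   Context: $S$ (sensitive attribute) takes values in a finite alphabet $\mathcal{S}$; $X$ (useful data) and $T$ (task) take values in finite or countably infinite alphabets, with finite entropies. $X,S,T$ are arbitrarily correlated (no Markov chain is assumed). The supremum is over all conditional distributions $P_{Y\mid S,X,T}$ of a discrete random variable $Y$ (the representation) given $(S,X,T)$. Standing assumptions: $r<H(X)$ and $\epsilon<H(S)$. Logarithms are base 2. *)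

theory Defs
  imports "HOL-Probability.Probability_Mass_Function" "HOL-Analysis.Infinite_Sum"
begin

text \<open>Discrete information measures (base-2 logarithms) for distributions given as pmfs.
  Terms with zero probability vanish since they are multiplied by 0.\<close>

definition ent :: "'a pmf \<Rightarrow> real" where
  "ent p = (\<Sum>\<^sub>\<infinity>a. - pmf p a * log 2 (pmf p a))"

definition finite_ent :: "'a pmf \<Rightarrow> bool" where
  "finite_ent p \<longleftrightarrow> (\<lambda>a. - pmf p a * log 2 (pmf p a)) summable_on UNIV"

definition cond_ent :: "('a \<times> 'b) pmf \<Rightarrow> real" where
  "cond_ent J = (\<Sum>\<^sub>\<infinity>(a,b). - pmf J (a,b) * log 2 (pmf J (a,b) / pmf (map_pmf snd J) b))"

definition mut_info :: "('a \<times> 'b) pmf \<Rightarrow> real" where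
  "mut_info J = (\<Sum>\<^sub>\<infinity>(a,b). pmf J (a,b) *
      log 2 (pmf J (a,b) / (pmf (map_pmf fst J) a * pmf (map_pmf snd J) b)))"

text \<open>Joint distribution of (S,X,T,Y) when Y is generated from (S,X,T) by the kernel K.
  The representation Y is discrete; its alphabet is taken to be nat (every countable
  alphabet embeds into nat).\<close>
definition joint_Y :: "('s \<times> 'x \<times> 't) pmf \<Rightarrow> ('s \<Rightarrow> 'x \<Rightarrow> 't \<Rightarrow> nat pmf)
    \<Rightarrow> ('s \<times> 'x \<times> 't \<times> nat) pmf" where
  "joint_Y P K = bind_pmf P (\<lambda>(s,x,t). map_pmf (\<lambda>y. (s,x,t,y)) (K s x t))"

definition g_fun :: "real \<Rightarrow> real \<Rightarrow> ('s \<times> 'x \<times> 't) pmf \<Rightarrow> real" where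
  "g_fun r \<epsilon> P = Sup ((\<lambda>K. mut_info (map_pmf (\<lambda>(s,x,t,y). (y,t)) (joint_Y P K))) `
     {K. mut_info (map_pmf (\<lambda>(s,x,t,y). (y,s)) (joint_Y P K)) \<le> \<epsilon>
       \<and> mut_info (map_pmf (\<lambda>(s,x,t,y). (x,y)) (joint_Y P K)) \<le> r})"

end

theory Submission
  imports Defs "HOL-Probability.Distributions" "HOL-Analysis.Infinite_Set_Sum"
begin

text \<open>
  The upper bound is \<open>I(Y;T) \<le> I(Y;S) + H(T | S)\<close>, and likewise with \<open>X\<close> in place of \<open>S\<close>.

  For the lower bounds let \<open>W = (X,S)\<close> and \<open>Y = (V,Z)\<close>. The variable \<open>V\<close> is an erased version
  (kept with probability \<open>\<alpha>\<close>) of some \<open>U\<close> with \<open>I(U;S) = \<epsilon>\<close> that determines \<open>X\<close> together with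
  \<open>S\<close>; then \<open>I(V;W) = r\<close> and \<open>I(V;S) \<le> \<epsilon>\<close>. Given \<open>V\<close>, the variable \<open>Z\<close> is a random function,
  independent of \<open>W\<close>, with \<open>T = Z(W)\<close>. From \<open>H(T | Y) \<le> H(W | Y) = H(W | V)\<close> one obtains the
  bounds without logarithm. The others follow from
  \<open>H(T | Y) \<le> I + log (I + 5.51) + 1.06\<close> for \<open>I = I(W;T | V)\<close>, which holds if \<open>Z\<close> is read off from a
  race of exponential clocks, one for each value of \<open>T\<close>: Gibbs' inequality is applied with a
  heavy-tailed density in the rescaled clocks as code distribution.

  On countable alphabets such discrete \<open>U\<close> and \<open>Z\<close> need not exist, so \<open>X\<close> and \<open>T\<close> are
  truncated outside finite sets, which costs arbitrarily little entropy. The remaining cases are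
  instances of this one: swap \<open>S\<close> and \<open>X\<close>, lower \<open>r\<close> to \<open>H(X | S) + \<epsilon>\<close>, or set \<open>r = 0\<close>.
\<close>

section \<open>Conditional entropy of random variables\<close>

text \<open>The constraints on I(Y;S) and I(X;Y) are hard, while I(Y;T) enters through a supremum,
  so every approximation has to be paid for in I(Y;T). Truncation therefore keeps H(W | V,Z) = H(W |
  V) as an exact equality. In the race, given W = w and the winner t, the winning clock has mean P(t
  | w). Divided by P(t), it has as its mean the likelihood ratio P(t | w) / P(t), whose logarithm
  averages to I(W;T). A code length that grows like the logarithm of the rescaled clock thus costs
  about I, and a heavy tail yields such a length. With tail exponent 1/l the price beyond I + log (1
  + b) is log l + (I + c)/l, where c = log (1 + 1/b). Replacing c by its bound 5.51, the minimum is
  at l = (I + 5.51) ln 2, which gives log (I + 5.51) + log (ln 2) + 1 / ln 2; the last two terms and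
  log (1 + b) are below 1.06. For nontrivial V one l serves all values of V: for fixed l the bound
  is affine in the information, so it averages exactly. Finite alphabets make the clocks a finite
  product and the random function a discrete variable.\<close>

text \<open>Random variables are functions on the base pmf. They enter only through the partitions that
  they induce, so variables that determine each other are interchangeable.\<close>
definition rv_prob :: "'m pmf \<Rightarrow> ('m \<Rightarrow> 'a) \<Rightarrow> 'm \<Rightarrow> real" where
  "rv_prob M X \<omega> = measure (measure_pmf M) {\<omega>'. X \<omega>' = X \<omega>}"

text \<open>The conditional information density -log P(X | Y). As a difference of logarithms it
  turns the chain rule into a pointwise identity, \<open>self_info_chain\<close>. A constant Y gives
  the unconditional case.\<close>

definition self_info :: "'m pmf \<Rightarrow> ('m \<Rightarrow> 'a) \<Rightarrow> ('m \<Rightarrow> 'b) \<Rightarrow> 'm \<Rightarrow> real" where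
  "self_info M X Y \<omega> = log 2 (rv_prob M Y \<omega>) - log 2 (rv_prob M (\<lambda>\<omega>. (X \<omega>, Y \<omega>)) \<omega>)"

text \<open>The Bochner integral of a non-integrable density is 0, so this is the conditional
  entropy only under integrability, which \<open>fin_rv M X\<close> guarantees for every Y.\<close>

definition Hc :: "'m pmf \<Rightarrow> ('m \<Rightarrow> 'a) \<Rightarrow> ('m \<Rightarrow> 'b) \<Rightarrow> real" where
  "Hc M X Y = measure_pmf.expectation M (self_info M X Y)"

definition fin_rv :: "'m pmf \<Rightarrow> ('m \<Rightarrow> 'a) \<Rightarrow> bool" where
  "fin_rv M X \<longleftrightarrow> integrable (measure_pmf M) (self_info M X (\<lambda>_. ()))"

lemma rv_prob_pmf: "rv_prob M X \<omega> = pmf (map_pmf X M) (X \<omega>)"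
  by (simp add: rv_prob_def pmf_map vimage_def)

lemma rv_prob_pos: "\<omega> \<in> set_pmf M \<Longrightarrow> 0 < rv_prob M X \<omega>"
  by (simp add: rv_prob_pmf pmf_positive)

lemma rv_prob_mono:
  assumes "\<omega> \<in> set_pmf M"
    and "\<And>\<omega>'. \<omega>' \<in> set_pmf M \<Longrightarrow> X \<omega>' = X \<omega> \<Longrightarrow> Y \<omega>' = Y \<omega>"
  shows "rv_prob M X \<omega> \<le> rv_prob M Y \<omega>"
  unfolding rv_prob_def
  by (rule measure_pmf.finite_measure_mono_AE)
     (unfold AE_measure_pmf_iff mem_Collect_eq, use assms(2) in blast, simp)

lemma rv_prob_cong:
  assumes "\<omega> \<in> set_pmf M"
    and "\<And>\<omega>'. \<omega>' \<in> set_pmf M \<Longrightarrow> X \<omega>' = X \<omega> \<longleftrightarrow> Y \<omega>' = Y \<omega>"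
  shows "rv_prob M X \<omega> = rv_prob M Y \<omega>"
  by (intro antisym rv_prob_mono) (use assms in blast)+

lemma rv_prob_const [simp]: "rv_prob M (\<lambda>_. c) \<omega> = 1"
  by (simp add: rv_prob_def)

lemma self_info_nonneg:
  assumes "\<omega> \<in> set_pmf M" shows "0 \<le> self_info M X Y \<omega>"
proof -
  have "rv_prob M (\<lambda>\<omega>. (X \<omega>, Y \<omega>)) \<omega> \<le> rv_prob M Y \<omega>"
    by (rule rv_prob_mono) (use assms in auto)
  then show ?thesis using rv_prob_pos[OF assms, of Y] rv_prob_pos[OF assms, of "\<lambda>\<omega>. (X \<omega>, Y \<omega>)"]
    by (simp add: self_info_def)
qed

lemma self_info_cong:
  assumes "\<omega> \<in> set_pmf M"
    and "\<And>\<omega>'. \<omega>' \<in> set_pmf M \<Longrightarrow> Y \<omega>' = Y \<omega> \<longleftrightarrow> Y' \<omega>' = Y' \<omega>"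
    and "\<And>\<omega>'. \<omega>' \<in> set_pmf M \<Longrightarrow> Y \<omega>' = Y \<omega> \<Longrightarrow> Y' \<omega>' = Y' \<omega> \<Longrightarrow> X \<omega>' = X \<omega> \<longleftrightarrow> X' \<omega>' = X' \<omega>"
  shows "self_info M X Y \<omega> = self_info M X' Y' \<omega>"
proof -
  have "rv_prob M Y \<omega> = rv_prob M Y' \<omega>"
    by (rule rv_prob_cong) (use assms in blast)+
  moreover have "rv_prob M (\<lambda>\<omega>. (X \<omega>, Y \<omega>)) \<omega> = rv_prob M (\<lambda>\<omega>. (X' \<omega>, Y' \<omega>)) \<omega>"
    by (rule rv_prob_cong) (use assms in blast)+
  ultimately show ?thesis by (simp add: self_info_def)
qed

text \<open>Conditional entropy depends only on the partition of the support by Y and on how X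
  refines each of its blocks. Regrouping tuples, and adding to X or removing from it anything that Y
  determines, are instances.\<close>

lemma Hc_cong:
  assumes "\<And>\<omega> \<omega>'. \<omega> \<in> set_pmf M \<Longrightarrow> \<omega>' \<in> set_pmf M \<Longrightarrow> Y \<omega>' = Y \<omega> \<longleftrightarrow> Y' \<omega>' = Y' \<omega>"
    and "\<And>\<omega> \<omega>'. \<omega> \<in> set_pmf M \<Longrightarrow> \<omega>' \<in> set_pmf M \<Longrightarrow> Y \<omega>' = Y \<omega> \<Longrightarrow> Y' \<omega>' = Y' \<omega>
      \<Longrightarrow> X \<omega>' = X \<omega> \<longleftrightarrow> X' \<omega>' = X' \<omega>"
  shows "Hc M X Y = Hc M X' Y'"
  unfolding Hc_def
proof (intro integral_cong_AE)
  show "AE \<omega> in measure_pmf M. self_info M X Y \<omega> = self_info M X' Y' \<omega>"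
    unfolding AE_measure_pmf_iff by (intro ballI self_info_cong; (rule assms)?; assumption)
qed auto

lemma integrable_self_info_cong:
  assumes "\<And>\<omega> \<omega>'. \<omega> \<in> set_pmf M \<Longrightarrow> \<omega>' \<in> set_pmf M \<Longrightarrow> Y \<omega>' = Y \<omega> \<longleftrightarrow> Y' \<omega>' = Y' \<omega>"
    and "\<And>\<omega> \<omega>'. \<omega> \<in> set_pmf M \<Longrightarrow> \<omega>' \<in> set_pmf M \<Longrightarrow> Y \<omega>' = Y \<omega> \<Longrightarrow> Y' \<omega>' = Y' \<omega>
      \<Longrightarrow> X \<omega>' = X \<omega> \<longleftrightarrow> X' \<omega>' = X' \<omega>"
  shows "integrable (measure_pmf M) (self_info M X Y) \<longleftrightarrow> integrable (measure_pmf M) (self_info M X' Y')"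
proof (intro integrable_cong_AE)
  show "AE \<omega> in measure_pmf M. self_info M X Y \<omega> = self_info M X' Y' \<omega>"
    unfolding AE_measure_pmf_iff by (intro ballI self_info_cong; (rule assms)?; assumption)
qed auto

lemma Hc_nonneg: "0 \<le> Hc M X Y"
  unfolding Hc_def by (intro integral_nonneg_AE) (auto simp: AE_measure_pmf_iff self_info_nonneg)

lemma nn_integral_pmf_snd:
  "(\<integral>\<^sup>+z. pmf p (y, z) \<partial>count_space UNIV) = pmf (map_pmf fst p) y"
proof -
  have "(\<integral>\<^sup>+z. pmf p (y, z) \<partial>count_space UNIV) = emeasure (measure_pmf p) (Pair y ` UNIV)"
    by (rule nn_integral_pmf') (auto intro: inj_onI)
  also have "Pair y ` UNIV = fst -` {y}" by auto
  finally show ?thesis by (simp add: pmf_map measure_pmf.emeasure_eq_measure)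
qed

text \<open>The integrand is the likelihood ratio between the law that makes X and Z conditionally
  independent given Y and the true law.\<close>
lemma markov_ratio_le_1:
  "(\<integral>\<^sup>+\<omega>. ennreal (rv_prob M (\<lambda>\<omega>. (X \<omega>, Y \<omega>)) \<omega> * rv_prob M (\<lambda>\<omega>. (Y \<omega>, Z \<omega>)) \<omega>
      / (rv_prob M Y \<omega> * rv_prob M (\<lambda>\<omega>. (X \<omega>, Y \<omega>, Z \<omega>)) \<omega>)) \<partial>measure_pmf M) \<le> 1"
proof -
  define N where "N = map_pmf (\<lambda>\<omega>. ((X \<omega>, Y \<omega>), Z \<omega>)) M"
  define pXY where "pXY = map_pmf (\<lambda>\<omega>. (X \<omega>, Y \<omega>)) M"
  define pYZ where "pYZ = map_pmf (\<lambda>\<omega>. (Y \<omega>, Z \<omega>)) M"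
  define pY where "pY = map_pmf Y M"
  have pY: "pY = map_pmf fst pYZ" by (simp add: pY_def pYZ_def map_pmf_comp)
  define G where "G = (\<lambda>(u, z). pmf pXY u * pmf pYZ (snd u, z) / pmf pY (snd u))"
  have Gnn: "0 \<le> G v" for v by (auto simp: G_def split: prod.split)
  have "rv_prob M (\<lambda>\<omega>. (X \<omega>, Y \<omega>, Z \<omega>)) \<omega> = pmf N ((X \<omega>, Y \<omega>), Z \<omega>)" for \<omega>
    unfolding rv_prob_def N_def pmf_map by (rule arg_cong[where f="measure _"]) auto
  then have "(\<integral>\<^sup>+\<omega>. ennreal (rv_prob M (\<lambda>\<omega>. (X \<omega>, Y \<omega>)) \<omega> * rv_prob M (\<lambda>\<omega>. (Y \<omega>, Z \<omega>)) \<omega>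
      / (rv_prob M Y \<omega> * rv_prob M (\<lambda>\<omega>. (X \<omega>, Y \<omega>, Z \<omega>)) \<omega>)) \<partial>measure_pmf M)
     = (\<integral>\<^sup>+v. ennreal (G v / pmf N v) \<partial>measure_pmf N)"
    by (simp add: N_def G_def pXY_def pYZ_def pY_def rv_prob_pmf)
  also have "\<dots> = (\<integral>\<^sup>+v. ennreal (pmf N v) * ennreal (G v / pmf N v) \<partial>count_space UNIV)"
    by (rule nn_integral_measure_pmf)
  \<comment> \<open>Off the support of \<open>N\<close> the left integrand vanishes, whereas
    \<open>G\<close>, the conditionally independent law, may have mass there; hence an
    inequality.\<close>
  also have "\<dots> \<le> (\<integral>\<^sup>+v. ennreal (G v) \<partial>count_space UNIV)"
    by (intro nn_integral_mono) (auto simp: ennreal_mult[symmetric] Gnn intro!: ennreal_leI)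
  also have "\<dots> = (\<integral>\<^sup>+u. \<integral>\<^sup>+z. ennreal (G (u, z)) \<partial>count_space UNIV \<partial>count_space UNIV)"
    by (rule nn_integral_fst_count_space[symmetric])
  also have "\<dots> = (\<integral>\<^sup>+u. ennreal (pmf pXY u / pmf pY (snd u)) *
       (\<integral>\<^sup>+z. pmf pYZ (snd u, z) \<partial>count_space UNIV) \<partial>count_space UNIV)"
    by (subst nn_integral_cmult[symmetric])
       (auto simp: G_def ennreal_mult[symmetric] field_simps intro!: nn_integral_cong)
  also have "\<dots> \<le> (\<integral>\<^sup>+u. ennreal (pmf pXY u) \<partial>count_space UNIV)"
    by (intro nn_integral_mono)
       (auto simp: nn_integral_pmf_snd pY[symmetric] ennreal_mult[symmetric] intro!: ennreal_leI)
  also have "\<dots> = 1" by (simp add: nn_integral_pmf)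
  finally show ?thesis .
qed

text \<open>\<open>ln x \<le> x - 1\<close> is applied pointwise to the ratio f, whose mean is at
  most 1. The pointwise form \<open>key\<close> also dominates the nonnegative density on its left,
  so integrability comes out of the same estimate.\<close>

lemma self_info_conditioning:
  fixes X :: "'m \<Rightarrow> 'a" and Y :: "'m \<Rightarrow> 'b" and Z :: "'m \<Rightarrow> 'c"
  assumes int: "integrable (measure_pmf M) (self_info M X Y)"
  shows "integrable (measure_pmf M) (self_info M X (\<lambda>\<omega>. (Y \<omega>, Z \<omega>)))"
    and "Hc M X (\<lambda>\<omega>. (Y \<omega>, Z \<omega>)) \<le> Hc M X Y"
proof -
  define f where "f = (\<lambda>\<omega>. rv_prob M (\<lambda>\<omega>. (X \<omega>, Y \<omega>)) \<omega> * rv_prob M (\<lambda>\<omega>. (Y \<omega>, Z \<omega>)) \<omega>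
      / (rv_prob M Y \<omega> * rv_prob M (\<lambda>\<omega>. (X \<omega>, Y \<omega>, Z \<omega>)) \<omega>))"
  have f0: "0 \<le> f \<omega>" for \<omega> by (simp add: f_def rv_prob_def)
  have nf: "(\<integral>\<^sup>+\<omega>. ennreal (f \<omega>) \<partial>measure_pmf M) \<le> 1"
    unfolding f_def by (rule markov_ratio_le_1)
  then have "(\<integral>\<^sup>+\<omega>. ennreal (f \<omega>) \<partial>measure_pmf M) < \<infinity>"
    using order_le_less_trans[OF nf] by simp
  then have intf: "integrable (measure_pmf M) f" using f0 by (intro integrableI_nonneg) auto
  have Ef: "measure_pmf.expectation M f \<le> 1"
    using nf nn_integral_eq_integral[OF intf] f0 by simp
  have key: "self_info M X (\<lambda>\<omega>. (Y \<omega>, Z \<omega>)) \<omega> \<le> self_info M X Y \<omega> + (f \<omega> - 1) / ln 2"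
    if "\<omega> \<in> set_pmf M" for \<omega>
  proof -
    note pos = rv_prob_pos[OF that, of Y] rv_prob_pos[OF that, of "\<lambda>\<omega>. (X \<omega>, Y \<omega>)"]
      rv_prob_pos[OF that, of "\<lambda>\<omega>. (Y \<omega>, Z \<omega>)"] rv_prob_pos[OF that, of "\<lambda>\<omega>. (X \<omega>, Y \<omega>, Z \<omega>)"]
    have "f \<omega> > 0" using pos by (simp add: f_def)
    then have "log 2 (f \<omega>) \<le> (f \<omega> - 1) / ln 2"
      by (simp add: log_def divide_right_mono ln_le_minus_one)
    moreover have "log 2 (f \<omega>) = self_info M X (\<lambda>\<omega>. (Y \<omega>, Z \<omega>)) \<omega> - self_info M X Y \<omega>"
      unfolding f_def self_info_def using pos by (simp add: log_mult log_divide less_imp_neq[symmetric])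
    ultimately show ?thesis by simp
  qed
  have intb: "integrable (measure_pmf M) (\<lambda>\<omega>. self_info M X Y \<omega> + (f \<omega> - 1) / ln 2)"
    using int intf by simp
  show 1: "integrable (measure_pmf M) (self_info M X (\<lambda>\<omega>. (Y \<omega>, Z \<omega>)))"
    by (rule Bochner_Integration.integrable_bound[OF intb])
       (auto simp: AE_measure_pmf_iff self_info_nonneg intro!: order_trans[OF key abs_ge_self])
  have "Hc M X (\<lambda>\<omega>. (Y \<omega>, Z \<omega>)) \<le> measure_pmf.expectation M (\<lambda>\<omega>. self_info M X Y \<omega> + (f \<omega> - 1) / ln 2)"
    unfolding Hc_def by (intro integral_mono_AE 1 intb) (auto simp: AE_measure_pmf_iff key)
  also have "\<dots> = Hc M X Y + (measure_pmf.expectation M f - 1) / ln 2"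
    using int intf by (simp add: Hc_def)
  also have "\<dots> \<le> Hc M X Y" using Ef by (simp add: field_simps)
  finally show "Hc M X (\<lambda>\<omega>. (Y \<omega>, Z \<omega>)) \<le> Hc M X Y" .
qed

text \<open>Finite entropy of X makes all its conditional entropies integrable, whatever the
  conditioning variable; random functions and codes in that place may have infinite entropy.\<close>

lemma fin_rv_integrable:
  assumes "fin_rv M X"
  shows "integrable (measure_pmf M) (self_info M X Y)"
proof -
  have "integrable (measure_pmf M) (self_info M X (\<lambda>\<omega>. ((), Y \<omega>)))"
    using assms unfolding fin_rv_def by (rule self_info_conditioning)
  also have "?this \<longleftrightarrow> integrable (measure_pmf M) (self_info M X Y)"
    by (rule integrable_self_info_cong) auto
  finally show ?thesis .
qed

lemma Hc_mono_cond:
  assumes "fin_rv M X"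
    and det: "\<And>\<omega> \<omega>'. \<omega> \<in> set_pmf M \<Longrightarrow> \<omega>' \<in> set_pmf M \<Longrightarrow> Z \<omega>' = Z \<omega> \<Longrightarrow> Y \<omega>' = Y \<omega>"
  shows "Hc M X Z \<le> Hc M X Y"
proof -
  have "Hc M X Z = Hc M X (\<lambda>\<omega>. (Y \<omega>, Z \<omega>))"
    by (rule Hc_cong) (use det in blast)+
  also have "\<dots> \<le> Hc M X Y" by (intro self_info_conditioning fin_rv_integrable assms)
  finally show ?thesis .
qed

lemma self_info_chain:
  assumes "\<omega> \<in> set_pmf M"
  shows "self_info M (\<lambda>\<omega>. (X \<omega>, X' \<omega>)) Y \<omega>
    = self_info M X (\<lambda>\<omega>. (X' \<omega>, Y \<omega>)) \<omega> + self_info M X' Y \<omega>"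
proof -
  have "rv_prob M (\<lambda>\<omega>. (X \<omega>, X' \<omega>, Y \<omega>)) \<omega> = rv_prob M (\<lambda>\<omega>. ((X \<omega>, X' \<omega>), Y \<omega>)) \<omega>"
    by (rule rv_prob_cong) (use assms in auto)
  then show ?thesis by (simp add: self_info_def)
qed

lemma fin_rv_pair:
  assumes "fin_rv M X" "fin_rv M X'"
  shows "fin_rv M (\<lambda>\<omega>. (X \<omega>, X' \<omega>))"
proof -
  have "integrable (measure_pmf M) (\<lambda>\<omega>. self_info M X (\<lambda>\<omega>. (X' \<omega>, ())) \<omega> + self_info M X' (\<lambda>_. ()) \<omega>)"
    using assms by (intro Bochner_Integration.integrable_add fin_rv_integrable)
  then show ?thesis unfolding fin_rv_def
    by (rule integrable_cong_AE_imp) (auto simp: AE_measure_pmf_iff self_info_chain)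
qed

lemma Hc_chain:
  assumes "fin_rv M X" "fin_rv M X'"
  shows "Hc M (\<lambda>\<omega>. (X \<omega>, X' \<omega>)) Y = Hc M X (\<lambda>\<omega>. (X' \<omega>, Y \<omega>)) + Hc M X' Y"
proof -
  have "Hc M (\<lambda>\<omega>. (X \<omega>, X' \<omega>)) Y
      = measure_pmf.expectation M (\<lambda>\<omega>. self_info M X (\<lambda>\<omega>. (X' \<omega>, Y \<omega>)) \<omega> + self_info M X' Y \<omega>)"
    unfolding Hc_def by (intro integral_cong_AE) (auto simp: AE_measure_pmf_iff self_info_chain)
  then show ?thesis using assms
    by (simp add: Hc_def fin_rv_integrable)
qed

lemma fin_rv_mono:
  assumes "fin_rv M X"
    and det: "\<And>\<omega> \<omega>'. \<omega> \<in> set_pmf M \<Longrightarrow> \<omega>' \<in> set_pmf M \<Longrightarrow> X \<omega>' = X \<omega> \<Longrightarrow> X' \<omega>' = X' \<omega>"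
  shows "fin_rv M X'"
  unfolding fin_rv_def
proof (rule Bochner_Integration.integrable_bound)
  show "integrable (measure_pmf M) (self_info M X (\<lambda>_. ()))" using assms by (simp add: fin_rv_def)
  show "AE \<omega> in measure_pmf M. norm (self_info M X' (\<lambda>_. ()) \<omega>) \<le> norm (self_info M X (\<lambda>_. ()) \<omega>)"
    unfolding AE_measure_pmf_iff
  proof
    fix \<omega> assume \<omega>: "\<omega> \<in> set_pmf M"
    have "rv_prob M (\<lambda>\<omega>. (X \<omega>, ())) \<omega> \<le> rv_prob M (\<lambda>\<omega>. (X' \<omega>, ())) \<omega>"
      by (rule rv_prob_mono) (use \<omega> det in blast)+
    then show "norm (self_info M X' (\<lambda>_. ()) \<omega>) \<le> norm (self_info M X (\<lambda>_. ()) \<omega>)"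
      using self_info_nonneg[OF \<omega>, of X "\<lambda>_. ()"] self_info_nonneg[OF \<omega>, of X' "\<lambda>_. ()"]
        rv_prob_pos[OF \<omega>, of "\<lambda>\<omega>. (X \<omega>, ())"] rv_prob_pos[OF \<omega>, of "\<lambda>\<omega>. (X' \<omega>, ())"]
      by (simp add: self_info_def)
  qed
qed simp

lemma Hc_determined:
  assumes "\<And>\<omega> \<omega>'. \<omega> \<in> set_pmf M \<Longrightarrow> \<omega>' \<in> set_pmf M \<Longrightarrow> Y \<omega>' = Y \<omega> \<Longrightarrow> X \<omega>' = X \<omega>"
  shows "Hc M X Y = 0"
proof -
  have "Hc M X Y = Hc M (\<lambda>_. ()) Y" by (rule Hc_cong) (use assms in blast)+
  also have "self_info M (\<lambda>_. ()) Y = (\<lambda>_. 0)"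
    by (auto simp: self_info_def rv_prob_def)
  then have "Hc M (\<lambda>_. ()) Y = 0" by (simp add: Hc_def)
  finally show ?thesis .
qed

lemma Hc_triangle:
  assumes "fin_rv M X" "fin_rv M X'"
  shows "Hc M X Y \<le> Hc M X (\<lambda>\<omega>. (X' \<omega>, Y \<omega>)) + Hc M X' Y"
proof -
  have "Hc M X Y \<le> Hc M X' (\<lambda>\<omega>. (X \<omega>, Y \<omega>)) + Hc M X Y" by (simp add: Hc_nonneg)
  also have "\<dots> = Hc M (\<lambda>\<omega>. (X' \<omega>, X \<omega>)) Y" by (simp add: Hc_chain assms)
  also have "\<dots> = Hc M (\<lambda>\<omega>. (X \<omega>, X' \<omega>)) Y" by (rule Hc_cong) auto
  finally show ?thesis by (simp add: Hc_chain assms)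
qed

text \<open>Both sides expand H(X,X' | Y). With constant Y this is the symmetry of mutual
  information, written without subtraction.\<close>

lemma Hc_exchange:
  assumes "fin_rv M X" "fin_rv M X'"
  shows "Hc M X (\<lambda>\<omega>. (X' \<omega>, Y \<omega>)) + Hc M X' Y = Hc M X' (\<lambda>\<omega>. (X \<omega>, Y \<omega>)) + Hc M X Y"
proof -
  have "Hc M (\<lambda>\<omega>. (X \<omega>, X' \<omega>)) Y = Hc M (\<lambda>\<omega>. (X' \<omega>, X \<omega>)) Y" by (rule Hc_cong) auto
  then show ?thesis using assms by (simp add: Hc_chain)
qed

lemma rv_prob_map: "rv_prob (map_pmf h M) X (h \<omega>) = rv_prob M (\<lambda>\<omega>. X (h \<omega>)) \<omega>"
  by (simp add: rv_prob_pmf map_pmf_comp)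

lemma self_info_map: "self_info (map_pmf h M) X Y (h \<omega>) = self_info M (\<lambda>\<omega>. X (h \<omega>)) (\<lambda>\<omega>. Y (h \<omega>)) \<omega>"
  by (simp add: self_info_def rv_prob_map)

lemma Hc_map: "Hc (map_pmf h M) X Y = Hc M (\<lambda>\<omega>. X (h \<omega>)) (\<lambda>\<omega>. Y (h \<omega>))"
  by (simp add: Hc_def self_info_map)

lemma fin_rv_map: "fin_rv (map_pmf h M) X \<longleftrightarrow> fin_rv M (\<lambda>\<omega>. X (h \<omega>))"
  by (simp add: fin_rv_def integrable_map_pmf_eq self_info_map)

text \<open>In \<open>ennreal\<close>, an average over a composed experiment can be split into
  iterated integrals before integrability of the parts is known.\<close>

lemma Hc_nn_integral:
  assumes "fin_rv M X"
  shows "ennreal (Hc M X Y) = (\<integral>\<^sup>+\<omega>. ennreal (self_info M X Y \<omega>) \<partial>measure_pmf M)"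
  unfolding Hc_def using fin_rv_integrable[OF assms]
  by (intro nn_integral_eq_integral[symmetric]) (auto simp: AE_measure_pmf_iff self_info_nonneg)

lemma fin_rv_finite:
  assumes "finite (X ` set_pmf M)"
  shows "fin_rv M X"
  unfolding fin_rv_def
proof (rule measure_pmf.integrable_const_bound)
  let ?h = "\<lambda>x. \<bar>log 2 (pmf (map_pmf X M) x)\<bar>"
  show "AE \<omega> in measure_pmf M. norm (self_info M X (\<lambda>_. ()) \<omega>) \<le> Max (?h ` X ` set_pmf M)"
    unfolding AE_measure_pmf_iff
  proof
    fix \<omega> assume \<omega>: "\<omega> \<in> set_pmf M"
    have "rv_prob M (\<lambda>\<omega>. (X \<omega>, ())) \<omega> = rv_prob M X \<omega>" by (rule rv_prob_cong) (use \<omega> in auto)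
    then have "norm (self_info M X (\<lambda>_. ()) \<omega>) = ?h (X \<omega>)"
      by (simp add: self_info_def rv_prob_pmf)
    also have "\<dots> \<le> Max (?h ` X ` set_pmf M)"
      using \<omega> assms by (intro Max_ge) auto
    finally show "norm (self_info M X (\<lambda>_. ()) \<omega>) \<le> Max (?h ` X ` set_pmf M)" .
  qed
qed simp

section \<open>The functional representation lemma on finite alphabets\<close>

abbreviation exp1 :: "real measure" where
  "exp1 \<equiv> density lborel (exponential_density 1)"

lemma prob_space_exp1: "prob_space exp1"
  by (rule prob_space_exponential_density) simp

lemma product_sigma_finite_exp1: "product_sigma_finite (\<lambda>_. exp1)"
  using prob_space_exp1
  by (simp add: product_sigma_finite_def prob_space_imp_sigma_finite)

lemma emeasure_exp1_greaterThan:
  assumes "0 \<le> a" shows "emeasure exp1 {a<..} = ennreal (exp (- a))"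
proof -
  interpret prob_space exp1 by (rule prob_space_exp1)
  have "distributed exp1 lborel (\<lambda>x. x) (exponential_density 1)"
    unfolding distributed_def by (auto simp: distr_id2)
  from exponential_distributedD_gt[OF this assms] show ?thesis
    by (simp add: emeasure_eq_measure greaterThan_def)
qed

lemma nn_integral_exp1:
  assumes [measurable]: "h \<in> borel_measurable borel"
  shows "(\<integral>\<^sup>+x. h x \<partial>exp1) = (\<integral>\<^sup>+x. h x * ennreal (exp (- x)) * indicator {0..} x \<partial>lborel)"
  by (subst nn_integral_density)
     (auto simp: exponential_density_def intro!: nn_integral_cong split: split_indicator simp: mult.commute)

text \<open>The condition says that t rings first in a race of independent exponential clocks whose
  rates are given by k.\<close>
lemma exponential_race:
  fixes k :: "'t \<Rightarrow> real" and h :: "real \<Rightarrow> ennreal"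
  assumes fin: "finite \<tau>" and t: "t \<in> \<tau>" and nn: "\<And>t. 0 \<le> k t" and pos: "0 < k t"
    and one: "sum k \<tau> = 1" and h[measurable]: "h \<in> borel_measurable borel"
  shows "(\<integral>\<^sup>+\<omega>. (if \<forall>t'\<in>\<tau> - {t}. \<omega> t * k t' < \<omega> t' * k t then h (\<omega> t) else 0) \<partial>PiM \<tau> (\<lambda>_. exp1))
    = (\<integral>\<^sup>+x. h x * ennreal (exp (- x / k t)) * indicator {0..} x \<partial>lborel)"
proof -
  interpret product_sigma_finite "\<lambda>_. exp1" by (rule product_sigma_finite_exp1)
  define J where "J = \<tau> - {t}"
  have J: "finite J" "t \<notin> J" "\<tau> = insert t J" using fin t by (auto simp: J_def)
  have tJ: "t' \<noteq> t" if "t' \<in> J" for t' using that J by auto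
  define f where "f = (\<lambda>\<omega>. if \<forall>t'\<in>J. \<omega> t * k t' < \<omega> t' * k t then h (\<omega> t) else 0)"
  have f[measurable]: "f \<in> borel_measurable (PiM (insert t J) (\<lambda>_. exp1))"
    unfolding f_def using J(1) by measurable
  have "(\<integral>\<^sup>+\<omega>. f \<omega> \<partial>PiM (insert t J) (\<lambda>_. exp1))
      = (\<integral>\<^sup>+y. \<integral>\<^sup>+\<omega>. f (fun_upd \<omega> t y) \<partial>PiM J (\<lambda>_. exp1) \<partial>exp1)"
    by (rule product_nn_integral_insert_rev) (use J f in auto)
  \<comment> \<open>Given \<open>\<omega> t = y\<close> the other clocks are independent, and t'
    loses iff its clock exceeds \<open>y * k t' / k t\<close>. The survival exponents add up to
    \<open>y * (1 - k t) / k t\<close>, which the density \<open>exp (- y)\<close> completes to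
    \<open>y / k t\<close>.\<close>
  also have "\<dots> = (\<integral>\<^sup>+y. h y * ennreal (\<Prod>t'\<in>J. exp (- y * k t' / k t)) \<partial>exp1)"
  proof (rule nn_integral_cong_AE)
    have "AE y in exp1. 0 \<le> y"
      by (subst AE_density) (auto simp: exponential_density_def not_less)
    then show "AE y in exp1. (\<integral>\<^sup>+\<omega>. f (fun_upd \<omega> t y) \<partial>PiM J (\<lambda>_. exp1))
        = h y * ennreal (\<Prod>t'\<in>J. exp (- y * k t' / k t))"
    proof eventually_elim
      fix y :: real assume y: "0 \<le> y"
      have "f (fun_upd \<omega> t y) = h y * (\<Prod>t'\<in>J. indicator {y * k t' / k t<..} (\<omega> t'))" for \<omega>
      proof (cases "\<forall>t'\<in>J. y * k t' / k t < \<omega> t'")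
        case True
        then have "\<forall>t'\<in>J. y * k t' < \<omega> t' * k t" using pos by (simp add: field_simps)
        moreover have "(\<Prod>t'\<in>J. indicator {y * k t' / k t<..} (\<omega> t')) = (1::ennreal)"
          by (rule prod.neutral) (use True in auto)
        ultimately show ?thesis using tJ by (auto simp: f_def)
      next
        case False
        then obtain t' where t': "t' \<in> J" "\<not> y * k t' / k t < \<omega> t'" by auto
        then have "\<not> y * k t' < \<omega> t' * k t" using pos by (simp add: field_simps)
        moreover have "(\<Prod>t'\<in>J. indicator {y * k t' / k t<..} (\<omega> t')) = (0::ennreal)"
          by (rule prod_zero) (use t' J in \<open>auto intro!: bexI[of _ t']\<close>)
        ultimately show ?thesis using tJ t' by (auto simp: f_def)
      qed
      then have "(\<integral>\<^sup>+\<omega>. f (fun_upd \<omega> t y) \<partial>PiM J (\<lambda>_. exp1))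
        = h y * (\<integral>\<^sup>+\<omega>. (\<Prod>t'\<in>J. indicator {y * k t' / k t<..} (\<omega> t')) \<partial>PiM J (\<lambda>_. exp1))"
        using J(1) by (simp add: nn_integral_cmult)
      also have "(\<integral>\<^sup>+\<omega>. (\<Prod>t'\<in>J. indicator {y * k t' / k t<..} (\<omega> t')) \<partial>PiM J (\<lambda>_. exp1))
         = (\<Prod>t'\<in>J. \<integral>\<^sup>+x. indicator {y * k t' / k t<..} x \<partial>exp1)"
        by (rule product_nn_integral_prod) (use J in auto)
      also have "\<dots> = (\<Prod>t'\<in>J. ennreal (exp (- (y * k t' / k t))))"
        by (rule prod.cong) (use y nn pos in \<open>auto simp: emeasure_exp1_greaterThan\<close>)
      finally show "(\<integral>\<^sup>+\<omega>. f (fun_upd \<omega> t y) \<partial>PiM J (\<lambda>_. exp1))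
         = h y * ennreal (\<Prod>t'\<in>J. exp (- y * k t' / k t))"
        by (simp only: prod_ennreal exp_ge_zero minus_mult_left[symmetric] minus_divide_left[symmetric])
    qed
  qed
  also have "\<dots> = (\<integral>\<^sup>+x. h x * ennreal (\<Prod>t'\<in>J. exp (- x * k t' / k t)) * ennreal (exp (- x)) * indicator {0..} x \<partial>lborel)"
    by (rule nn_integral_exp1) measurable
  also have "\<dots> = (\<integral>\<^sup>+x. h x * ennreal (exp (- x / k t)) * indicator {0..} x \<partial>lborel)"
  proof -
    have "(\<Prod>t'\<in>J. exp (- x * k t' / k t)) * exp (- x) = exp (- x / k t)" for x
    proof -
      have "sum k J = 1 - k t" using one J by (simp add: sum.insert)
      moreover have "(\<Prod>t'\<in>J. exp (- x * k t' / k t)) = exp (- x * sum k J / k t)"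
        using J(1) by (simp add: exp_sum[symmetric] sum_distrib_left sum_divide_distrib sum_negf)
      moreover have "- x * (1 - k t) / k t + - x = - x / k t"
        using pos by (simp add: field_simps)
      ultimately show ?thesis by (simp add: exp_add[symmetric])
    qed
    then show ?thesis
      by (intro nn_integral_cong) (simp add: mult.assoc ennreal_mult[symmetric] prod_nonneg)
  qed
  finally show ?thesis by (simp add: J(3) f_def J(2) J_def[symmetric])
qed

text \<open>With c the probability of t given w, the first integral is the probability that t wins
  the race. The quotient of the two, again c, is the mean of the clock of t in that event.\<close>

lemma nn_integral_exp_scaled:
  assumes "0 < c"
  shows "(\<integral>\<^sup>+x. ennreal (exp (- x / c)) * indicator {0..} x \<partial>lborel) = ennreal c"
    and "(\<integral>\<^sup>+x. ennreal x * ennreal (exp (- x / c)) * indicator {0..} x \<partial>lborel) = ennreal (c\<^sup>2)"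
proof -
  have eq: "(\<integral>\<^sup>+x. ennreal (x ^ i) * ennreal (exp (- x / c)) * indicator {0..} x \<partial>lborel)
      = ennreal c * (\<integral>\<^sup>+x. ennreal (exponential_density (1 / c) x * x ^ i) \<partial>lborel)" for i
    using assms
    by (subst nn_integral_cmult[symmetric])
       (auto simp: exponential_density_def ennreal_mult[symmetric] field_simps
             intro!: nn_integral_cong split: split_indicator)
  show "(\<integral>\<^sup>+x. ennreal (exp (- x / c)) * indicator {0..} x \<partial>lborel) = ennreal c"
    using eq[of 0] nn_integral_erlang_ith_moment[of "1 / c" 0 0] assms by simp
  show "(\<integral>\<^sup>+x. ennreal x * ennreal (exp (- x / c)) * indicator {0..} x \<partial>lborel) = ennreal (c\<^sup>2)"
    using eq[of 1] nn_integral_erlang_ith_moment[of "1 / c" 0 1] assms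
    by (simp add: ennreal_mult[symmetric] power2_eq_square)
qed

text \<open>At c = 1 the integrand is the Lomax density, a Pareto law shifted to start at 0, with
  exponent s and scale b; replacing x by x / c multiplies the mass by c.\<close>

lemma nn_integral_power_law:
  fixes b s c :: real
  assumes "0 < b" "0 < s" "0 < c"
  shows "(\<integral>\<^sup>+x. ennreal (s * b powr s * (x / c + b) powr (- s - 1)) * indicator {0..} x \<partial>lborel) = ennreal c"
proof -
  let ?F = "\<lambda>x. - c * b powr s * (x / c + b) powr (- s)"
  have "(\<integral>\<^sup>+x. ennreal (s * b powr s * (x / c + b) powr (- s - 1)) * indicator {0..} x \<partial>lborel)
      = ennreal (0 - ?F 0)"
  proof (rule nn_integral_FTC_atLeast)
    fix x :: real assume "0 \<le> x"
    then have "0 < x / c + b" using assms by (simp add: add_nonneg_pos)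
    then show "(?F has_real_derivative s * b powr s * (x / c + b) powr (- s - 1)) (at x)"
      using assms by (auto intro!: derivative_eq_intros simp: field_simps)
  next
    have "filterlim (\<lambda>x. x / c + b) at_top at_top"
      using assms by (intro filterlim_tendsto_add_at_top[OF tendsto_const, of _ _ b, unfolded add.commute[of b]] filterlim_at_top_mult_tendsto_pos[OF tendsto_const _ filterlim_ident, of "1 / c", simplified]) auto
    then have "((\<lambda>x. (x / c + b) powr (- s)) \<longlongrightarrow> 0) at_top"
      by (rule tendsto_neg_powr[rotated]) (use assms in auto)
    then have "(?F \<longlongrightarrow> - c * b powr s * 0) at_top" by (intro tendsto_intros)
    then show "(?F \<longlongrightarrow> 0) at_top" by simp
  qed (use assms in auto)
  also have "0 - ?F 0 = c" using assms by (simp add: powr_minus field_simps)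
  finally show ?thesis .
qed

text \<open>The exponential density is at most 1 on the half-line, so a power-law weight in the
  clock scaled by c has mean at most c. With c = P(t), the weights of all symbols t sum to at most 1
  in the mean: Kraft's inequality on average.\<close>

lemma nn_integral_exp1_power_law:
  fixes b s c :: real
  assumes "0 < b" "0 < s" "0 < c"
  shows "(\<integral>\<^sup>+x. ennreal (s * b powr s * (x / c + b) powr (- s - 1)) \<partial>exp1) \<le> ennreal c"
proof -
  have "(\<integral>\<^sup>+x. ennreal (s * b powr s * (x / c + b) powr (- s - 1)) \<partial>exp1)
    = (\<integral>\<^sup>+x. ennreal (s * b powr s * (x / c + b) powr (- s - 1)) * ennreal (exp (- x)) * indicator {0..} x \<partial>lborel)"
    by (rule nn_integral_exp1) measurable
  also have "\<dots> \<le> (\<integral>\<^sup>+x. ennreal (s * b powr s * (x / c + b) powr (- s - 1)) * indicator {0..} x \<partial>lborel)"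
    by (intro nn_integral_mono)
       (use assms in \<open>auto split: split_indicator simp: ennreal_mult[symmetric] intro!: ennreal_leI mult_left_le\<close>)
  also have "\<dots> = ennreal c" by (rule nn_integral_power_law) fact+
  finally show ?thesis .
qed


section \<open>Entropy and cross-entropy on finite alphabets\<close>

lemma ent_finite:
  assumes "finite A" "set_pmf q \<subseteq> A"
  shows "ent q = (\<Sum>t\<in>A. - pmf q t * log 2 (pmf q t))"
proof -
  have "ent q = (\<Sum>\<^sub>\<infinity>t\<in>A. - pmf q t * log 2 (pmf q t))"
    unfolding ent_def by (rule infsum_cong_neutral) (use assms in \<open>auto simp: set_pmf_iff\<close>)
  then show ?thesis using assms by simp
qed

lemma pmf_map_finite:
  assumes "finite (set_pmf p)"
  shows "pmf (map_pmf g p) t = (\<Sum>w\<in>set_pmf p. if g w = t then pmf p w else 0)"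
proof -
  have "pmf (map_pmf g p) t = measure (measure_pmf p) ((g -` {t}) \<inter> set_pmf p)"
    unfolding pmf_map by (rule measure_Int_set_pmf[symmetric])
  also have "\<dots> = sum (pmf p) ((g -` {t}) \<inter> set_pmf p)"
    by (rule measure_measure_pmf_finite) (use assms in auto)
  also have "\<dots> = (\<Sum>w\<in>set_pmf p. if g w = t then pmf p w else 0)"
    using assms by (subst sum.inter_filter[symmetric]) (auto intro!: sum.cong)
  finally show ?thesis .
qed

text \<open>Gibbs' inequality for unnormalised weights, from \<open>ln x \<le> x - 1\<close>. The
  correction \<open>sum q \<tau> - 1\<close> is kept because the weights used later depend on the
  clocks, and their total is controlled only in expectation.\<close>

lemma ent_map_le_cross_entropy:
  fixes p :: "'w pmf" and g :: "'w \<Rightarrow> 't" and q :: "'t \<Rightarrow> real"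
  assumes fin: "finite (set_pmf p)" "finite \<tau>" and g: "g ` set_pmf p \<subseteq> \<tau>"
    and q: "\<And>t. t \<in> \<tau> \<Longrightarrow> 0 < q t"
  shows "ent (map_pmf g p) * ln 2 \<le> (\<Sum>w\<in>set_pmf p. pmf p w * - ln (q (g w))) + sum q \<tau> - 1"
proof -
  let ?\<mu> = "pmf (map_pmf g p)"
  have one: "sum ?\<mu> \<tau> = 1" by (rule sum_pmf_eq_1) (use fin g in auto)
  have "ent (map_pmf g p) * ln 2 = (\<Sum>t\<in>\<tau>. - ?\<mu> t * ln (?\<mu> t))"
    using fin g by (subst ent_finite[of \<tau>]) (auto simp: log_def sum_distrib_right intro!: sum.cong)
  also have "\<dots> \<le> (\<Sum>t\<in>\<tau>. ?\<mu> t * - ln (q t) + q t - ?\<mu> t)"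
  proof (rule sum_mono)
    fix t assume t: "t \<in> \<tau>"
    show "- ?\<mu> t * ln (?\<mu> t) \<le> ?\<mu> t * - ln (q t) + q t - ?\<mu> t"
    proof (cases "?\<mu> t = 0")
      case False
      then have m: "0 < ?\<mu> t" by (simp add: less_le)
      have "ln (q t / ?\<mu> t) \<le> q t / ?\<mu> t - 1" using m q[OF t] by (intro ln_le_minus_one) simp
      then have "?\<mu> t * ln (q t / ?\<mu> t) \<le> ?\<mu> t * (q t / ?\<mu> t - 1)"
        using m by (intro mult_left_mono) auto
      then show ?thesis using m q[OF t] by (simp add: ln_div algebra_simps)
    qed (use q[OF t] in simp)
  qed
  also have "\<dots> = (\<Sum>t\<in>\<tau>. ?\<mu> t * - ln (q t)) + sum q \<tau> - 1"
    by (simp add: sum.distrib sum_subtractf sum_negf one)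
  also have "(\<Sum>t\<in>\<tau>. ?\<mu> t * - ln (q t)) = (\<Sum>w\<in>set_pmf p. pmf p w * - ln (q (g w)))"
  proof -
    have "(\<Sum>t\<in>\<tau>. ?\<mu> t * - ln (q t))
        = (\<Sum>t\<in>\<tau>. \<Sum>w\<in>set_pmf p. if g w = t then pmf p w * - ln (q t) else 0)"
      unfolding pmf_map_finite[OF fin(1)] sum_distrib_right by (intro sum.cong) auto
    also have "\<dots> = (\<Sum>w\<in>set_pmf p. \<Sum>t\<in>\<tau>. if g w = t then pmf p w * - ln (q t) else 0)"
      by (rule sum.swap)
    also have "\<dots> = (\<Sum>w\<in>set_pmf p. pmf p w * - ln (q (g w)))"
      by (intro sum.cong refl) (use fin g in \<open>auto simp: sum.delta\<close>)
    finally show ?thesis .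
  qed
  finally show ?thesis .
qed

text \<open>The same clocks serve all w, and only the rates depend on w; this coupling is what keeps
  the entropy of \<open>G \<omega> w\<close> over w small. The finite range reduces measurability to
  preimages of points.\<close>

lemma exponential_selection:
  fixes L :: "'w set" and \<kappa> :: "'w \<Rightarrow> 't pmf"
  assumes fin: "finite L" "finite \<tau>" and sub: "\<And>w. w \<in> L \<Longrightarrow> set_pmf (\<kappa> w) \<subseteq> \<tau>"
  defines "\<Omega> \<equiv> PiM \<tau> (\<lambda>_. exp1)"
  obtains G :: "('t \<Rightarrow> real) \<Rightarrow> 'w \<Rightarrow> 't" where
    "G \<in> measurable \<Omega> (count_space UNIV)" "finite (range G)"
    "\<And>\<omega> w. w \<in> L \<Longrightarrow> G \<omega> w \<in> set_pmf (\<kappa> w)"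
    "\<And>w t h. w \<in> L \<Longrightarrow> t \<in> set_pmf (\<kappa> w) \<Longrightarrow> (h :: real \<Rightarrow> ennreal) \<in> borel_measurable borel \<Longrightarrow>
      (\<integral>\<^sup>+\<omega>. (if G \<omega> w = t then h (\<omega> t) else 0) \<partial>\<Omega>)
       = (\<integral>\<^sup>+x. h x * ennreal (exp (- x / pmf (\<kappa> w) t)) * indicator {0..} x \<partial>lborel)"
proof -
  interpret \<Omega>: prob_space \<Omega> unfolding \<Omega>_def by (intro prob_space_PiM prob_space_exp1)
  \<comment> \<open>The comparison of \<open>\<omega> t / pmf (\<kappa> w) t\<close> with the other
    ratios, cross-multiplied so that symbols of probability 0 are included.\<close>
  define win where "win = (\<lambda>w t \<omega>. \<forall>t'\<in>\<tau> - {t}. \<omega> t * pmf (\<kappa> w) t' < (\<omega> t' :: real) * pmf (\<kappa> w) t)"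
  have one: "sum (pmf (\<kappa> w)) \<tau> = 1" if "w \<in> L" for w
    by (rule sum_pmf_eq_1) (use fin sub that in auto)
  have win_uniq: "t = t'" if "win w t \<omega>" "win w t' \<omega>" "t \<in> \<tau>" "t' \<in> \<tau>" for w t t' \<omega>
  proof (rule ccontr)
    assume "t \<noteq> t'"
    with that have "\<omega> t * pmf (\<kappa> w) t' < \<omega> t' * pmf (\<kappa> w) t" "\<omega> t' * pmf (\<kappa> w) t < \<omega> t * pmf (\<kappa> w) t'"
      by (auto simp: win_def)
    then show False by simp
  qed
  have win_meas[measurable]: "Measurable.pred \<Omega> (win w t)" if "t \<in> \<tau>" for w t
  proof -
    have [measurable]: "(\<lambda>\<omega>. \<omega> t') \<in> borel_measurable \<Omega>" if "t' \<in> \<tau>" for t'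
      using measurable_component_singleton[OF that, of "\<lambda>_. exp1"] by (simp add: \<Omega>_def)
    show ?thesis unfolding win_def pred_def
      by (intro sets.sets_Collect_finite_All) (use that fin in auto)
  qed
  \<comment> \<open>The output if no clock wins, for instance on a tie. It lies in the support, so
    that the support condition on \<open>G\<close> holds for every \<omega> and not just almost
    surely.\<close>
  define t0 where "t0 = (\<lambda>w. SOME t. t \<in> set_pmf (\<kappa> w))"
  have t0: "t0 w \<in> set_pmf (\<kappa> w)" for w unfolding t0_def by (rule someI_ex) (use set_pmf_not_empty in fast)
  \<comment> \<open>\<open>undefined\<close> off L makes \<open>G \<omega>\<close> an element of the
    finite set \<open>PiE L (\<lambda>_. \<tau>)\<close>.\<close>
  define G where "G = (\<lambda>\<omega> w. if w \<in> L then (if \<exists>t\<in>set_pmf (\<kappa> w). win w t \<omega> then THE t. t \<in> set_pmf (\<kappa> w) \<and> win w t \<omega>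
     else t0 w) else undefined)"
  have G_win: "G \<omega> w = t" if "w \<in> L" "t \<in> set_pmf (\<kappa> w)" "win w t \<omega>" for \<omega> w t
  proof -
    have "(THE t. t \<in> set_pmf (\<kappa> w) \<and> win w t \<omega>) = t"
      by (rule the_equality) (use that win_uniq sub in blast)+
    then show ?thesis using that by (auto simp: G_def)
  qed
  have G_in: "G \<omega> w \<in> set_pmf (\<kappa> w)" if "w \<in> L" for \<omega> w
  proof (cases "\<exists>t\<in>set_pmf (\<kappa> w). win w t \<omega>")
    case True then show ?thesis using G_win that by blast
  next
    case False then show ?thesis using that t0 by (simp add: G_def)
  qed
  have range: "range G \<subseteq> PiE L (\<lambda>_. \<tau>)"
  proof clarify
    fix \<omega>
    have "G \<omega> w = undefined" if "w \<notin> L" for w using that by (simp add: G_def)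
    moreover have "G \<omega> w \<in> \<tau>" if "w \<in> L" for w using G_in[OF that] sub[OF that] by auto
    ultimately show "G \<omega> \<in> PiE L (\<lambda>_. \<tau>)" by (auto simp: PiE_def extensional_def)
  qed
  then have fr: "finite (range G)" using fin by (meson finite_PiE finite_subset)
  have winp: "(\<integral>\<^sup>+\<omega>. (if win w t \<omega> then h (\<omega> t) else 0) \<partial>\<Omega>)
       = (\<integral>\<^sup>+x. h x * ennreal (exp (- x / pmf (\<kappa> w) t)) * indicator {0..} x \<partial>lborel)"
    if "w \<in> L" "t \<in> set_pmf (\<kappa> w)" "(h :: real \<Rightarrow> ennreal) \<in> borel_measurable borel" for w t h
    unfolding win_def \<Omega>_def
    by (rule exponential_race) (use that fin sub one in \<open>auto simp: pmf_positive\<close>)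
  have prob_win: "\<Omega>.prob {\<omega>\<in>space \<Omega>. win w t \<omega>} = pmf (\<kappa> w) t"
    if "w \<in> L" "t \<in> set_pmf (\<kappa> w)" for w t
  proof -
    have "t \<in> \<tau>" using that sub by auto
    then have "emeasure \<Omega> {\<omega>\<in>space \<Omega>. win w t \<omega>} = (\<integral>\<^sup>+\<omega>. indicator {\<omega>\<in>space \<Omega>. win w t \<omega>} \<omega> \<partial>\<Omega>)"
      using win_meas by (intro nn_integral_indicator[symmetric]) (simp add: pred_def)
    also have "\<dots> = (\<integral>\<^sup>+\<omega>. (if win w t \<omega> then 1 else 0) \<partial>\<Omega>)"
      by (intro nn_integral_cong) (simp split: split_indicator)
    also have "\<dots> = ennreal (pmf (\<kappa> w) t)"
      using winp[OF that, of "\<lambda>_. 1"] nn_integral_exp_scaled(1)[of "pmf (\<kappa> w) t"] that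
      by (simp add: pmf_positive)
    finally show ?thesis by (simp add: \<Omega>.emeasure_eq_measure)
  qed
  \<comment> \<open>The events that t wins are disjoint and their probabilities
    \<open>pmf (\<kappa> w) t\<close> sum to 1, so ties are null without a separate
    argument.\<close>
  have win_AE: "AE \<omega> in \<Omega>. \<exists>t\<in>set_pmf (\<kappa> w). win w t \<omega>" if w: "w \<in> L" for w
  proof -
    have fs: "finite (set_pmf (\<kappa> w))" using fin sub[OF w] finite_subset by blast
    have [measurable]: "Measurable.pred \<Omega> (win w t)" if "t \<in> set_pmf (\<kappa> w)" for t
      using that sub[OF w] by (intro win_meas) auto
    have "\<Omega>.prob (\<Union>t\<in>set_pmf (\<kappa> w). {\<omega>\<in>space \<Omega>. win w t \<omega>}) = (\<Sum>t\<in>set_pmf (\<kappa> w). \<Omega>.prob {\<omega>\<in>space \<Omega>. win w t \<omega>})"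
    proof (rule \<Omega>.finite_measure_finite_Union[OF fs])
      show "disjoint_family_on (\<lambda>t. {\<omega>\<in>space \<Omega>. win w t \<omega>}) (set_pmf (\<kappa> w))"
        unfolding disjoint_family_on_def using win_uniq sub[OF w] by blast
    qed (auto simp: image_subset_iff)
    also have "\<dots> = 1" using prob_win[OF w] by (simp add: sum_pmf_eq_1[OF fs])
    also have "(\<Union>t\<in>set_pmf (\<kappa> w). {\<omega>\<in>space \<Omega>. win w t \<omega>}) = {\<omega>\<in>space \<Omega>. \<exists>t\<in>set_pmf (\<kappa> w). win w t \<omega>}" by auto
    finally show ?thesis using fs by (subst (asm) \<Omega>.prob_Collect_eq_1) measurable
  qed
  have Gw_meas: "Measurable.pred \<Omega> (\<lambda>\<omega>. G \<omega> w = t)" if w: "w \<in> L" for w t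
  proof (cases "t \<in> set_pmf (\<kappa> w)")
    case True
    have fs: "finite (set_pmf (\<kappa> w))" using fin sub[OF w] finite_subset by blast
    have [measurable]: "Measurable.pred \<Omega> (win w t)" if "t \<in> set_pmf (\<kappa> w)" for t
      using that sub[OF w] by (intro win_meas) auto
    have "(G \<omega> w = t) \<longleftrightarrow> win w t \<omega> \<or> (\<not> (\<exists>t\<in>set_pmf (\<kappa> w). win w t \<omega>) \<and> t = t0 w)" for \<omega>
    proof (cases "\<exists>t\<in>set_pmf (\<kappa> w). win w t \<omega>")
      case True then show ?thesis using G_win[OF w] \<open>t \<in> set_pmf (\<kappa> w)\<close> by blast
    next
      case False
      then have "G \<omega> w = t0 w" using w by (simp add: G_def)
      then show ?thesis using False \<open>t \<in> set_pmf (\<kappa> w)\<close> by auto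
    qed
    then show ?thesis using fs True by simp
  next
    case False
    then have "\<And>\<omega>. G \<omega> w \<noteq> t" using G_in[OF w] by metis
    then show ?thesis by simp
  qed
  have Gm: "G \<in> measurable \<Omega> (count_space UNIV)"
  proof -
    have "G \<in> measurable \<Omega> (count_space (PiE L (\<lambda>_. \<tau>)))"
    proof (subst measurable_count_space_eq2, intro finite_PiE fin, intro conjI ballI)
      show "G \<in> space \<Omega> \<rightarrow> PiE L (\<lambda>_. \<tau>)" using range by auto
      fix g assume g: "g \<in> PiE L (\<lambda>_. \<tau>)"
      have "G -` {g} \<inter> space \<Omega> = {\<omega>\<in>space \<Omega>. \<forall>w\<in>L. G \<omega> w = g w}"
      proof -
        have "G \<omega> = g" if "\<forall>w\<in>L. G \<omega> w = g w" for \<omega>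
        proof (rule PiE_ext)
          show "G \<omega> \<in> PiE L (\<lambda>_. \<tau>)" using range by blast
          show "g \<in> PiE L (\<lambda>_. \<tau>)" by fact
        qed (use that in auto)
        then show ?thesis by auto
      qed
      also have "\<dots> \<in> sets \<Omega>"
        using fin Gw_meas by (intro sets.sets_Collect_finite_All) (auto simp: pred_def)
      finally show "G -` {g} \<inter> space \<Omega> \<in> sets \<Omega>" .
    qed
    then show ?thesis by (rule measurable_compose) simp
  qed
  have G_int: "(\<integral>\<^sup>+\<omega>. (if G \<omega> w = t then h (\<omega> t) else 0) \<partial>\<Omega>)
       = (\<integral>\<^sup>+x. h x * ennreal (exp (- x / pmf (\<kappa> w) t)) * indicator {0..} x \<partial>lborel)"
    if "w \<in> L" "t \<in> set_pmf (\<kappa> w)" "(h :: real \<Rightarrow> ennreal) \<in> borel_measurable borel" for w t h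
  proof -
    have "(\<integral>\<^sup>+\<omega>. (if G \<omega> w = t then h (\<omega> t) else 0) \<partial>\<Omega>) = (\<integral>\<^sup>+\<omega>. (if win w t \<omega> then h (\<omega> t) else 0) \<partial>\<Omega>)"
    proof (rule nn_integral_cong_AE)
      show "AE \<omega> in \<Omega>. (if G \<omega> w = t then h (\<omega> t) else 0) = (if win w t \<omega> then h (\<omega> t) else 0)"
        using win_AE[OF that(1)]
      proof eventually_elim
        case (elim \<omega>)
        then obtain u where u: "u \<in> set_pmf (\<kappa> w)" "win w u \<omega>" by auto
        have "G \<omega> w = u" using G_win[OF that(1) u] .
        then show ?case using u that G_win[OF that(1,2)] by auto
      qed
    qed
    then show ?thesis using winp[OF that] by simp
  qed
  show thesis by (rule that[OF Gm fr G_in G_int])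
qed


text \<open>\<open>Abs_pmf\<close> asks that almost every point be an atom; the points of mass 0 in
  a finite range form a null set.\<close>

lemma pmf_of_random_variable:
  assumes "prob_space \<Omega>" and G: "G \<in> measurable \<Omega> (count_space UNIV)" and fin: "finite (range G)"
  obtains \<Phi> where "measure_pmf \<Phi> = distr \<Omega> (count_space UNIV) G"
proof -
  interpret \<Omega>: prob_space \<Omega> by fact
  let ?D = "distr \<Omega> (count_space UNIV) G"
  interpret D: prob_space ?D by (rule \<Omega>.prob_space_distr[OF G])
  let ?N = "{x \<in> range G. measure ?D {x} = 0}"
  have "emeasure ?D ?N = (\<Sum>x\<in>?N. emeasure ?D {x})"
    by (rule emeasure_eq_sum_singleton) (use fin in auto)
  then have "emeasure ?D ?N = 0" by (simp add: D.emeasure_eq_measure)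
  then have "AE x in ?D. x \<notin> ?N" by (intro AE_not_in) (auto simp: null_sets_def)
  moreover have "AE x in ?D. x \<in> range G" using G by (subst AE_distr_iff) auto
  ultimately have "AE x in ?D. measure ?D {x} \<noteq> 0" by eventually_elim auto
  then have "measure_pmf (Abs_pmf ?D) = ?D"
    by (intro Abs_pmf_inverse) (auto simp: D.prob_space_axioms)
  then show thesis by (rule that)
qed

text \<open>The random function maps w to the symbol t that rings first when the clock of t runs at rate
  \<open>\<kappa> w t\<close>. Given the clocks, its output is encoded by a power law in the clocks scaled by the
  marginal probabilities; b and l are the cutoff and the inverse exponent of that law. The bound
  is linear in I, so that it can be averaged over a conditioning variable.\<close>
lemma strong_functional_representation:
  fixes p :: "'w pmf" and \<kappa> :: "'w \<Rightarrow> 't pmf" and b l :: real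
  assumes finp: "finite (set_pmf p)" and fin\<kappa>: "\<And>w. w \<in> set_pmf p \<Longrightarrow> finite (set_pmf (\<kappa> w))"
    and b: "0 < b" and l: "0 < l"
  defines "I \<equiv> ent (bind_pmf p \<kappa>) - measure_pmf.expectation p (\<lambda>w. ent (\<kappa> w))"
  obtains \<Phi> :: "('w \<Rightarrow> 't) pmf" where
    "\<And>w. w \<in> set_pmf p \<Longrightarrow> map_pmf (\<lambda>g. g w) \<Phi> = \<kappa> w"
    "measure_pmf.expectation \<Phi> (\<lambda>g. ent (map_pmf g p))
       \<le> log 2 l + log 2 (1 + b) + I + (I + log 2 (1 + 1 / b)) / l"
    "finite (set_pmf \<Phi>)"
proof -
  define L where "L = set_pmf p"
  define \<tau> where "\<tau> = (\<Union>w\<in>L. set_pmf (\<kappa> w))"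
  define \<Omega> where "\<Omega> = PiM \<tau> (\<lambda>_::'t. exp1)"
  define P where "P = pmf (bind_pmf p \<kappa>)"
  define k where "k = (\<lambda>w. pmf (\<kappa> w))"
  define s where "s = 1 / l"
  have s: "0 < s" using l by (simp add: s_def)
  have finL: "finite L" and fin\<tau>: "finite \<tau>" using finp fin\<kappa> by (auto simp: L_def \<tau>_def)
  have sub: "set_pmf (\<kappa> w) \<subseteq> \<tau>" if "w \<in> L" for w using that by (auto simp: \<tau>_def)
  have set_bind: "set_pmf (bind_pmf p \<kappa>) = \<tau>" by (auto simp: \<tau>_def L_def)
  have P_pos: "0 < P t" if "t \<in> \<tau>" for t using that set_bind by (simp add: P_def pmf_positive)
  have P_sum: "P t = (\<Sum>w\<in>L. pmf p w * k w t)" for t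
    unfolding P_def pmf_bind k_def L_def
    by (subst integral_measure_pmf[of "set_pmf p"]) (use finp in auto)
  have P1: "sum P \<tau> = 1" unfolding P_def by (rule sum_pmf_eq_1) (use fin\<tau> set_bind in auto)
  have p1: "sum (pmf p) L = 1" by (rule sum_pmf_eq_1) (use finL in \<open>auto simp: L_def\<close>)
  have k1: "sum (k w) \<tau> = 1" if "w \<in> L" for w
    unfolding k_def by (rule sum_pmf_eq_1) (use fin\<tau> sub that in auto)
  interpret \<Omega>: prob_space \<Omega> unfolding \<Omega>_def by (intro prob_space_PiM prob_space_exp1)
  obtain G :: "('t \<Rightarrow> real) \<Rightarrow> 'w \<Rightarrow> 't" where
    G[measurable]: "G \<in> measurable \<Omega> (count_space UNIV)" and fr: "finite (range G)"
    and G_in: "\<And>\<omega> w. w \<in> L \<Longrightarrow> G \<omega> w \<in> set_pmf (\<kappa> w)"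
    and G_int: "\<And>w t h. w \<in> L \<Longrightarrow> t \<in> set_pmf (\<kappa> w) \<Longrightarrow> (h :: real \<Rightarrow> ennreal) \<in> borel_measurable borel \<Longrightarrow>
      (\<integral>\<^sup>+\<omega>. (if G \<omega> w = t then h (\<omega> t) else 0) \<partial>\<Omega>)
       = (\<integral>\<^sup>+x. h x * ennreal (exp (- x / pmf (\<kappa> w) t)) * indicator {0..} x \<partial>lborel)"
    by (rule exponential_selection[OF finL fin\<tau> sub, folded \<Omega>_def]; (rule that; assumption)?)
  have G_in\<tau>: "G \<omega> w \<in> \<tau>" if "w \<in> L" for \<omega> w using G_in sub that by blast
  obtain \<Phi> where \<Phi>: "measure_pmf \<Phi> = distr \<Omega> (count_space UNIV) G"
    using pmf_of_random_variable[OF \<Omega>.prob_space_axioms G fr] by blast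
  have [measurable]: "Measurable.pred \<Omega> (\<lambda>\<omega>. G \<omega> w = t)" for w t
    by (rule measurable_compose[OF G]) simp
  have coord[measurable]: "(\<lambda>\<omega>. \<omega> t) \<in> borel_measurable \<Omega>" if "t \<in> \<tau>" for t
    using measurable_component_singleton[OF that, of "\<lambda>_. exp1"] by (simp add: \<Omega>_def)
  have \<omega>_nonneg: "AE \<omega> in \<Omega>. \<forall>t\<in>\<tau>. 0 \<le> \<omega> t"
  proof (rule AE_finite_allI[OF fin\<tau>])
    fix t assume "t \<in> \<tau>"
    have "AE x in exp1. 0 \<le> x" by (subst AE_density) (auto simp: exponential_density_def not_less)
    then show "AE \<omega> in \<Omega>. 0 \<le> \<omega> t"
      unfolding \<Omega>_def using \<open>t \<in> \<tau>\<close> by (intro AE_PiM_component prob_space_exp1) auto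
  qed
  have prob: "has_bochner_integral \<Omega> (\<lambda>\<omega>. if G \<omega> w = t then 1 else 0) (k w t)"
    if w: "w \<in> L" for w t
  proof (cases "t \<in> set_pmf (\<kappa> w)")
    case True
    have "(\<integral>\<^sup>+\<omega>. ennreal (if G \<omega> w = t then 1 else 0) \<partial>\<Omega>) = (\<integral>\<^sup>+\<omega>. (if G \<omega> w = t then 1 else 0) \<partial>\<Omega>)"
      by (intro nn_integral_cong) auto
    also have "\<dots> = ennreal (k w t)"
      using G_int[OF w True, of "\<lambda>_. 1"] nn_integral_exp_scaled(1)[of "k w t"] True
      by (simp add: k_def pmf_positive)
    finally show ?thesis by (intro has_bochner_integral_nn_integral) (auto simp: k_def)
  next
    case False
    then have "\<And>\<omega>. G \<omega> w \<noteq> t" using G_in[OF w] by metis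
    then show ?thesis using False by (simp add: k_def set_pmf_iff has_bochner_integral_zero)
  qed
  have mean: "has_bochner_integral \<Omega> (\<lambda>\<omega>. if G \<omega> w = t then \<omega> t else 0) ((k w t)\<^sup>2)"
    if w: "w \<in> L" and t: "t \<in> \<tau>" for w t
  proof (cases "t \<in> set_pmf (\<kappa> w)")
    case True
    have "(\<integral>\<^sup>+\<omega>. ennreal (if G \<omega> w = t then \<omega> t else 0) \<partial>\<Omega>) = (\<integral>\<^sup>+\<omega>. (if G \<omega> w = t then ennreal (\<omega> t) else 0) \<partial>\<Omega>)"
      by (intro nn_integral_cong) auto
    also have "\<dots> = ennreal ((k w t)\<^sup>2)"
      using G_int[OF w True, of ennreal] nn_integral_exp_scaled(2)[of "k w t"] True
      by (simp add: k_def pmf_positive)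
    finally show ?thesis
      by (intro has_bochner_integral_nn_integral) (use \<omega>_nonneg t in \<open>auto elim!: eventually_mono\<close>)
  next
    case False
    then have "\<And>\<omega>. G \<omega> w \<noteq> t" using G_in[OF w] by metis
    then show ?thesis using False by (simp add: k_def set_pmf_iff has_bochner_integral_zero)
  qed
  \<comment> \<open>The code weight of t: the Lomax density at the clock rescaled by the marginal
    \<open>P t\<close>, without reference to w. Its negative logarithm is a constant plus
    \<open>(s + 1) * ln (\<omega> t / P t + b)\<close>.\<close>
  define q where "q = (\<lambda>\<omega> t. s * b powr s * (\<omega> t / P t + b) powr (- s - 1))"
  have q_nn: "(\<integral>\<^sup>+\<omega>. ennreal (q \<omega> t) \<partial>\<Omega>) \<le> ennreal (P t)" if t: "t \<in> \<tau>" for t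
  proof -
    have "(\<integral>\<^sup>+\<omega>. ennreal (q \<omega> t) \<partial>\<Omega>)
        = (\<integral>\<^sup>+x. ennreal (s * b powr s * (x / P t + b) powr (- s - 1)) \<partial>distr \<Omega> exp1 (\<lambda>\<omega>. \<omega> t))"
      unfolding q_def using coord[OF t] by (subst nn_integral_distr) auto
    also have "distr \<Omega> exp1 (\<lambda>\<omega>. \<omega> t) = exp1"
      unfolding \<Omega>_def by (rule distr_PiM_component[OF prob_space_exp1 t])
    finally show ?thesis using nn_integral_exp1_power_law[OF b s P_pos[OF t]] by simp
  qed
  have q0: "0 \<le> q \<omega> t" for \<omega> t using s by (simp add: q_def)
  have q_int: "integrable \<Omega> (\<lambda>\<omega>. q \<omega> t)" if t: "t \<in> \<tau>" for t
    by (rule integrableI_nonneg)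
       (use q_nn[OF t] q0 t in \<open>auto simp: q_def less_top[symmetric] top_unique intro: order_le_less_trans\<close>)
  have q_le: "(\<integral>\<omega>. q \<omega> t \<partial>\<Omega>) \<le> P t" if t: "t \<in> \<tau>" for t
    using q_nn[OF t] nn_integral_eq_integral[OF q_int[OF t]] q0 P_pos[OF t] by simp
  define R where "R = (\<lambda>w t. k w t / P t)"
  have R0: "0 \<le> R w t" for w t by (simp add: R_def k_def P_def)
  \<comment> \<open>Jensen's inequality by a tangent: when t wins, F is the tangent of
    \<open>ln (u + b)\<close> at \<open>u = R w t\<close>, evaluated at
    \<open>\<omega> t / P t\<close>. Being affine in the clock, it is integrated exactly by
    \<open>prob\<close> and \<open>mean\<close>. The tangent point is the mean of the rescaled
    winning clock, so the slope term cancels.\<close>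
  define F where "F = (\<lambda>w t \<omega>. (if G \<omega> w = t then 1 else 0) * (ln (R w t + b) - R w t / (R w t + b))
      + (if G \<omega> w = t then \<omega> t else 0) * (1 / (P t * (R w t + b))))"
  have F_int: "has_bochner_integral \<Omega> (F w t) (k w t * ln (R w t + b))" if "w \<in> L" "t \<in> \<tau>" for w t
  proof -
    have "has_bochner_integral \<Omega> (F w t)
       (k w t * (ln (R w t + b) - R w t / (R w t + b)) + (k w t)\<^sup>2 * (1 / (P t * (R w t + b))))"
      unfolding F_def
      by (intro has_bochner_integral_add has_bochner_integral_mult_left prob mean that)
    moreover have "(k w t)\<^sup>2 * (1 / (P t * (R w t + b))) = k w t * (R w t / (R w t + b))"
      by (simp add: R_def power2_eq_square)
    ultimately show ?thesis by (simp add: algebra_simps)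
  qed
  define K where "K = - ln s - s * ln b"
  have pointwise: "ent (map_pmf (G \<omega>) p) * ln 2
      \<le> (K + (s + 1) * (\<Sum>w\<in>L. \<Sum>t\<in>\<tau>. pmf p w * F w t \<omega>)) + (\<Sum>t\<in>\<tau>. q \<omega> t) - 1"
    if \<omega>: "\<forall>t\<in>\<tau>. 0 \<le> \<omega> t" for \<omega>
  proof -
    have pos: "0 < \<omega> t / P t + b" if "t \<in> \<tau>" for t
      using \<omega> that P_pos[OF that] b by (simp add: add_nonneg_pos)
    have "ent (map_pmf (G \<omega>) p) * ln 2 \<le> (\<Sum>w\<in>L. pmf p w * - ln (q \<omega> (G \<omega> w))) + (\<Sum>t\<in>\<tau>. q \<omega> t) - 1"
      unfolding L_def
    proof (rule ent_map_le_cross_entropy[OF finp fin\<tau>])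
      show "G \<omega> ` set_pmf p \<subseteq> \<tau>" using G_in\<tau> by (auto simp: L_def)
      show "0 < q \<omega> t" if "t \<in> \<tau>" for t using s b pos[OF that] by (simp add: q_def)
    qed
    also have "(\<Sum>w\<in>L. pmf p w * - ln (q \<omega> (G \<omega> w))) \<le> (\<Sum>w\<in>L. pmf p w * (K + (s + 1) * (\<Sum>t\<in>\<tau>. F w t \<omega>)))"
    proof (intro sum_mono mult_left_mono)
      fix w assume w: "w \<in> L"
      define t where "t = G \<omega> w"
      have t: "t \<in> \<tau>" using G_in\<tau>[OF w] by (simp add: t_def)
      have "(\<Sum>t\<in>\<tau>. F w t \<omega>) = (\<Sum>u\<in>\<tau>. if u = t then ln (R w t + b) - R w t / (R w t + b) + \<omega> t / (P t * (R w t + b)) else 0)"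
        by (intro sum.cong) (auto simp: F_def t_def)
      then have Fs: "(\<Sum>t\<in>\<tau>. F w t \<omega>) = ln (R w t + b) - R w t / (R w t + b) + \<omega> t / (P t * (R w t + b))"
        using fin\<tau> t by simp
      have Rb: "0 < R w t + b" using R0[of w t] b by simp
      have "ln ((\<omega> t / P t + b) / (R w t + b)) \<le> (\<omega> t / P t + b) / (R w t + b) - 1"
        using Rb pos[OF t] by (intro ln_le_minus_one) simp
      moreover have "(\<omega> t / P t + b) / (R w t + b) - 1 = \<omega> t / (P t * (R w t + b)) - R w t / (R w t + b)"
        using Rb P_pos[OF t] by (simp add: divide_simps) (simp add: algebra_simps)
      ultimately have "ln (\<omega> t / P t + b) \<le> (\<Sum>t\<in>\<tau>. F w t \<omega>)"
        using Rb pos[OF t] by (simp add: ln_div Fs)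
      moreover have "- ln (q \<omega> t) = K + (s + 1) * ln (\<omega> t / P t + b)"
        using s b pos[OF t] by (simp add: q_def K_def ln_mult ln_powr algebra_simps)
      ultimately show "- ln (q \<omega> (G \<omega> w)) \<le> K + (s + 1) * (\<Sum>t\<in>\<tau>. F w t \<omega>)"
        using s by (simp add: t_def mult_left_mono)
    qed simp
    also have "(\<Sum>w\<in>L. pmf p w * (K + (s + 1) * (\<Sum>t\<in>\<tau>. F w t \<omega>)))
       = sum (pmf p) L * K + (s + 1) * (\<Sum>w\<in>L. \<Sum>t\<in>\<tau>. pmf p w * F w t \<omega>)"
      by (simp add: sum_distrib_left sum_distrib_right sum.distrib algebra_simps)
    finally show ?thesis by (simp add: p1)
  qed
  define B where "B = (\<Sum>w\<in>L. \<Sum>t\<in>\<tau>. pmf p w * (k w t * ln (R w t + b)))"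
  have rhs: "has_bochner_integral \<Omega> (\<lambda>\<omega>. (K + (s + 1) * (\<Sum>w\<in>L. \<Sum>t\<in>\<tau>. pmf p w * F w t \<omega>)) + (\<Sum>t\<in>\<tau>. q \<omega> t) - 1)
      ((K + (s + 1) * B) + (\<Sum>t\<in>\<tau>. \<integral>\<omega>. q \<omega> t \<partial>\<Omega>) - 1)"
  proof -
    have c: "has_bochner_integral \<Omega> (\<lambda>_. c) c" for c :: real
      by (simp add: has_bochner_integral_iff \<Omega>.prob_space)
    show ?thesis unfolding B_def
      by (intro has_bochner_integral_add has_bochner_integral_diff has_bochner_integral_mult_right
          has_bochner_integral_sum F_int c has_bochner_integral_integrable q_int)
  qed
  have ent_bdd: "integrable \<Omega> (\<lambda>\<omega>. ent (map_pmf (G \<omega>) p) * ln 2)"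
  proof (rule \<Omega>.integrable_const_bound)
    show "AE \<omega> in \<Omega>. norm (ent (map_pmf (G \<omega>) p) * ln 2) \<le> Max ((\<lambda>g. norm (ent (map_pmf g p) * ln 2)) ` range G)"
      using fr by (intro AE_I2 Max_ge) auto
    show "(\<lambda>\<omega>. ent (map_pmf (G \<omega>) p) * ln 2) \<in> borel_measurable \<Omega>"
      by (rule measurable_compose[OF G]) simp
  qed
  have "(\<integral>\<omega>. ent (map_pmf (G \<omega>) p) * ln 2 \<partial>\<Omega>)
      \<le> (K + (s + 1) * B) + (\<Sum>t\<in>\<tau>. \<integral>\<omega>. q \<omega> t \<partial>\<Omega>) - 1"
    unfolding has_bochner_integral_integral_eq[OF rhs, symmetric]
    by (rule integral_mono_AE[OF ent_bdd])
       (use rhs \<omega>_nonneg pointwise in \<open>auto simp: has_bochner_integral_iff elim!: eventually_mono\<close>)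
  also have "\<dots> \<le> K + (s + 1) * B"
    using sum_mono[of \<tau> "\<lambda>t. \<integral>\<omega>. q \<omega> t \<partial>\<Omega>" P] q_le P1 by simp
  also have "B \<le> I * ln 2 + ln (1 + b)"
  proof -
    \<comment> \<open>Jensen's inequality again, now over t:
      \<open>ln (R + b) = ln R + ln (1 + b / R)\<close>, and the last term lies below the tangent of
      \<open>ln (1 + b * x)\<close> at x = 1. Since \<open>k / R = P\<close> where k is positive,
      summation over t turns the tangent into \<open>ln (1 + b)\<close>, and \<open>ln R\<close>
      gives the mutual information.\<close>
    have summand: "k w t * ln (R w t + b) \<le> (k w t * ln (k w t) - k w t * ln (P t)) + k w t * (ln (1 + b) - b / (1 + b))
         + P t * (b / (1 + b))" if "t \<in> \<tau>" for w t
    proof (cases "k w t = 0")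
      case True then show ?thesis using P_pos[OF that] b by simp
    next
      case False
      then have kp: "0 < k w t" by (simp add: k_def less_le)
      then have Rp: "0 < R w t" using P_pos[OF that] by (simp add: R_def)
      have "ln ((1 + b / R w t) / (1 + b)) \<le> (1 + b / R w t) / (1 + b) - 1"
        using Rp b by (intro ln_le_minus_one) (simp add: add_pos_nonneg)
      also have "\<dots> = (1 / R w t) * (b / (1 + b)) - b / (1 + b)"
        using Rp b by (simp add: divide_simps) (simp add: algebra_simps)
      finally have "ln (1 + b / R w t) \<le> ln (1 + b) - b / (1 + b) + (1 / R w t) * (b / (1 + b))"
        using Rp b by (subst (asm) ln_divide_pos) (simp_all add: add_pos_pos)
      moreover have "ln (R w t + b) = ln (k w t) - ln (P t) + ln (1 + b / R w t)"
      proof -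
        have "R w t + b = R w t * (1 + b / R w t)" using Rp by (simp add: field_simps)
        moreover have "ln (R w t * (1 + b / R w t)) = ln (R w t) + ln (1 + b / R w t)"
          using Rp b by (intro ln_mult_pos) (simp_all add: add_pos_pos)
        moreover have "ln (R w t) = ln (k w t) - ln (P t)"
          using kp P_pos[OF that] by (simp add: R_def ln_div)
        ultimately show ?thesis by simp
      qed
      ultimately have "k w t * ln (R w t + b) \<le> k w t * (ln (k w t) - ln (P t) + (ln (1 + b) - b / (1 + b) + (1 / R w t) * (b / (1 + b))))"
        using kp by (intro mult_left_mono) auto
      also have "\<dots> = (k w t * ln (k w t) - k w t * ln (P t)) + k w t * (ln (1 + b) - b / (1 + b)) + (k w t * (1 / R w t)) * (b / (1 + b))"
        by (simp add: algebra_simps)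
      also have "k w t * (1 / R w t) = P t" using kp by (simp add: R_def)
      finally show ?thesis .
    qed
    have "B \<le> (\<Sum>w\<in>L. \<Sum>t\<in>\<tau>. pmf p w * ((k w t * ln (k w t) - k w t * ln (P t)) + k w t * (ln (1 + b) - b / (1 + b))
         + P t * (b / (1 + b))))"
      unfolding B_def by (intro sum_mono mult_left_mono summand) auto
    also have "\<dots> = (\<Sum>w\<in>L. pmf p w * ((\<Sum>t\<in>\<tau>. k w t * ln (k w t) - k w t * ln (P t)) + ln (1 + b)))"
    proof (intro sum.cong refl)
      fix w assume w: "w \<in> L"
      have "(\<Sum>t\<in>\<tau>. pmf p w * ((k w t * ln (k w t) - k w t * ln (P t)) + k w t * (ln (1 + b) - b / (1 + b)) + P t * (b / (1 + b))))
        = pmf p w * ((\<Sum>t\<in>\<tau>. k w t * ln (k w t) - k w t * ln (P t)) + sum (k w) \<tau> * (ln (1 + b) - b / (1 + b)) + sum P \<tau> * (b / (1 + b)))"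
        by (simp only: sum_distrib_left[symmetric] sum.distrib sum_distrib_right[symmetric])
      also have "\<dots> = pmf p w * ((\<Sum>t\<in>\<tau>. k w t * ln (k w t) - k w t * ln (P t)) + ln (1 + b))"
        by (simp add: k1[OF w] P1)
      finally show "(\<Sum>t\<in>\<tau>. pmf p w * ((k w t * ln (k w t) - k w t * ln (P t)) + k w t * (ln (1 + b) - b / (1 + b)) + P t * (b / (1 + b))))
        = pmf p w * ((\<Sum>t\<in>\<tau>. k w t * ln (k w t) - k w t * ln (P t)) + ln (1 + b))" .
    qed
    also have "\<dots> = (\<Sum>w\<in>L. pmf p w * (\<Sum>t\<in>\<tau>. k w t * ln (k w t))) - (\<Sum>t\<in>\<tau>. P t * ln (P t)) + ln (1 + b)"
    proof -
      have "(\<Sum>w\<in>L. pmf p w * (\<Sum>t\<in>\<tau>. k w t * ln (P t))) = (\<Sum>t\<in>\<tau>. P t * ln (P t))"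
        unfolding P_sum sum_distrib_left sum_distrib_right
        by (subst sum.swap) (simp add: P_sum[symmetric] mult.assoc)
      then show ?thesis using p1
        by (simp add: sum_subtractf distrib_left right_diff_distrib sum.distrib sum_distrib_right[symmetric])
    qed
    also have "\<dots> = I * ln 2 + ln (1 + b)"
    proof -
      have "ent (bind_pmf p \<kappa>) * ln 2 = - (\<Sum>t\<in>\<tau>. P t * ln (P t))"
        by (subst ent_finite[of \<tau>])
           (use fin\<tau> set_bind in \<open>auto simp: log_def sum_distrib_right P_def sum_negf[symmetric] intro!: sum.cong\<close>)
      moreover have "ent (\<kappa> w) * ln 2 = - (\<Sum>t\<in>\<tau>. k w t * ln (k w t))" if "w \<in> L" for w
        by (subst ent_finite[of \<tau>])
           (use fin\<tau> sub[OF that] in \<open>auto simp: log_def sum_distrib_right k_def sum_negf[symmetric] intro!: sum.cong\<close>)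
      moreover have "measure_pmf.expectation p (\<lambda>w. ent (\<kappa> w)) = (\<Sum>w\<in>L. pmf p w * ent (\<kappa> w))"
        by (subst integral_measure_pmf[of L]) (use finL in \<open>auto simp: L_def\<close>)
      ultimately show ?thesis
        by (simp add: I_def left_diff_distrib sum_distrib_right mult.assoc sum_negf)
    qed
    finally show ?thesis .
  qed
  finally have bound: "(\<integral>\<omega>. ent (map_pmf (G \<omega>) p) * ln 2 \<partial>\<Omega>) \<le> K + (s + 1) * (I * ln 2 + ln (1 + b))"
    using s by (simp add: mult_left_mono)
  have E\<Phi>: "measure_pmf.expectation \<Phi> (\<lambda>g. ent (map_pmf g p)) = (\<integral>\<omega>. ent (map_pmf (G \<omega>) p) \<partial>\<Omega>)"
    unfolding \<Phi> by (rule integral_distr[OF G]) simp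
  show thesis
  proof
    fix w assume "w \<in> set_pmf p"
    then have w: "w \<in> L" by (simp add: L_def)
    show "map_pmf (\<lambda>g. g w) \<Phi> = \<kappa> w"
    proof (rule pmf_eqI)
      fix t
      have "pmf (map_pmf (\<lambda>g. g w) \<Phi>) t = measure \<Omega> {\<omega>\<in>space \<Omega>. G \<omega> w = t}"
        unfolding pmf_map \<Phi> by (subst measure_distr[OF G]) (auto intro!: arg_cong[where f="measure \<Omega>"])
      also have "\<dots> = (\<integral>\<omega>. indicator {\<omega>\<in>space \<Omega>. G \<omega> w = t} \<omega> \<partial>\<Omega>)" by simp
      also have "\<dots> = (\<integral>\<omega>. (if G \<omega> w = t then 1 else 0) \<partial>\<Omega>)"
        by (intro Bochner_Integration.integral_cong) (auto split: split_indicator)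
      also have "\<dots> = pmf (\<kappa> w) t" using has_bochner_integral_integral_eq[OF prob[OF w, of t]] by (simp add: k_def)
      finally show "pmf (map_pmf (\<lambda>g. g w) \<Phi>) t = pmf (\<kappa> w) t" .
    qed
  next
    have "measure_pmf.expectation \<Phi> (\<lambda>g. ent (map_pmf g p)) * ln 2 \<le> K + (s + 1) * (I * ln 2 + ln (1 + b))"
      using bound E\<Phi> by simp
    also have "\<dots> = (log 2 l + log 2 (1 + b) + I + (I + log 2 (1 + 1 / b)) / l) * ln 2"
    proof -
      \<comment> \<open>The term \<open>- s * ln b\<close> from the normalisation of the weight
        combines with \<open>s * ln (1 + b)\<close>.\<close>
      have "ln (1 + 1 / b) = ln (1 + b) - ln b"
        using b by (subst ln_divide_pos[symmetric]) (auto simp: field_simps)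
      moreover have "K = ln l - ln b / l" using l by (simp add: K_def s_def ln_div)
      moreover have "(log 2 l + log 2 (1 + b) + I + (I + log 2 (1 + 1 / b)) / l) * ln 2
          = ln l + ln (1 + b) + I * ln 2 + (I * ln 2 + ln (1 + 1 / b)) / l"
        by (simp add: log_def distrib_right add_divide_distrib)
      ultimately show ?thesis
        by (simp only:) (simp add: s_def distrib_right distrib_left add_divide_distrib diff_divide_distrib)
    qed
    finally show "measure_pmf.expectation \<Phi> (\<lambda>g. ent (map_pmf g p))
       \<le> log 2 l + log 2 (1 + b) + I + (I + log 2 (1 + 1 / b)) / l" by simp
  next
    have "set_pmf \<Phi> \<subseteq> range G"
    proof -
      have "AE g in measure_pmf \<Phi>. g \<in> range G" unfolding \<Phi> using G by (subst AE_distr_iff) auto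
      then show ?thesis by (auto simp: AE_measure_pmf_iff)
    qed
    then show "finite (set_pmf \<Phi>)" using fr finite_subset by blast
  qed
qed

section \<open>Disintegration, extension and erasure\<close>

lemma infsum_pmf_eq_expectation:
  fixes f :: "'a \<Rightarrow> real"
  assumes "integrable (measure_pmf p) f"
  shows "(\<Sum>\<^sub>\<infinity>a. pmf p a * f a) = measure_pmf.expectation p f"
proof -
  have "integrable (count_space UNIV) (\<lambda>a. pmf p a * f a)"
    using assms unfolding measure_pmf_eq_density by (subst (asm) integrable_density) auto
  then have "infsetsum (\<lambda>a. pmf p a * f a) UNIV = (\<Sum>\<^sub>\<infinity>a. pmf p a * f a)"
    by (intro infsetsum_infsum) (simp add: Infinite_Set_Sum.abs_summable_on_def)
  then show ?thesis
    unfolding infsetsum_def measure_pmf_eq_density by (subst integral_density) auto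
qed

lemma integrable_pmf_iff_summable:
  fixes f :: "'a \<Rightarrow> real"
  assumes "\<And>a. a \<in> set_pmf p \<Longrightarrow> 0 \<le> f a"
  shows "integrable (measure_pmf p) f \<longleftrightarrow> (\<lambda>a. pmf p a * f a) summable_on UNIV"
proof -
  have nn: "0 \<le> pmf p a * f a" for a
    using assms[of a] by (cases "a \<in> set_pmf p") (auto simp: set_pmf_iff)
  have "integrable (measure_pmf p) f \<longleftrightarrow> integrable (count_space UNIV) (\<lambda>a. pmf p a * f a)"
    unfolding measure_pmf_eq_density by (subst integrable_density) auto
  also have "\<dots> \<longleftrightarrow> Infinite_Sum.abs_summable_on (\<lambda>a. pmf p a * f a) UNIV"
    by (simp only: abs_summable_equivalent Infinite_Set_Sum.abs_summable_on_def)
  also have "\<dots> \<longleftrightarrow> (\<lambda>a. pmf p a * f a) summable_on UNIV"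
    using nn by (simp add: abs_of_nonneg)
  finally show ?thesis .
qed

lemma self_info_id: "self_info p (\<lambda>a. a) (\<lambda>_. ()) a = - log 2 (pmf p a)"
proof -
  have "rv_prob p (\<lambda>a. (a, ())) a = pmf p a"
    by (simp add: rv_prob_def measure_pmf_single)
  then show ?thesis by (simp add: self_info_def)
qed

lemma fin_rv_finite_ent: "fin_rv M X \<longleftrightarrow> finite_ent (map_pmf X M)"
proof -
  have "fin_rv M X \<longleftrightarrow> fin_rv (map_pmf X M) (\<lambda>a. a)" by (simp add: fin_rv_map)
  also have "\<dots> \<longleftrightarrow> finite_ent (map_pmf X M)"
    unfolding fin_rv_def finite_ent_def
    by (subst integrable_pmf_iff_summable, erule self_info_nonneg) (simp add: self_info_id)
  finally show ?thesis .
qed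

lemma Hc_ent:
  assumes "fin_rv M X"
  shows "Hc M X (\<lambda>_. ()) = ent (map_pmf X M)"
proof -
  have "fin_rv (map_pmf X M) (\<lambda>a. a)" using assms by (simp add: fin_rv_map)
  then have "ent (map_pmf X M) = Hc (map_pmf X M) (\<lambda>a. a) (\<lambda>_. ())"
    unfolding ent_def Hc_def fin_rv_def
    by (subst infsum_pmf_eq_expectation[symmetric]) (auto simp: self_info_id)
  then show ?thesis by (simp add: Hc_map)
qed

lemma rv_prob_id [simp]: "rv_prob J (\<lambda>\<omega>. \<omega>) \<omega> = pmf J \<omega>"
  by (simp add: rv_prob_def measure_pmf_single)

lemma Hc_cond_ent:
  assumes "fin_rv J fst"
  shows "cond_ent J = Hc J fst snd"
proof -
  have "Hc J fst snd = (\<Sum>\<^sub>\<infinity>v. pmf J v * self_info J fst snd v)"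
    unfolding Hc_def by (rule infsum_pmf_eq_expectation[symmetric, OF fin_rv_integrable[OF assms]])
  also have "\<dots> = cond_ent J"
    unfolding cond_ent_def
  proof (rule infsum_cong)
    fix v :: "'a \<times> 'b"
    show "pmf J v * self_info J fst snd v
       = (case v of (a, b) \<Rightarrow> - pmf J (a, b) * log 2 (pmf J (a, b) / pmf (map_pmf snd J) b))"
    proof (cases "v \<in> set_pmf J")
      case True
      then have "0 < pmf J v" "0 < pmf (map_pmf snd J) (snd v)"
        by (auto simp: pmf_positive intro!: pmf_positive)
      then show ?thesis
        by (cases v) (auto simp: self_info_def rv_prob_pmf[of _ snd] log_divide less_imp_neq[symmetric] algebra_simps)
    qed (auto simp: set_pmf_iff split: prod.split)
  qed
  finally show ?thesis by simp
qed

text \<open>Finite entropy is asked of the first component, so the second may be a representation of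
  infinite entropy. Off the support both summands are multiples of 0.\<close>

lemma Hc_mut_info:
  assumes "fin_rv J fst"
  shows "mut_info J = Hc J fst (\<lambda>_. ()) - Hc J fst snd"
proof -
  have int: "integrable (measure_pmf J) (\<lambda>v. self_info J fst (\<lambda>_. ()) v - self_info J fst snd v)"
    by (intro Bochner_Integration.integrable_diff fin_rv_integrable assms)
  have "Hc J fst (\<lambda>_. ()) - Hc J fst snd
      = (\<Sum>\<^sub>\<infinity>v. pmf J v * (self_info J fst (\<lambda>_. ()) v - self_info J fst snd v))"
    unfolding infsum_pmf_eq_expectation[OF int] Hc_def
    by (intro Bochner_Integration.integral_diff[symmetric] fin_rv_integrable assms)
  also have "\<dots> = mut_info J"
    unfolding mut_info_def
  proof (rule infsum_cong)
    fix v :: "'a \<times> 'b"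
    show "pmf J v * (self_info J fst (\<lambda>_. ()) v - self_info J fst snd v)
       = (case v of (a, b) \<Rightarrow> pmf J (a, b) * log 2 (pmf J (a, b) / (pmf (map_pmf fst J) a * pmf (map_pmf snd J) b)))"
    proof (cases "v \<in> set_pmf J")
      case True
      then have p: "0 < pmf J v" "0 < pmf (map_pmf snd J) (snd v)" "0 < pmf (map_pmf fst J) (fst v)"
        by (auto simp: pmf_positive intro!: pmf_positive)
      have "rv_prob J (\<lambda>\<omega>. (fst \<omega>, ())) v = rv_prob J fst v" by (rule rv_prob_cong) (use True in auto)
      with p show ?thesis
        by (cases v) (auto simp: self_info_def rv_prob_pmf[of _ snd] rv_prob_pmf[of _ fst]
            log_divide log_mult less_imp_neq[symmetric] algebra_simps)
    qed (auto simp: set_pmf_iff split: prod.split)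
  qed
  finally show ?thesis by simp
qed

text \<open>\<open>g_fun\<close> puts the representation first in some pairs and second in another,
  while \<open>Hc_mut_info\<close> expects the variable of finite entropy in front.\<close>

lemma mut_info_swap: "mut_info (map_pmf (\<lambda>v. (snd v, fst v)) J) = mut_info J"
proof -
  have eq: "pmf (map_pmf (\<lambda>v. (snd v, fst v)) J) (b, a) = pmf J (a, b)" for a b
    using pmf_map_inj'[of "\<lambda>v. (snd v, fst v)" J "(a, b)"] by (simp add: inj_on_def prod_eq_iff)
  have "mut_info J = (\<Sum>\<^sub>\<infinity>v\<in>prod.swap ` UNIV. case v of (a, b) \<Rightarrow> pmf J (a, b) *
      log 2 (pmf J (a, b) / (pmf (map_pmf fst J) a * pmf (map_pmf snd J) b)))"
    unfolding mut_info_def by simp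
  also have "\<dots> = mut_info (map_pmf (\<lambda>v. (snd v, fst v)) J)"
    unfolding mut_info_def
    by (subst infsum_reindex) (auto simp: map_pmf_comp eq mult.commute intro!: infsum_cong)
  finally show ?thesis by simp
qed

section \<open>Disintegration of a law along a variable\<close>

lemma bind_cond_pmf:
  "bind_pmf (map_pmf f M) (\<lambda>v. cond_pmf M (f -` {v})) = M"
proof -
  have "bind_pmf (map_pmf f M) (\<lambda>v. cond_pmf M {y. v = f y}) = M"
  proof (rule bind_cond_pmf_cancel)
    fix v assume "v \<in> set_pmf (map_pmf f M)"
    then show "set_pmf M \<inter> {y. v = f y} \<noteq> {}" by auto
  next
    fix v y assume "v = f y"
    have "measure (measure_pmf (map_pmf f M)) {x. x = f y} = pmf (map_pmf f M) (f y)"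
      by (simp add: measure_pmf_single[symmetric])
    then show "measure (measure_pmf M) {y. v = f y} = measure (measure_pmf (map_pmf f M)) {x. x = f y}"
      using \<open>v = f y\<close> by (simp add: pmf_map vimage_def eq_commute)
  qed auto
  moreover have "f -` {v} = {y. v = f y}" for v by auto
  ultimately show ?thesis by simp
qed

text \<open>Total probability along f: within the fibre over v, \<open>f \<omega>\<close> may be
  replaced by v. The disintegrations below are instances.\<close>

lemma bind_map_cond_pmf:
  "bind_pmf (map_pmf f M) (\<lambda>v. map_pmf (h v) (cond_pmf M (f -` {v}))) = map_pmf (\<lambda>\<omega>. h (f \<omega>) \<omega>) M"
proof -
  have "bind_pmf (map_pmf f M) (\<lambda>v. map_pmf (h v) (cond_pmf M (f -` {v})))
      = bind_pmf (map_pmf f M) (\<lambda>v. map_pmf (\<lambda>\<omega>. h (f \<omega>) \<omega>) (cond_pmf M (f -` {v})))"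
  proof (rule bind_pmf_cong[OF refl])
    fix v assume "v \<in> set_pmf (map_pmf f M)"
    then have "set_pmf M \<inter> f -` {v} \<noteq> {}" by auto
    then show "map_pmf (h v) (cond_pmf M (f -` {v})) = map_pmf (\<lambda>\<omega>. h (f \<omega>) \<omega>) (cond_pmf M (f -` {v}))"
      by (intro map_pmf_cong) auto
  qed
  then show ?thesis by (simp add: map_bind_pmf[symmetric] bind_cond_pmf)
qed

lemma ent_nonneg: "0 \<le> ent p"
proof -
  have "0 \<le> - (pmf p a * log 2 (pmf p a))" for a
    using pmf_le_1[of p a] by (cases "pmf p a = 0") (auto simp: mult_nonneg_nonpos less_le)
  then show ?thesis unfolding ent_def by (intro infsum_nonneg) simp
qed

text \<open>Given \<open>fst\<close>, the law of \<open>snd\<close> is the kernel, so its entropy is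
  averaged. A common finite set for all supports gives \<open>snd\<close> finite entropy; the
  version in \<open>ennreal\<close> precedes integrability and yields it.\<close>

lemma Hc_bind:
  fixes D :: "'d pmf" and \<mu> :: "'d \<Rightarrow> 't pmf"
  defines "N \<equiv> bind_pmf D (\<lambda>d. map_pmf (Pair d) (\<mu> d))"
  assumes fin: "finite A" and sub: "\<And>d. d \<in> set_pmf D \<Longrightarrow> set_pmf (\<mu> d) \<subseteq> A"
  shows "ennreal (Hc N snd fst) = (\<integral>\<^sup>+d. ennreal (ent (\<mu> d)) \<partial>measure_pmf D)"
    and "integrable (measure_pmf D) (\<lambda>d. ent (\<mu> d))"
    and "Hc N snd fst = measure_pmf.expectation D (\<lambda>d. ent (\<mu> d))"
proof -
  have "fin_rv N snd"
    by (rule fin_rv_finite, rule finite_subset[OF _ fin]) (clarsimp simp: N_def, use sub in blast)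
  note fN = this
  have mapfst: "map_pmf fst N = D"
    by (simp add: N_def map_bind_pmf map_pmf_comp o_def bind_return_pmf' map_pmf_const)
  have pmfN: "pmf N (d, t) = pmf D d * pmf (\<mu> d) t" for d t
  proof -
    have "pmf (map_pmf (Pair x) (\<mu> x)) (d, t) = indicator {d} x * pmf (\<mu> d) t" for x
      by (cases "x = d") (auto simp: pmf_map_inj' inj_on_def set_pmf_iff[symmetric] pmf_eq_0_set_pmf)
    then show ?thesis by (simp add: N_def pmf_bind measure_pmf_single)
  qed
  have si: "self_info N snd fst (d, t) = self_info (\<mu> d) (\<lambda>t. t) (\<lambda>_. ()) t"
    if "d \<in> set_pmf D" "t \<in> set_pmf (\<mu> d)" for d t
  proof -
    have dt: "(d, t) \<in> set_pmf N" using that by (auto simp: N_def)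
    have "rv_prob N (\<lambda>\<omega>. (snd \<omega>, fst \<omega>)) (d, t) = rv_prob N (\<lambda>\<omega>. (fst \<omega>, snd \<omega>)) (d, t)"
      by (rule rv_prob_cong[OF dt]) auto
    then show ?thesis
      using that by (simp add: self_info_def[of N] self_info_id rv_prob_pmf[of _ fst] mapfst pmfN
        log_mult pmf_positive less_imp_neq[symmetric])
  qed
  have inner: "(\<integral>\<^sup>+t. ennreal (self_info (\<mu> d) (\<lambda>t. t) (\<lambda>_. ()) t) \<partial>measure_pmf (\<mu> d)) = ennreal (ent (\<mu> d))"
    if "d \<in> set_pmf D" for d
  proof -
    have "finite ((\<lambda>t. t) ` set_pmf (\<mu> d))" using sub[OF that] fin finite_subset by auto
    then have f: "fin_rv (\<mu> d) (\<lambda>t. t)" by (rule fin_rv_finite)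
    show ?thesis using Hc_nn_integral[OF f, of "\<lambda>_. ()"] Hc_ent[OF f] by simp
  qed
  have "ennreal (Hc N snd fst) = (\<integral>\<^sup>+v. ennreal (self_info N snd fst v) \<partial>measure_pmf N)"
    by (rule Hc_nn_integral[OF fN])
  also have "\<dots> = (\<integral>\<^sup>+d. \<integral>\<^sup>+t. ennreal (self_info N snd fst (d, t)) \<partial>measure_pmf (\<mu> d) \<partial>measure_pmf D)"
  proof -
    have "(\<integral>\<^sup>+v. f v \<partial>measure_pmf N) = (\<integral>\<^sup>+d. \<integral>\<^sup>+t. f (d, t) \<partial>measure_pmf (\<mu> d) \<partial>measure_pmf D)" for f
      by (simp add: N_def)
    then show ?thesis .
  qed
  also have "\<dots> = (\<integral>\<^sup>+d. ennreal (ent (\<mu> d)) \<partial>measure_pmf D)"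
  proof (intro nn_integral_cong_AE, unfold AE_measure_pmf_iff, rule ballI)
    fix d assume d: "d \<in> set_pmf D"
    have "(\<integral>\<^sup>+t. ennreal (self_info N snd fst (d, t)) \<partial>measure_pmf (\<mu> d))
       = (\<integral>\<^sup>+t. ennreal (self_info (\<mu> d) (\<lambda>t. t) (\<lambda>_. ()) t) \<partial>measure_pmf (\<mu> d))"
      by (intro nn_integral_cong_AE) (auto simp: AE_measure_pmf_iff si[OF d])
    then show "(\<integral>\<^sup>+t. ennreal (self_info N snd fst (d, t)) \<partial>measure_pmf (\<mu> d)) = ennreal (ent (\<mu> d))"
      using inner[OF d] by simp
  qed
  finally show nn: "ennreal (Hc N snd fst) = (\<integral>\<^sup>+d. ennreal (ent (\<mu> d)) \<partial>measure_pmf D)" .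
  show int: "integrable (measure_pmf D) (\<lambda>d. ent (\<mu> d))"
    by (rule integrableI_nonneg) (auto simp: ent_nonneg nn[symmetric])
  show "Hc N snd fst = measure_pmf.expectation D (\<lambda>d. ent (\<mu> d))"
    using nn_integral_eq_integral[OF int] nn by (simp add: ent_nonneg Hc_nonneg)
qed

text \<open>Old variables are composed with \<open>fst\<close> and keep their joint law, so the
  representation can be built by successive extensions.\<close>

definition ext_pmf :: "'m pmf \<Rightarrow> ('m \<Rightarrow> 'z pmf) \<Rightarrow> ('m \<times> 'z) pmf" where
  "ext_pmf M k = bind_pmf M (\<lambda>\<omega>. map_pmf (Pair \<omega>) (k \<omega>))"

lemma map_fst_ext_pmf: "map_pmf fst (ext_pmf M k) = M"
  by (simp add: ext_pmf_def map_bind_pmf map_pmf_comp o_def bind_return_pmf' map_pmf_const)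

lemma set_ext_pmf: "set_pmf (ext_pmf M k) = (SIGMA \<omega>:set_pmf M. set_pmf (k \<omega>))"
  by (auto simp: ext_pmf_def)

lemma Hc_ext_fst: "Hc (ext_pmf M k) (\<lambda>v. X (fst v)) (\<lambda>v. Y (fst v)) = Hc M X Y"
  using Hc_map[of fst "ext_pmf M k" X Y] by (simp add: map_fst_ext_pmf)

lemma fin_rv_ext_fst: "fin_rv (ext_pmf M k) (\<lambda>v. X (fst v)) \<longleftrightarrow> fin_rv M X"
  using fin_rv_map[of fst "ext_pmf M k" X] by (simp add: map_fst_ext_pmf)

lemma rv_prob_ext:
  assumes "\<And>\<omega>'. Y \<omega>' = Y \<omega> \<Longrightarrow> k \<omega>' = k \<omega>"
  shows "rv_prob (ext_pmf M k) (\<lambda>v. (Y (fst v), snd v)) (\<omega>, z) = rv_prob M Y \<omega> * pmf (k \<omega>) z"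
proof -
  let ?A = "{v. (Y (fst v), snd v) = (Y \<omega>, z)}"
  have "measure (measure_pmf (map_pmf (Pair \<omega>') (k \<omega>'))) ?A = indicator {\<omega>'. Y \<omega>' = Y \<omega>} \<omega>' * pmf (k \<omega>) z" for \<omega>'
  proof (cases "Y \<omega>' = Y \<omega>")
    case True
    then have "Pair \<omega>' -` ?A = {z}" by auto
    then show ?thesis using True assms[OF True] by (simp add: measure_pmf_single)
  next
    case False
    then have "Pair \<omega>' -` ?A = {}" by auto
    then show ?thesis using False by simp
  qed
  then have "emeasure (measure_pmf (ext_pmf M k)) ?A = (\<integral>\<^sup>+\<omega>'. ennreal (indicator {\<omega>'. Y \<omega>' = Y \<omega>} \<omega>' * pmf (k \<omega>) z) \<partial>measure_pmf M)"
    unfolding ext_pmf_def emeasure_bind_pmf by (simp only: measure_pmf.emeasure_eq_measure)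
  also have "\<dots> = ennreal (rv_prob M Y \<omega> * pmf (k \<omega>) z)"
    by (simp add: ennreal_mult'' nn_integral_multc rv_prob_def ennreal_indicator measure_pmf.emeasure_eq_measure)
  finally show ?thesis by (simp add: rv_prob_def measure_pmf.emeasure_eq_measure)
qed

text \<open>The kernel factors through Y, so X and the new coordinate are conditionally independent
  given Y; the factor \<open>pmf (k \<omega>) z\<close> cancels in the density.\<close>

lemma Hc_ext_markov:
  assumes dep: "\<And>\<omega> \<omega>'. Y \<omega>' = Y \<omega> \<Longrightarrow> k \<omega>' = k \<omega>"
  shows "Hc (ext_pmf M k) (\<lambda>v. X (fst v)) (\<lambda>v. (Y (fst v), snd v)) = Hc M X Y"
proof -
  have "self_info (ext_pmf M k) (\<lambda>v. X (fst v)) (\<lambda>v. (Y (fst v), snd v)) v = self_info M X Y (fst v)"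
    if "v \<in> set_pmf (ext_pmf M k)" for v
  proof -
    obtain \<omega> z where v: "v = (\<omega>, z)" by (cases v)
    with that have \<omega>: "\<omega> \<in> set_pmf M" "z \<in> set_pmf (k \<omega>)" by (auto simp: set_ext_pmf)
    have "rv_prob (ext_pmf M k) (\<lambda>v. (X (fst v), Y (fst v), snd v)) v
        = rv_prob (ext_pmf M k) (\<lambda>v. ((X (fst v), Y (fst v)), snd v)) v"
      by (rule rv_prob_cong[OF that]) auto
    also have "\<dots> = rv_prob M (\<lambda>\<omega>. (X \<omega>, Y \<omega>)) \<omega> * pmf (k \<omega>) z"
      unfolding v by (rule rv_prob_ext[of "\<lambda>\<omega>. (X \<omega>, Y \<omega>)"]) (use dep in blast)
    moreover have "rv_prob (ext_pmf M k) (\<lambda>v. (Y (fst v), snd v)) v = rv_prob M Y \<omega> * pmf (k \<omega>) z"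
      unfolding v by (rule rv_prob_ext) (use dep in blast)
    ultimately show ?thesis
      using rv_prob_pos[OF \<omega>(1), of Y] rv_prob_pos[OF \<omega>(1), of "\<lambda>\<omega>. (X \<omega>, Y \<omega>)"] pmf_positive[OF \<omega>(2)]
      by (simp add: self_info_def v log_mult less_imp_neq[symmetric])
  qed
  then have "Hc (ext_pmf M k) (\<lambda>v. X (fst v)) (\<lambda>v. (Y (fst v), snd v))
      = measure_pmf.expectation (ext_pmf M k) (\<lambda>v. self_info M X Y (fst v))"
    unfolding Hc_def by (intro integral_cong_AE) (auto simp: AE_measure_pmf_iff)
  also have "\<dots> = measure_pmf.expectation (map_pmf fst (ext_pmf M k)) (self_info M X Y)" by simp
  finally show ?thesis by (simp only: map_fst_ext_pmf Hc_def)
qed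


text \<open>The flag is independent of everything and visible in the erased variable, so
  conditioning on it splits the entropy into a case with U and a case without. The same \<beta>
  works for every X, so one erasure scales all leakages alike.\<close>

lemma Hc_erasure:
  fixes \<beta> :: real
  assumes \<beta>: "0 \<le> \<beta>" "\<beta> \<le> 1" and fin: "fin_rv M X"
  defines "N \<equiv> ext_pmf M (\<lambda>_. bernoulli_pmf \<beta>)"
  shows "Hc N (\<lambda>v. X (fst v)) (\<lambda>v. (if snd v then Some (U (fst v)) else None, Y (fst v)))
    = (1 - \<beta>) * Hc M X Y + \<beta> * Hc M X (\<lambda>\<omega>. (U \<omega>, Y \<omega>))"
proof -
  let ?V = "\<lambda>v. (if snd v then Some (U (fst v)) else None, Y (fst v))"
  let ?si = "self_info N (\<lambda>v. X (fst v)) ?V"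
  have finN: "fin_rv N (\<lambda>v. X (fst v))" using fin by (simp add: N_def fin_rv_ext_fst)
  have T: "?si (\<omega>, True) = self_info M X (\<lambda>\<omega>. (U \<omega>, Y \<omega>)) \<omega>" if \<omega>: "\<omega> \<in> set_pmf M" and "0 < \<beta>" for \<omega>
  proof -
    have v: "(\<omega>, True) \<in> set_pmf N" using that \<beta> by (simp add: N_def set_ext_pmf set_pmf_iff)
    have 1: "rv_prob N ?V (\<omega>, True) = rv_prob M (\<lambda>\<omega>. (U \<omega>, Y \<omega>)) \<omega> * \<beta>"
    proof -
      have "rv_prob N ?V (\<omega>, True) = rv_prob N (\<lambda>v. ((U (fst v), Y (fst v)), snd v)) (\<omega>, True)"
        by (rule rv_prob_cong[OF v]) auto
      then show ?thesis using \<beta> rv_prob_ext[of "\<lambda>\<omega>. (U \<omega>, Y \<omega>)" \<omega> "\<lambda>_. bernoulli_pmf \<beta>" M True] by (simp add: N_def)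
    qed
    have 2: "rv_prob N (\<lambda>v. (X (fst v), ?V v)) (\<omega>, True) = rv_prob M (\<lambda>\<omega>. (X \<omega>, U \<omega>, Y \<omega>)) \<omega> * \<beta>"
    proof -
      have "rv_prob N (\<lambda>v. (X (fst v), ?V v)) (\<omega>, True) = rv_prob N (\<lambda>v. ((X (fst v), U (fst v), Y (fst v)), snd v)) (\<omega>, True)"
        by (rule rv_prob_cong[OF v]) auto
      then show ?thesis using \<beta> rv_prob_ext[of "\<lambda>\<omega>. (X \<omega>, U \<omega>, Y \<omega>)" \<omega> "\<lambda>_. bernoulli_pmf \<beta>" M True] by (simp add: N_def)
    qed
    show ?thesis
      using rv_prob_pos[OF \<omega>, of "\<lambda>\<omega>. (U \<omega>, Y \<omega>)"] rv_prob_pos[OF \<omega>, of "\<lambda>\<omega>. (X \<omega>, U \<omega>, Y \<omega>)"] \<open>0 < \<beta>\<close>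
      unfolding self_info_def 1 2 by (simp add: log_mult less_imp_neq[symmetric])
  qed
  have F: "?si (\<omega>, False) = self_info M X Y \<omega>" if \<omega>: "\<omega> \<in> set_pmf M" and "\<beta> < 1" for \<omega>
  proof -
    have v: "(\<omega>, False) \<in> set_pmf N" using that \<beta> by (simp add: N_def set_ext_pmf set_pmf_iff)
    have 1: "rv_prob N ?V (\<omega>, False) = rv_prob M Y \<omega> * (1 - \<beta>)"
    proof -
      have "rv_prob N ?V (\<omega>, False) = rv_prob N (\<lambda>v. (Y (fst v), snd v)) (\<omega>, False)"
        by (rule rv_prob_cong[OF v]) auto
      then show ?thesis using \<beta> rv_prob_ext[of Y \<omega> "\<lambda>_. bernoulli_pmf \<beta>" M False] by (simp add: N_def)
    qed
    have 2: "rv_prob N (\<lambda>v. (X (fst v), ?V v)) (\<omega>, False) = rv_prob M (\<lambda>\<omega>. (X \<omega>, Y \<omega>)) \<omega> * (1 - \<beta>)"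
    proof -
      have "rv_prob N (\<lambda>v. (X (fst v), ?V v)) (\<omega>, False) = rv_prob N (\<lambda>v. ((X (fst v), Y (fst v)), snd v)) (\<omega>, False)"
        by (rule rv_prob_cong[OF v]) auto
      then show ?thesis using \<beta> rv_prob_ext[of "\<lambda>\<omega>. (X \<omega>, Y \<omega>)" \<omega> "\<lambda>_. bernoulli_pmf \<beta>" M False] by (simp add: N_def)
    qed
    show ?thesis
      using rv_prob_pos[OF \<omega>, of Y] rv_prob_pos[OF \<omega>, of "\<lambda>\<omega>. (X \<omega>, Y \<omega>)"] \<open>\<beta> < 1\<close>
      unfolding self_info_def 1 2 by (simp add: log_mult less_imp_neq[symmetric])
  qed
  have "ennreal (Hc N (\<lambda>v. X (fst v)) ?V) = (\<integral>\<^sup>+v. ennreal (?si v) \<partial>measure_pmf N)"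
    by (rule Hc_nn_integral[OF finN])
  also have "\<dots> = (\<integral>\<^sup>+\<omega>. ennreal (?si (\<omega>, True)) * ennreal \<beta> + ennreal (?si (\<omega>, False)) * ennreal (1 - \<beta>) \<partial>measure_pmf M)"
  proof -
    have "(\<integral>\<^sup>+v. f v \<partial>measure_pmf N) = (\<integral>\<^sup>+\<omega>. f (\<omega>, True) * ennreal \<beta> + f (\<omega>, False) * ennreal (1 - \<beta>) \<partial>measure_pmf M)" for f
      using \<beta> by (simp add: N_def ext_pmf_def)
    then show ?thesis .
  qed
  also have "\<dots> = (\<integral>\<^sup>+\<omega>. ennreal \<beta> * ennreal (self_info M X (\<lambda>\<omega>. (U \<omega>, Y \<omega>)) \<omega>)
      + ennreal (1 - \<beta>) * ennreal (self_info M X Y \<omega>) \<partial>measure_pmf M)"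
  proof (intro nn_integral_cong_AE, unfold AE_measure_pmf_iff, rule ballI)
    fix \<omega> assume \<omega>: "\<omega> \<in> set_pmf M"
    \<comment> \<open>For \<beta> = 0 the outcome lies off the support and \<open>T\<close> says
      nothing, but then its weight is 0; likewise below for \<beta> = 1.\<close>
    have "ennreal (?si (\<omega>, True)) * ennreal \<beta> = ennreal \<beta> * ennreal (self_info M X (\<lambda>\<omega>. (U \<omega>, Y \<omega>)) \<omega>)"
      using T[OF \<omega>] \<beta> by (cases "\<beta> = 0") (simp_all add: mult.commute)
    moreover have "ennreal (?si (\<omega>, False)) * ennreal (1 - \<beta>) = ennreal (1 - \<beta>) * ennreal (self_info M X Y \<omega>)"
      using F[OF \<omega>] \<beta> by (cases "\<beta> = 1") (simp_all add: mult.commute)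
    ultimately show "ennreal (?si (\<omega>, True)) * ennreal \<beta> + ennreal (?si (\<omega>, False)) * ennreal (1 - \<beta>)
      = ennreal \<beta> * ennreal (self_info M X (\<lambda>\<omega>. (U \<omega>, Y \<omega>)) \<omega>) + ennreal (1 - \<beta>) * ennreal (self_info M X Y \<omega>)" by simp
  qed
  also have "\<dots> = ennreal \<beta> * ennreal (Hc M X (\<lambda>\<omega>. (U \<omega>, Y \<omega>))) + ennreal (1 - \<beta>) * ennreal (Hc M X Y)"
    by (simp add: nn_integral_add nn_integral_cmult Hc_nn_integral[OF fin])
  also have "\<dots> = ennreal ((1 - \<beta>) * Hc M X Y + \<beta> * Hc M X (\<lambda>\<omega>. (U \<omega>, Y \<omega>)))"
    using \<beta> by (simp add: ennreal_mult[symmetric] Hc_nonneg ennreal_plus[symmetric] add.commute del: ennreal_plus)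
  finally show ?thesis
    using \<beta> by (subst (asm) ennreal_inj) (simp_all add: Hc_nonneg del: ennreal_plus)
qed

text \<open>The unconditional representation is applied in each fibre of V. The function is drawn
  from its law conditioned on sending L to T; by Bayes' rule this gives the joint law in which the
  function and L are independent given V and T is the value. Hence the function adds no information
  on L.\<close>

lemma conditional_functional_representation:
  fixes M :: "'m pmf" and V :: "'m \<Rightarrow> 'v" and L :: "'m \<Rightarrow> 'l" and T :: "'m \<Rightarrow> 't" and b l :: real
  assumes finL: "finite (L ` set_pmf M)" and finT: "finite (T ` set_pmf M)" and b: "0 < b" and l: "0 < l"
  defines "I \<equiv> Hc M T V - Hc M T (\<lambda>\<omega>. (L \<omega>, V \<omega>))"
  obtains k :: "'m \<Rightarrow> ('l \<Rightarrow> 't) pmf" where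
    "\<And>\<omega> \<omega>'. V \<omega>' = V \<omega> \<Longrightarrow> L \<omega>' = L \<omega> \<Longrightarrow> T \<omega>' = T \<omega> \<Longrightarrow> k \<omega>' = k \<omega>"
    "\<And>\<omega> g. (\<omega>, g) \<in> set_pmf (ext_pmf M k) \<Longrightarrow> g (L \<omega>) = T \<omega>"
    "Hc (ext_pmf M k) (\<lambda>v. L (fst v)) (\<lambda>v. (V (fst v), snd v)) = Hc M L V"
    "Hc (ext_pmf M k) (\<lambda>v. T (fst v)) (\<lambda>v. (V (fst v), snd v))
       \<le> log 2 l + log 2 (1 + b) + I + (I + log 2 (1 + 1 / b)) / l"
proof -
  define pV where "pV = map_pmf V M"
  define Mv where "Mv = (\<lambda>v. cond_pmf M (V -` {v}))"
  define p where "p = (\<lambda>v. map_pmf L (Mv v))"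
  define \<kappa> where "\<kappa> = (\<lambda>v x. map_pmf T (cond_pmf (Mv v) (L -` {x})))"
  have set_Mv: "set_pmf (Mv v) = set_pmf M \<inter> V -` {v}" if "v \<in> set_pmf pV" for v
    unfolding Mv_def by (rule set_cond_pmf) (use that in \<open>auto simp: pV_def\<close>)
  have set_p: "set_pmf (p v) = L ` (set_pmf M \<inter> V -` {v})" if "v \<in> set_pmf pV" for v
    using set_Mv[OF that] by (simp add: p_def)
  have set_\<kappa>: "set_pmf (\<kappa> v x) = T ` (set_pmf M \<inter> V -` {v} \<inter> L -` {x})" if "v \<in> set_pmf pV" "x \<in> set_pmf (p v)" for v x
  proof -
    have "set_pmf (cond_pmf (Mv v) (L -` {x})) = set_pmf (Mv v) \<inter> L -` {x}"
      by (rule set_cond_pmf) (use that in \<open>auto simp: p_def\<close>)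
    then show ?thesis using set_Mv[OF that(1)] by (simp add: \<kappa>_def)
  qed
  have finp: "finite (set_pmf (p v))" if "v \<in> set_pmf pV" for v
    by (rule finite_subset[OF _ finL]) (use set_p[OF that] in auto)
  have fin\<kappa>: "finite (set_pmf (\<kappa> v x))" if "v \<in> set_pmf pV" "x \<in> set_pmf (p v)" for v x
    by (rule finite_subset[OF _ finT]) (use set_\<kappa>[OF that] in auto)
  define J where "J = (\<lambda>v. ent (bind_pmf (p v) (\<kappa> v)) - measure_pmf.expectation (p v) (\<lambda>x. ent (\<kappa> v x)))"
  \<comment> \<open>With one l for all fibres the bound is affine in the information j of a fibre.
    As J averages to I, the bound averages to the same expression at I.\<close>
  define c0 where "c0 = log 2 l + log 2 (1 + b) + log 2 (1 + 1 / b) / l"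
  have bdd_eq: "log 2 l + log 2 (1 + b) + j + (j + log 2 (1 + 1 / b)) / l = c0 + j * (1 + 1 / l)" for j
    by (simp add: c0_def add_divide_distrib algebra_simps)
  have "\<forall>v. \<exists>\<Phi> :: ('l \<Rightarrow> 't) pmf. v \<in> set_pmf pV \<longrightarrow> (\<forall>x\<in>set_pmf (p v). map_pmf (\<lambda>g. g x) \<Phi> = \<kappa> v x) \<and>
      measure_pmf.expectation \<Phi> (\<lambda>g. ent (map_pmf g (p v))) \<le> c0 + J v * (1 + 1 / l) \<and> finite (set_pmf \<Phi>)"
  proof
    fix v
    show "\<exists>\<Phi> :: ('l \<Rightarrow> 't) pmf. v \<in> set_pmf pV \<longrightarrow> (\<forall>x\<in>set_pmf (p v). map_pmf (\<lambda>g. g x) \<Phi> = \<kappa> v x) \<and>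
      measure_pmf.expectation \<Phi> (\<lambda>g. ent (map_pmf g (p v))) \<le> c0 + J v * (1 + 1 / l) \<and> finite (set_pmf \<Phi>)"
    proof (cases "v \<in> set_pmf pV")
      case True
      obtain \<Phi> :: "('l \<Rightarrow> 't) pmf" where
        "\<And>x. x \<in> set_pmf (p v) \<Longrightarrow> map_pmf (\<lambda>g. g x) \<Phi> = \<kappa> v x"
        "measure_pmf.expectation \<Phi> (\<lambda>g. ent (map_pmf g (p v)))
         \<le> log 2 l + log 2 (1 + b) + J v + (J v + log 2 (1 + 1 / b)) / l"
        "finite (set_pmf \<Phi>)"
        using strong_functional_representation[of "p v" "\<kappa> v" b l, folded J_def, OF finp[OF True] fin\<kappa>[OF True] b l]
        unfolding J_def by blast
      then show ?thesis by (auto simp: bdd_eq)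
    qed auto
  qed
  then obtain \<Phi> :: "'v \<Rightarrow> ('l \<Rightarrow> 't) pmf" where
    \<Phi>: "\<And>v x. v \<in> set_pmf pV \<Longrightarrow> x \<in> set_pmf (p v) \<Longrightarrow> map_pmf (\<lambda>g. g x) (\<Phi> v) = \<kappa> v x"
    and \<Phi>_le: "\<And>v. v \<in> set_pmf pV \<Longrightarrow> measure_pmf.expectation (\<Phi> v) (\<lambda>g. ent (map_pmf g (p v))) \<le> c0 + J v * (1 + 1 / l)"
    and \<Phi>_fin: "\<And>v. v \<in> set_pmf pV \<Longrightarrow> finite (set_pmf (\<Phi> v))"
    by metis
  \<comment> \<open>The posterior of the random function once its value at x is known to be
    t.\<close>
  define K where "K = (\<lambda>v x t. cond_pmf (\<Phi> v) ((\<lambda>g. g x) -` {t}))"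
  define k where "k = (\<lambda>\<omega>. K (V \<omega>) (L \<omega>) (T \<omega>))"
  have proj: "map_pmf (\<lambda>\<omega>. (V \<omega>, L \<omega>, T \<omega>)) M
      = bind_pmf pV (\<lambda>v. bind_pmf (p v) (\<lambda>x. map_pmf (\<lambda>t. (v, x, t)) (\<kappa> v x)))"
  proof -
    have "map_pmf (\<lambda>\<omega>. (V \<omega>, L \<omega>, T \<omega>)) M = bind_pmf pV (\<lambda>v. map_pmf (\<lambda>\<omega>. (v, L \<omega>, T \<omega>)) (Mv v))"
      unfolding pV_def Mv_def by (rule bind_map_cond_pmf[symmetric])
    also have "(\<lambda>v. map_pmf (\<lambda>\<omega>. (v, L \<omega>, T \<omega>)) (Mv v)) = (\<lambda>v. bind_pmf (p v) (\<lambda>x. map_pmf (\<lambda>t. (v, x, t)) (\<kappa> v x)))"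
      unfolding p_def \<kappa>_def map_pmf_comp
      by (rule ext, rule bind_map_cond_pmf[symmetric, where h="\<lambda>x \<omega>. (_, x, T \<omega>)"])
    finally show ?thesis .
  qed
  define R where "R = map_pmf (\<lambda>v. (V (fst v), L (fst v), T (fst v), snd v)) (ext_pmf M k)"
  \<comment> \<open>The same law sampled in the other order: the function g before x, with
    \<open>g x\<close> in place of t.\<close>
  have R: "R = bind_pmf pV (\<lambda>v. bind_pmf (\<Phi> v) (\<lambda>g. map_pmf (\<lambda>x. (v, x, g x, g)) (p v)))"
  proof -
    have "R = bind_pmf M (\<lambda>\<omega>. map_pmf (\<lambda>g. (V \<omega>, L \<omega>, T \<omega>, g)) (K (V \<omega>) (L \<omega>) (T \<omega>)))"
      by (simp add: R_def ext_pmf_def map_bind_pmf map_pmf_comp k_def)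
    also have "\<dots> = bind_pmf (map_pmf (\<lambda>\<omega>. (V \<omega>, L \<omega>, T \<omega>)) M) (\<lambda>(v, x, t). map_pmf (\<lambda>g. (v, x, t, g)) (K v x t))"
      by (simp add: bind_map_pmf)
    also have "\<dots> = bind_pmf pV (\<lambda>v. bind_pmf (p v) (\<lambda>x. bind_pmf (\<kappa> v x) (\<lambda>t. map_pmf (\<lambda>g. (v, x, t, g)) (K v x t))))"
      unfolding proj by (simp add: bind_assoc_pmf bind_map_pmf)
    also have "\<dots> = bind_pmf pV (\<lambda>v. bind_pmf (p v) (\<lambda>x. map_pmf (\<lambda>g. (v, x, g x, g)) (\<Phi> v)))"
    proof (intro bind_pmf_cong refl)
      fix v x assume v: "v \<in> set_pmf pV" "x \<in> set_pmf (p v)"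
      show "bind_pmf (\<kappa> v x) (\<lambda>t. map_pmf (\<lambda>g. (v, x, t, g)) (K v x t)) = map_pmf (\<lambda>g. (v, x, g x, g)) (\<Phi> v)"
        unfolding \<Phi>[OF v, symmetric] K_def by (rule bind_map_cond_pmf)
    qed
    also have "\<dots> = bind_pmf pV (\<lambda>v. bind_pmf (\<Phi> v) (\<lambda>g. map_pmf (\<lambda>x. (v, x, g x, g)) (p v)))"
      unfolding map_pmf_def by (subst bind_commute_pmf) (rule refl)
    finally show ?thesis .
  qed
  define D where "D = bind_pmf pV (\<lambda>v. map_pmf (Pair v) (\<Phi> v))"
  have D_fst: "map_pmf fst D = pV"
    by (simp add: D_def map_bind_pmf map_pmf_comp o_def bind_return_pmf' map_pmf_const)
  have D_set: "d \<in> set_pmf D \<longleftrightarrow> fst d \<in> set_pmf pV \<and> snd d \<in> set_pmf (\<Phi> (fst d))" for d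
    by (cases d) (auto simp: D_def)
  have HL: "Hc (ext_pmf M k) (\<lambda>v. L (fst v)) (\<lambda>v. (V (fst v), snd v)) = Hc M L V"
  proof -
    have "Hc (ext_pmf M k) (\<lambda>v. L (fst v)) (\<lambda>v. (V (fst v), snd v))
        = Hc (map_pmf (\<lambda>(v, x, t, g). ((v, g), x)) R) snd fst"
      by (simp add: R_def Hc_map)
    also have "map_pmf (\<lambda>(v, x, t, g). ((v, g), x)) R = bind_pmf D (\<lambda>d. map_pmf (Pair d) (p (fst d)))"
      by (simp add: R D_def map_bind_pmf bind_assoc_pmf bind_map_pmf map_pmf_comp)
    also have "Hc \<dots> snd fst = measure_pmf.expectation D (\<lambda>d. ent (p (fst d)))"
      by (rule Hc_bind[OF finL]) (auto simp: D_set set_p)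
    also have "\<dots> = measure_pmf.expectation (map_pmf fst D) (\<lambda>v. ent (p v))" by simp
    also have "\<dots> = measure_pmf.expectation pV (\<lambda>v. ent (p v))" by (simp only: D_fst)
    also have "\<dots> = Hc (bind_pmf pV (\<lambda>v. map_pmf (Pair v) (p v))) snd fst"
      by (rule Hc_bind(3)[OF finL, symmetric]) (auto simp: set_p)
    also have "bind_pmf pV (\<lambda>v. map_pmf (Pair v) (p v)) = map_pmf (\<lambda>\<omega>. (V \<omega>, L \<omega>)) M"
      unfolding pV_def p_def Mv_def map_pmf_comp by (rule bind_map_cond_pmf[where h="\<lambda>v \<omega>. (v, L \<omega>)"])
    finally show ?thesis by (simp add: Hc_map)
  qed
  define a where "a = (\<lambda>v. ent (map_pmf T (Mv v)))"
  define c where "c = (\<lambda>v. measure_pmf.expectation (p v) (\<lambda>x. ent (\<kappa> v x)))"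
  have J_eq: "J v = a v - c v" for v
  proof -
    have "bind_pmf (p v) (\<kappa> v) = map_pmf T (Mv v)"
      unfolding p_def \<kappa>_def by (rule bind_map_cond_pmf[where h="\<lambda>_. T"])
    then show ?thesis by (simp add: J_def a_def c_def)
  qed
  have a: "integrable (measure_pmf pV) a" "measure_pmf.expectation pV a = Hc M T V"
  proof -
    have sub: "set_pmf (map_pmf T (Mv v)) \<subseteq> T ` set_pmf M" if "v \<in> set_pmf pV" for v
      using set_Mv[OF that] by auto
    show "integrable (measure_pmf pV) a" unfolding a_def by (rule Hc_bind[OF finT sub])
    have "measure_pmf.expectation pV a = Hc (bind_pmf pV (\<lambda>v. map_pmf (Pair v) (map_pmf T (Mv v)))) snd fst"
      unfolding a_def by (rule Hc_bind(3)[OF finT sub, symmetric])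
    also have "bind_pmf pV (\<lambda>v. map_pmf (Pair v) (map_pmf T (Mv v))) = map_pmf (\<lambda>\<omega>. (V \<omega>, T \<omega>)) M"
      unfolding pV_def Mv_def map_pmf_comp by (rule bind_map_cond_pmf[where h="\<lambda>v \<omega>. (v, T \<omega>)"])
    finally show "measure_pmf.expectation pV a = Hc M T V" by (simp add: Hc_map)
  qed
  have c_nonneg: "0 \<le> c v" for v by (simp add: c_def ent_nonneg)
  have c: "integrable (measure_pmf pV) c" "measure_pmf.expectation pV c = Hc M T (\<lambda>\<omega>. (L \<omega>, V \<omega>))"
  proof -
    define D' where "D' = bind_pmf pV (\<lambda>v. map_pmf (Pair v) (p v))"
    define N where "N = bind_pmf D' (\<lambda>d. map_pmf (Pair d) (\<kappa> (fst d) (snd d)))"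
    have "N = map_pmf (\<lambda>(v, x, t). ((v, x), t)) (map_pmf (\<lambda>\<omega>. (V \<omega>, L \<omega>, T \<omega>)) M)"
      unfolding proj by (simp add: N_def D'_def bind_assoc_pmf bind_map_pmf map_bind_pmf map_pmf_comp)
    then have N: "N = map_pmf (\<lambda>\<omega>. ((V \<omega>, L \<omega>), T \<omega>)) M" by (simp add: map_pmf_comp)
    have "ennreal (Hc N snd fst) = (\<integral>\<^sup>+d. ennreal (ent (\<kappa> (fst d) (snd d))) \<partial>measure_pmf D')"
      unfolding N_def by (rule Hc_bind[OF finT]) (auto simp: D'_def set_\<kappa>)
    also have "\<dots> = (\<integral>\<^sup>+v. \<integral>\<^sup>+x. ennreal (ent (\<kappa> v x)) \<partial>measure_pmf (p v) \<partial>measure_pmf pV)"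
      by (simp add: D'_def)
    also have "\<dots> = (\<integral>\<^sup>+v. ennreal (c v) \<partial>measure_pmf pV)"
      unfolding c_def
      by (intro nn_integral_cong_AE, unfold AE_measure_pmf_iff, intro ballI nn_integral_eq_integral)
         (auto intro!: integrable_measure_pmf_finite finp simp: ent_nonneg)
    finally have nn: "ennreal (Hc N snd fst) = (\<integral>\<^sup>+v. ennreal (c v) \<partial>measure_pmf pV)" .
    show int: "integrable (measure_pmf pV) c"
      by (rule integrableI_nonneg) (auto simp: c_nonneg nn[symmetric])
    have "measure_pmf.expectation pV c = Hc N snd fst"
      using nn_integral_eq_integral[OF int] nn by (simp add: c_nonneg Hc_nonneg)
    also have "\<dots> = Hc M T (\<lambda>\<omega>. (V \<omega>, L \<omega>))" by (simp add: N Hc_map)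
    also have "\<dots> = Hc M T (\<lambda>\<omega>. (L \<omega>, V \<omega>))" by (rule Hc_cong) auto
    finally show "measure_pmf.expectation pV c = Hc M T (\<lambda>\<omega>. (L \<omega>, V \<omega>))" .
  qed
  have HT: "Hc (ext_pmf M k) (\<lambda>v. T (fst v)) (\<lambda>v. (V (fst v), snd v)) \<le> c0 + I * (1 + 1 / l)"
  proof -
    have "Hc (ext_pmf M k) (\<lambda>v. T (fst v)) (\<lambda>v. (V (fst v), snd v))
        = Hc (map_pmf (\<lambda>(v, x, t, g). ((v, g), t)) R) snd fst"
      by (simp add: R_def Hc_map)
    also have "map_pmf (\<lambda>(v, x, t, g). ((v, g), t)) R = bind_pmf D (\<lambda>d. map_pmf (Pair d) (map_pmf (snd d) (p (fst d))))"
      by (simp add: R D_def map_bind_pmf bind_assoc_pmf bind_map_pmf map_pmf_comp)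
    finally have eq: "Hc (ext_pmf M k) (\<lambda>v. T (fst v)) (\<lambda>v. (V (fst v), snd v)) = Hc \<dots> snd fst" .
    have int: "integrable (measure_pmf pV) (\<lambda>v. c0 + J v * (1 + 1 / l))"
      unfolding J_eq using a(1) c(1) by simp
    have "ennreal (Hc (ext_pmf M k) (\<lambda>v. T (fst v)) (\<lambda>v. (V (fst v), snd v)))
        = (\<integral>\<^sup>+d. ennreal (ent (map_pmf (snd d) (p (fst d)))) \<partial>measure_pmf D)"
      unfolding eq
    proof (rule Hc_bind[OF finT])
      fix d assume d: "d \<in> set_pmf D"
      show "set_pmf (map_pmf (snd d) (p (fst d))) \<subseteq> T ` set_pmf M"
      proof clarsimp
        fix x assume x: "x \<in> set_pmf (p (fst d))"
        have "snd d x \<in> set_pmf (map_pmf (\<lambda>g. g x) (\<Phi> (fst d)))" using d by (auto simp: D_set)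
        also have "\<dots> \<subseteq> T ` set_pmf M" using \<Phi>[OF _ x] set_\<kappa>[OF _ x] d by (auto simp: D_set)
        finally show "snd d x \<in> T ` set_pmf M" .
      qed
    qed
    also have "\<dots> = (\<integral>\<^sup>+v. \<integral>\<^sup>+g. ennreal (ent (map_pmf g (p v))) \<partial>measure_pmf (\<Phi> v) \<partial>measure_pmf pV)"
      by (simp add: D_def)
    also have "\<dots> \<le> (\<integral>\<^sup>+v. ennreal (c0 + J v * (1 + 1 / l)) \<partial>measure_pmf pV)"
    proof (intro nn_integral_mono_AE, unfold AE_measure_pmf_iff, rule ballI)
      fix v assume v: "v \<in> set_pmf pV"
      have "(\<integral>\<^sup>+g. ennreal (ent (map_pmf g (p v))) \<partial>measure_pmf (\<Phi> v))
        = ennreal (measure_pmf.expectation (\<Phi> v) (\<lambda>g. ent (map_pmf g (p v))))"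
        by (intro nn_integral_eq_integral integrable_measure_pmf_finite \<Phi>_fin[OF v]) (simp add: ent_nonneg)
      then show "(\<integral>\<^sup>+g. ennreal (ent (map_pmf g (p v))) \<partial>measure_pmf (\<Phi> v)) \<le> ennreal (c0 + J v * (1 + 1 / l))"
        using \<Phi>_le[OF v] by (simp add: ennreal_leI)
    qed
    also have "\<dots> = ennreal (measure_pmf.expectation pV (\<lambda>v. c0 + J v * (1 + 1 / l)))"
    proof (rule nn_integral_eq_integral[OF int], unfold AE_measure_pmf_iff, rule ballI)
      fix v assume v: "v \<in> set_pmf pV"
      have "0 \<le> measure_pmf.expectation (\<Phi> v) (\<lambda>g. ent (map_pmf g (p v)))" by (simp add: ent_nonneg)
      then show "0 \<le> c0 + J v * (1 + 1 / l)" using \<Phi>_le[OF v] by linarith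
    qed
    finally have le: "ennreal (Hc (ext_pmf M k) (\<lambda>v. T (fst v)) (\<lambda>v. (V (fst v), snd v)))
        \<le> ennreal (measure_pmf.expectation pV (\<lambda>v. c0 + J v * (1 + 1 / l)))" .
    have E: "measure_pmf.expectation pV (\<lambda>v. c0 + J v * (1 + 1 / l)) = c0 + I * (1 + 1 / l)"
    proof -
      have "measure_pmf.expectation pV J = I"
        unfolding J_eq[abs_def] I_def using a c by simp
      moreover have "integrable (measure_pmf pV) J" unfolding J_eq[abs_def] using a c by simp
      ultimately show ?thesis by simp
    qed
    have "0 \<le> measure_pmf.expectation pV (\<lambda>v. c0 + J v * (1 + 1 / l))"
    proof (rule integral_nonneg_AE, unfold AE_measure_pmf_iff, rule ballI)
      fix v assume v: "v \<in> set_pmf pV"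
      have "0 \<le> measure_pmf.expectation (\<Phi> v) (\<lambda>g. ent (map_pmf g (p v)))" by (simp add: ent_nonneg)
      then show "0 \<le> c0 + J v * (1 + 1 / l)" using \<Phi>_le[OF v] by linarith
    qed
    then show ?thesis using le unfolding E by simp
  qed
  show thesis
  proof
    show "k \<omega>' = k \<omega>" if "V \<omega>' = V \<omega>" "L \<omega>' = L \<omega>" "T \<omega>' = T \<omega>" for \<omega> \<omega>'
      using that by (simp add: k_def)
    show "g (L \<omega>) = T \<omega>" if "(\<omega>, g) \<in> set_pmf (ext_pmf M k)" for \<omega> g
    proof -
      have \<omega>: "\<omega> \<in> set_pmf M" and g: "g \<in> set_pmf (k \<omega>)" using that by (auto simp: set_ext_pmf)
      have v: "V \<omega> \<in> set_pmf pV" using \<omega> by (simp add: pV_def)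
      have x: "L \<omega> \<in> set_pmf (p (V \<omega>))" using \<omega> by (auto simp: set_p[OF v])
      have "T \<omega> \<in> set_pmf (\<kappa> (V \<omega>) (L \<omega>))" using \<omega> by (auto simp: set_\<kappa>[OF v x])
      then have "set_pmf (\<Phi> (V \<omega>)) \<inter> (\<lambda>g. g (L \<omega>)) -` {T \<omega>} \<noteq> {}"
        unfolding \<Phi>[OF v x, symmetric] by auto
      then show ?thesis using g by (simp add: k_def K_def set_cond_pmf)
    qed
    show "Hc (ext_pmf M k) (\<lambda>v. L (fst v)) (\<lambda>v. (V (fst v), snd v)) = Hc M L V" by (rule HL)
    show "Hc (ext_pmf M k) (\<lambda>v. T (fst v)) (\<lambda>v. (V (fst v), snd v))
       \<le> log 2 l + log 2 (1 + b) + I + (I + log 2 (1 + 1 / b)) / l"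
      using HT by (simp only: bdd_eq)
  qed
qed

section \<open>Truncation to finite alphabets\<close>

text \<open>Dominated convergence along an enumeration of the countable support.\<close>

lemma finite_support_approx:
  fixes f :: "'m \<Rightarrow> real"
  assumes int: "integrable (measure_pmf M) f" and e: "0 < e"
  obtains A where "finite A" "A \<subseteq> set_pmf M"
    "\<bar>measure_pmf.expectation M (\<lambda>\<omega>. if \<omega> \<in> A then 0 else f \<omega>)\<bar> < e"
proof -
  let ?A = "\<lambda>n. {\<omega> \<in> set_pmf M. to_nat_on (set_pmf M) \<omega> < n}"
  have "(\<lambda>n. measure_pmf.expectation M (\<lambda>\<omega>. if \<omega> \<in> ?A n then 0 else f \<omega>)) \<longlonglongrightarrow> measure_pmf.expectation M (\<lambda>_. 0 :: real)"
  proof (rule integral_dominated_convergence[where w="\<lambda>\<omega>. norm (f \<omega>)"])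
    show "AE \<omega> in measure_pmf M. (\<lambda>n. if \<omega> \<in> ?A n then 0 else f \<omega>) \<longlonglongrightarrow> 0"
      unfolding AE_measure_pmf_iff
    proof
      fix \<omega> assume "\<omega> \<in> set_pmf M"
      then have "eventually (\<lambda>n. (if \<omega> \<in> ?A n then 0 else f \<omega>) = 0) sequentially"
        by (intro eventually_mono[OF eventually_gt_at_top[of "to_nat_on (set_pmf M) \<omega>"]]) auto
      then show "(\<lambda>n. if \<omega> \<in> ?A n then 0 else f \<omega>) \<longlonglongrightarrow> 0" by (rule tendsto_eventually)
    qed
  qed (use int in auto)
  then have "eventually (\<lambda>n. dist (measure_pmf.expectation M (\<lambda>\<omega>. if \<omega> \<in> ?A n then 0 else f \<omega>)) (measure_pmf.expectation M (\<lambda>_. 0 :: real)) < e) sequentially"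
    using e by (rule tendstoD)
  then obtain n where n: "dist (measure_pmf.expectation M (\<lambda>\<omega>. if \<omega> \<in> ?A n then 0 else f \<omega>)) (measure_pmf.expectation M (\<lambda>_. 0 :: real)) < e"
    by (auto simp: eventually_sequentially)
  have "finite (?A n)"
  proof (rule inj_on_finite[of "to_nat_on (set_pmf M)" _ "{..<n}"])
    show "inj_on (to_nat_on (set_pmf M)) (?A n)"
      by (rule inj_on_subset[OF inj_on_to_nat_on]) (auto simp: countable_set_pmf)
  qed auto
  then show thesis using n by (intro that[of "?A n"]) auto
qed

text \<open>Any bound that vanishes with the probability of \<open>False\<close> would serve to show
  that a truncation event carries little entropy. The two terms of \<open>ent q * ln 2\<close> are
  at most Q and \<open>2 * sqrt Q\<close>, and 3 \<le> 5 ln 2.\<close>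

lemma binary_ent_le:
  fixes q :: "bool pmf"
  shows "ent q \<le> 5 * sqrt (pmf q False)"
proof -
  define Q where "Q = pmf q False"
  have Q: "0 \<le> Q" "Q \<le> 1" by (auto simp: Q_def pmf_le_1)
  have T: "pmf q True = 1 - Q"
    using sum_pmf_eq_1[of "{True, False}" q] by (simp add: Q_def subset_iff)
  have "ent q = - (1 - Q) * log 2 (1 - Q) - Q * log 2 Q"
    using ent_finite[of "{True, False}" q] T by (simp add: Q_def subset_iff algebra_simps)
  then have eq: "ent q * ln 2 = (1 - Q) * - ln (1 - Q) + Q * - ln Q"
    by (simp add: log_def divide_simps) (simp add: algebra_simps)
  have 1: "(1 - Q) * - ln (1 - Q) \<le> Q"
  proof (cases "Q = 1")
    case False
    then have "0 < 1 - Q" using Q by simp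
    then have "- ln (1 - Q) \<le> 1 / (1 - Q) - 1"
      using ln_le_minus_one[of "1 / (1 - Q)"] by (simp add: ln_div)
    then have "(1 - Q) * - ln (1 - Q) \<le> (1 - Q) * (1 / (1 - Q) - 1)"
      using \<open>0 < 1 - Q\<close> by (intro mult_left_mono) auto
    also have "\<dots> = Q" using \<open>0 < 1 - Q\<close> by (simp add: field_simps)
    finally show ?thesis .
  qed simp
  have 2: "Q * - ln Q \<le> 2 * sqrt Q"
  proof (cases "Q = 0")
    case False
    then have s: "0 < sqrt Q" using Q by simp
    then have "- ln (sqrt Q) \<le> 1 / sqrt Q - 1"
      using ln_le_minus_one[of "1 / sqrt Q"] by (simp add: ln_div)
    moreover have "ln Q = 2 * ln (sqrt Q)" using s by (simp add: ln_sqrt)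
    ultimately have "- ln Q \<le> 2 / sqrt Q" by simp
    then have "Q * - ln Q \<le> Q * (2 / sqrt Q)" using Q by (intro mult_left_mono) auto
    also have "\<dots> = 2 * sqrt Q"
      using s Q by (simp add: field_simps)
    finally show ?thesis .
  qed simp
  have "Q \<le> sqrt Q"
    using Q by (intro real_le_rsqrt) (simp add: power2_eq_square mult_left_le)
  then have "ent q * ln 2 \<le> 3 * sqrt Q" using eq 1 2 by simp
  also have "3 * sqrt Q \<le> (5 * sqrt Q) * ln 2"
    using mult_left_mono[OF ln2_ge_two_thirds, of "5 * sqrt Q"] real_sqrt_ge_zero[OF Q(1)] by linarith
  finally show ?thesis by (simp add: Q_def)
qed

lemma fin_rv_truncated:
  assumes "fin_rv M X" shows "fin_rv M (\<lambda>\<omega>. if E \<omega> then Some (X \<omega>) else None)"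
proof -
  have "fin_rv M E" by (rule fin_rv_finite) simp
  with assms have "fin_rv M (\<lambda>\<omega>. (X \<omega>, E \<omega>))" by (rule fin_rv_pair)
  then show ?thesis by (rule fin_rv_mono) auto
qed

text \<open>E may depend on more than X, so X' need not be a function of X; but X and E determine
  it, whence the first bound. For the second, H(X | X') = H(X' | X) + H(X) - H(X'). On E the blocks
  of X' lie in those of X, so H(X') is at least the part of H(X) carried by E.\<close>

lemma Hc_truncation:
  fixes E :: "'m \<Rightarrow> bool"
  assumes fin: "fin_rv M X"
  defines "X' \<equiv> \<lambda>\<omega>. if E \<omega> then Some (X \<omega>) else None"
  shows "Hc M X' X \<le> Hc M E (\<lambda>_. ())"
    and "Hc M X X' \<le> measure_pmf.expectation M (\<lambda>\<omega>. if E \<omega> then 0 else self_info M X (\<lambda>_. ()) \<omega>) + Hc M E (\<lambda>_. ())"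
proof -
  have finE: "fin_rv M E" by (rule fin_rv_finite) simp
  have fin': "fin_rv M X'" unfolding X'_def by (rule fin_rv_truncated[OF fin])
  have "Hc M X' X \<le> Hc M X' (\<lambda>\<omega>. (E \<omega>, X \<omega>)) + Hc M E X" by (rule Hc_triangle[OF fin' finE])
  also have "Hc M X' (\<lambda>\<omega>. (E \<omega>, X \<omega>)) = 0" by (rule Hc_determined) (auto simp: X'_def)
  also have "Hc M E X \<le> Hc M E (\<lambda>_. ())" by (rule Hc_mono_cond[OF finE]) simp
  finally show 1: "Hc M X' X \<le> Hc M E (\<lambda>_. ())" by simp
  let ?s = "self_info M X (\<lambda>_. ())"
  have int: "integrable (measure_pmf M) ?s" using fin by (simp add: fin_rv_def)
  have i1: "integrable (measure_pmf M) (\<lambda>\<omega>. if E \<omega> then ?s \<omega> else 0)"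
    and i2: "integrable (measure_pmf M) (\<lambda>\<omega>. if E \<omega> then 0 else ?s \<omega>)"
    by (rule Bochner_Integration.integrable_bound[OF int]; simp)+
  have "measure_pmf.expectation M (\<lambda>\<omega>. if E \<omega> then ?s \<omega> else 0) \<le> Hc M X' (\<lambda>_. ())"
    unfolding Hc_def
  proof (rule integral_mono_AE[OF i1 fin_rv_integrable[OF fin']], unfold AE_measure_pmf_iff, rule ballI)
    fix \<omega> assume \<omega>: "\<omega> \<in> set_pmf M"
    show "(if E \<omega> then ?s \<omega> else 0) \<le> self_info M X' (\<lambda>_. ()) \<omega>"
    proof (cases "E \<omega>")
      case True
      have "rv_prob M (\<lambda>\<omega>. (X' \<omega>, ())) \<omega> \<le> rv_prob M (\<lambda>\<omega>. (X \<omega>, ())) \<omega>"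
        by (rule rv_prob_mono[OF \<omega>]) (use True in \<open>auto simp: X'_def split: if_splits\<close>)
      then show ?thesis
        using True rv_prob_pos[OF \<omega>, of "\<lambda>\<omega>. (X' \<omega>, ())"] rv_prob_pos[OF \<omega>, of "\<lambda>\<omega>. (X \<omega>, ())"]
        by (simp add: self_info_def)
    qed (simp add: self_info_nonneg[OF \<omega>])
  qed
  moreover have "Hc M X (\<lambda>_. ()) = measure_pmf.expectation M (\<lambda>\<omega>. if E \<omega> then ?s \<omega> else 0)
      + measure_pmf.expectation M (\<lambda>\<omega>. if E \<omega> then 0 else ?s \<omega>)"
    unfolding Hc_def Bochner_Integration.integral_add[OF i1 i2, symmetric]
    by (intro Bochner_Integration.integral_cong) auto
  moreover have "Hc M X X' + Hc M X' (\<lambda>_. ()) = Hc M X' X + Hc M X (\<lambda>_. ())"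
  proof -
    have "Hc M X (\<lambda>\<omega>. (X' \<omega>, ())) = Hc M X X'" "Hc M X' (\<lambda>\<omega>. (X \<omega>, ())) = Hc M X' X"
      by (rule Hc_cong; simp)+
    then show ?thesis using Hc_exchange[OF fin fin', of "\<lambda>_. ()"] by simp
  qed
  ultimately show "Hc M X X' \<le> measure_pmf.expectation M (\<lambda>\<omega>. if E \<omega> then 0 else ?s \<omega>) + Hc M E (\<lambda>_. ())"
    using 1 by simp
qed

text \<open>One finite set serves every event containing it. This uniformity matters because the
  event is later formed from the images of A under two variables.\<close>

lemma truncation_approx:
  assumes fin: "fin_rv M X" and \<delta>: "0 < \<delta>"
  obtains A where "finite A" "A \<subseteq> set_pmf M"
    "\<And>E. A \<subseteq> Collect E \<Longrightarrow> Hc M (\<lambda>\<omega>. if E \<omega> then Some (X \<omega>) else None) X \<le> \<delta>"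
    "\<And>E. A \<subseteq> Collect E \<Longrightarrow> Hc M X (\<lambda>\<omega>. if E \<omega> then Some (X \<omega>) else None) \<le> \<delta>"
proof -
  let ?s = "self_info M X (\<lambda>_. ())"
  \<comment> \<open>\<open>\<delta> / 2\<close> bounds the lost entropy; the square makes
    \<open>5 * sqrt e\<close> at most \<open>\<delta> / 2\<close>, which bounds the entropy of the
    event.\<close>
  define e where "e = min (\<delta> / 2) ((\<delta> / 10)\<^sup>2)"
  have e: "0 < e" using \<delta> by (simp add: e_def)
  \<comment> \<open>The summand 1 lets a single tail estimate control both the lost entropy and the
    lost probability.\<close>
  have int: "integrable (measure_pmf M) (\<lambda>\<omega>. ?s \<omega> + 1)" using fin by (simp add: fin_rv_def)
  obtain A where A: "finite A" "A \<subseteq> set_pmf M"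
    and le: "\<bar>measure_pmf.expectation M (\<lambda>\<omega>. if \<omega> \<in> A then 0 else ?s \<omega> + 1)\<bar> < e"
    by (rule finite_support_approx[OF int e])
  have intA: "integrable (measure_pmf M) (\<lambda>\<omega>. if \<omega> \<in> A then 0 else ?s \<omega> + 1)"
    by (rule Bochner_Integration.integrable_bound[OF int]) auto
  have tail: "measure_pmf.expectation M f \<le> e"
    if "\<And>\<omega>. \<omega> \<in> set_pmf M \<Longrightarrow> 0 \<le> f \<omega> \<and> f \<omega> \<le> (if \<omega> \<in> A then 0 else ?s \<omega> + 1)" for f :: "'a \<Rightarrow> real"
  proof -
    have "measure_pmf.expectation M f \<le> measure_pmf.expectation M (\<lambda>\<omega>. if \<omega> \<in> A then 0 else ?s \<omega> + 1)"
    proof (rule integral_mono_AE[OF _ intA])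
      show "integrable (measure_pmf M) f"
      proof (rule Bochner_Integration.integrable_bound[OF intA])
        show "AE \<omega> in measure_pmf M. norm (f \<omega>) \<le> norm (if \<omega> \<in> A then 0 else ?s \<omega> + 1)"
          unfolding AE_measure_pmf_iff
        proof
          fix \<omega> assume "\<omega> \<in> set_pmf M"
          from that[OF this] show "norm (f \<omega>) \<le> norm (if \<omega> \<in> A then 0 else ?s \<omega> + 1)"
            by (simp split: if_splits)
        qed
      qed simp
    qed (use that in \<open>auto simp: AE_measure_pmf_iff\<close>)
    then show ?thesis using le by simp
  qed
  have HE: "Hc M E (\<lambda>_. ()) \<le> \<delta> / 2" if E: "A \<subseteq> Collect E" for E
  proof -
    have "fin_rv M E" by (rule fin_rv_finite) simp
    then have "Hc M E (\<lambda>_. ()) = ent (map_pmf E M)" by (rule Hc_ent)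
    also have "\<dots> \<le> 5 * sqrt (pmf (map_pmf E M) False)" by (rule binary_ent_le)
    also have "pmf (map_pmf E M) False \<le> e"
    proof -
      have "pmf (map_pmf E M) False = measure_pmf.expectation M (\<lambda>\<omega>. indicator {\<omega>. \<not> E \<omega>} \<omega>)"
        by (simp add: pmf_map vimage_def)
      also have "\<dots> \<le> e" by (rule tail) (use E in \<open>auto simp: self_info_nonneg indicator_def\<close>)
      finally show ?thesis .
    qed
    also have "e \<le> (\<delta> / 10)\<^sup>2" by (simp add: e_def)
    finally show ?thesis using \<delta> by simp
  qed
  show thesis
  proof (rule that[OF A])
    fix E assume E: "A \<subseteq> Collect E"
    show "Hc M (\<lambda>\<omega>. if E \<omega> then Some (X \<omega>) else None) X \<le> \<delta>"
      using Hc_truncation(1)[OF fin, of E] HE[OF E] \<delta> by simp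
    have "measure_pmf.expectation M (\<lambda>\<omega>. if E \<omega> then 0 else ?s \<omega>) \<le> e"
      by (rule tail) (use E in \<open>auto simp: self_info_nonneg\<close>)
    also have "e \<le> \<delta> / 2" by (simp add: e_def)
    finally show "Hc M X (\<lambda>\<omega>. if E \<omega> then Some (X \<omega>) else None) \<le> \<delta>"
      using Hc_truncation(2)[OF fin, of E] HE[OF E] by simp
  qed
qed

text \<open>The cutoff \<open>b = 1/40\<close> balances \<open>log (1 + b)\<close>, which enters the constant 1.06, against
  \<open>log (1 + 1/b) \<le> 5.51\<close>.\<close>
lemma representation_constants:
  fixes I :: real
  assumes I: "0 \<le> I"
  defines "l \<equiv> (I + 5.51) * ln 2"
  shows "log 2 l + log 2 (1 + 1 / 40) + I + (I + log 2 (1 + 1 / (1 / 40))) / l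
     \<le> I + log 2 (I + 5.51) + 1.06"
proof -
  have lnpos: "0 < ln (2::real)" by simp
  have l: "log 2 l = log 2 (I + 5.51) + log 2 (ln 2)" using I by (simp add: l_def log_mult)
  \<comment> \<open>41^2 = 1681 < 2048 = 2^11.\<close>
  have "2 * log 2 (41 :: real) = log 2 (41 ^ 2)" by (subst log_nat_power) simp_all
  then have "log 2 (41 :: real) = log 2 (41 ^ 2) / 2" by simp
  also have "\<dots> \<le> log 2 (2 ^ 11) / 2" by (intro divide_right_mono) (simp_all del: log_pow_cancel)
  also have "\<dots> = 11 / 2" by (simp only: log_pow_cancel)
  finally have l41: "log 2 (41 :: real) \<le> 5.51" by simp
  have "(I + log 2 41) / l \<le> (I + 5.51) / l"
    using l41 I lnpos by (intro divide_right_mono) (auto simp: l_def)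
  also have "\<dots> = 1 / ln 2" using I by (simp add: l_def)
  finally have 1: "(I + log 2 41) / l \<le> 1 / ln 2" .
  \<comment> \<open>The estimate \<open>ln (ln 2) \<le> - ln 2 / 2\<close> is equivalent to (ln 2)^2
    \<le> 1/2, and 625/1296 < 1/2.\<close>
  have "(ln 2)\<^sup>2 \<le> (25 / 36 :: real)\<^sup>2" using ln2_le_25_over_36 by (intro power_mono) auto
  then have "(ln 2)\<^sup>2 \<le> (1 / 2 :: real)" by (simp add: power2_eq_square)
  then have "ln ((ln 2)\<^sup>2) \<le> ln (1 / 2 :: real)" using lnpos by (subst ln_le_cancel_iff) auto
  then have lnln: "ln (ln 2 :: real) \<le> - ln 2 / 2" by (simp add: ln_realpow ln_div)
  have "ln (41 / 40 :: real) \<le> 1 / 40" using ln_le_minus_one[of "41 / 40 :: real"] by simp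
  \<comment> \<open>It suffices that 1 + 1/40 \<le> 1.56 ln 2, and 1.56 * 2/3 = 1.04.\<close>
  then have "ln (ln 2) + ln (41 / 40) + 1 \<le> 1.06 * ln (2 :: real)"
    using lnln ln2_ge_two_thirds by simp
  then have "(ln (ln 2) + ln (41 / 40) + 1) / ln 2 \<le> (1.06 :: real)"
    using lnpos by (subst pos_divide_le_eq) auto
  then have "log 2 (ln 2) + log 2 (41 / 40) + 1 / ln 2 \<le> (1.06 :: real)"
    by (simp add: log_def add_divide_distrib)
  moreover have "1 + 1 / 40 = (41 / 40 :: real)" "1 + 1 / (1 / 40) = (41 :: real)" by simp_all
  ultimately show ?thesis using 1 l by (simp only:)
qed

text \<open>At arguments from 5.51 on, the slope of the binary logarithm is below 1/2. This absorbs
  the growth of the information under truncation.\<close>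

lemma log_shift_le:
  fixes x d :: real
  assumes "0 \<le> x" "0 \<le> d"
  shows "log 2 (x + 2 * d + 5.51) \<le> log 2 (x + 5.51) + d"
proof -
  have "ln ((x + 2 * d + 5.51) / (x + 5.51)) \<le> (x + 2 * d + 5.51) / (x + 5.51) - 1"
    using assms by (intro ln_le_minus_one) simp
  also have "\<dots> = 2 * d / (x + 5.51)" using assms by (simp add: field_simps)
  also have "\<dots> \<le> 2 * d / 3" using assms by (intro divide_left_mono) auto
  also have "\<dots> \<le> d * ln 2" using ln2_ge_two_thirds assms mult_left_mono[of "2/3" "ln 2" d] by simp
  finally have "ln (x + 2 * d + 5.51) - ln (x + 5.51) \<le> d * ln 2"
    using assms by (subst (asm) ln_divide_pos) auto
  then have "(ln (x + 2 * d + 5.51) - ln (x + 5.51)) / ln 2 \<le> d" by (simp add: field_simps)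
  then show ?thesis by (simp add: log_def diff_divide_distrib)
qed

text \<open>Truncation leaves H(W | V,Z) = H(W | V) intact. The kernel sees W only through L. Where
  L is \<open>None\<close>, T' is \<open>None\<close> too and adds nothing about W; elsewhere L
  determines W. So given L and V, neither T' nor the function tells anything about W, and for L
  itself the finite case applies.\<close>

lemma functional_representation_extension:
  fixes M :: "'m pmf" and W :: "'m \<Rightarrow> 'w" and T :: "'m \<Rightarrow> 't" and V :: "'m \<Rightarrow> 'v" and \<delta> :: real
  assumes finW: "fin_rv M W" and finT: "fin_rv M T" and \<delta>: "0 < \<delta>"
  defines "I \<equiv> Hc M T V - Hc M T (\<lambda>\<omega>. (W \<omega>, V \<omega>))"
  obtains k :: "'m \<Rightarrow> ('w option \<Rightarrow> 't option) pmf" where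
    "\<And>\<omega> \<omega>'. V \<omega>' = V \<omega> \<Longrightarrow> W \<omega>' = W \<omega> \<Longrightarrow> T \<omega>' = T \<omega> \<Longrightarrow> k \<omega>' = k \<omega>"
    "Hc (ext_pmf M k) (\<lambda>v. W (fst v)) (\<lambda>v. (V (fst v), snd v)) = Hc M W V"
    "Hc (ext_pmf M k) (\<lambda>v. T (fst v)) (\<lambda>v. (W (fst v), V (fst v), snd v)) \<le> \<delta>"
    "Hc (ext_pmf M k) (\<lambda>v. T (fst v)) (\<lambda>v. (V (fst v), snd v)) \<le> I + log 2 (I + 5.51) + 1.06 + \<delta>"
proof -
  \<comment> \<open>The budget: \<open>I'\<close> exceeds I by at most 2d, the logarithm adds d, and
    recovering T from T' another d.\<close>
  define d where "d = \<delta> / 4"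
  have d: "0 < d" using \<delta> by (simp add: d_def)
  obtain A where A: "finite A" "A \<subseteq> set_pmf M"
    and Hle: "\<And>E. A \<subseteq> Collect E \<Longrightarrow> Hc M (\<lambda>\<omega>. if E \<omega> then Some (T \<omega>) else None) T \<le> d"
     "\<And>E. A \<subseteq> Collect E \<Longrightarrow> Hc M T (\<lambda>\<omega>. if E \<omega> then Some (T \<omega>) else None) \<le> d"
    by (rule truncation_approx[OF finT d]; (rule that; assumption)?)
  \<comment> \<open>E involves W as well as T, so that T' is constant where L is
    \<open>None\<close>.\<close>
  define E where "E = (\<lambda>\<omega>. W \<omega> \<in> W ` A \<and> T \<omega> \<in> T ` A)"
  define T' where "T' = (\<lambda>\<omega>. if E \<omega> then Some (T \<omega>) else None)"
  define L where "L = (\<lambda>\<omega>. if W \<omega> \<in> W ` A then Some (W \<omega>) else None)"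
  have T'T: "Hc M T' T \<le> d" and TT': "Hc M T T' \<le> d"
    unfolding T'_def by (intro Hle; auto simp: E_def)+
  have finT': "fin_rv M T'" unfolding T'_def by (rule fin_rv_truncated[OF finT])
  have finL: "fin_rv M L" unfolding L_def by (rule fin_rv_truncated[OF finW])
  have setL: "finite (L ` set_pmf M)"
    by (rule finite_subset[of _ "insert None (Some ` W ` A)"]) (use A in \<open>auto simp: L_def\<close>)
  have setT': "finite (T' ` set_pmf M)"
    by (rule finite_subset[of _ "insert None (Some ` T ` A)"]) (use A in \<open>auto simp: T'_def E_def\<close>)
  define I' where "I' = Hc M T' V - Hc M T' (\<lambda>\<omega>. (L \<omega>, V \<omega>))"
  have I'0: "0 \<le> I'"
    unfolding I'_def using Hc_mono_cond[OF finT', of "\<lambda>\<omega>. (L \<omega>, V \<omega>)" V] by simp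
  have I0: "0 \<le> I"
    unfolding I_def using Hc_mono_cond[OF finT, of "\<lambda>\<omega>. (W \<omega>, V \<omega>)" V] by simp
  have I'_le: "I' \<le> I + 2 * d"
  proof -
    have "Hc M T' V \<le> Hc M T' (\<lambda>\<omega>. (T \<omega>, V \<omega>)) + Hc M T V" by (rule Hc_triangle[OF finT' finT])
    also have "Hc M T' (\<lambda>\<omega>. (T \<omega>, V \<omega>)) \<le> Hc M T' T" by (rule Hc_mono_cond[OF finT']) auto
    finally have 1: "Hc M T' V \<le> Hc M T V + d" using T'T by simp
    have "Hc M T (\<lambda>\<omega>. (W \<omega>, V \<omega>)) \<le> Hc M T (\<lambda>\<omega>. (T' \<omega>, W \<omega>, V \<omega>)) + Hc M T' (\<lambda>\<omega>. (W \<omega>, V \<omega>))"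
      by (rule Hc_triangle[OF finT finT'])
    also have "Hc M T (\<lambda>\<omega>. (T' \<omega>, W \<omega>, V \<omega>)) \<le> Hc M T T'" by (rule Hc_mono_cond[OF finT]) auto
    also have "Hc M T' (\<lambda>\<omega>. (W \<omega>, V \<omega>)) \<le> Hc M T' (\<lambda>\<omega>. (L \<omega>, V \<omega>))"
      by (rule Hc_mono_cond[OF finT']) (auto simp: L_def)
    finally show ?thesis using 1 TT' by (simp add: I'_def I_def)
  qed
  define l where "l = (I' + 5.51) * ln 2"
  have l: "0 < l" using I'0 by (simp add: l_def)
  obtain k :: "'m \<Rightarrow> ('w option \<Rightarrow> 't option) pmf" where
    dep: "\<And>\<omega> \<omega>'. V \<omega>' = V \<omega> \<Longrightarrow> L \<omega>' = L \<omega> \<Longrightarrow> T' \<omega>' = T' \<omega> \<Longrightarrow> k \<omega>' = k \<omega>"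
    and fr: "\<And>\<omega> g. (\<omega>, g) \<in> set_pmf (ext_pmf M k) \<Longrightarrow> g (L \<omega>) = T' \<omega>"
    and HL: "Hc (ext_pmf M k) (\<lambda>v. L (fst v)) (\<lambda>v. (V (fst v), snd v)) = Hc M L V"
    and HT': "Hc (ext_pmf M k) (\<lambda>v. T' (fst v)) (\<lambda>v. (V (fst v), snd v))
       \<le> log 2 l + log 2 (1 + 1 / 40) + I' + (I' + log 2 (1 + 1 / (1 / 40))) / l"
    by (rule conditional_functional_representation[OF setL setT' _ l, of "1 / 40" V, folded I'_def];
        (rule that; assumption)?) simp
  let ?M = "ext_pmf M k"
  note fin = finW[THEN fin_rv_ext_fst[THEN iffD2], of k] finT[THEN fin_rv_ext_fst[THEN iffD2], of k]
    finT'[THEN fin_rv_ext_fst[THEN iffD2], of k] finL[THEN fin_rv_ext_fst[THEN iffD2], of k]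
  have T'_le: "Hc ?M (\<lambda>v. T' (fst v)) (\<lambda>v. (V (fst v), snd v)) \<le> I + log 2 (I + 5.51) + 1.06 + 3 * d"
  proof -
    have "Hc ?M (\<lambda>v. T' (fst v)) (\<lambda>v. (V (fst v), snd v)) \<le> I' + log 2 (I' + 5.51) + 1.06"
      using HT' representation_constants[OF I'0] unfolding l_def by linarith
    also have "log 2 (I' + 5.51) \<le> log 2 (I + 2 * d + 5.51)" using I'0 I'_le by simp
    also have "\<dots> \<le> log 2 (I + 5.51) + d" using I0 d by (intro log_shift_le) auto
    finally show ?thesis using I'_le by simp
  qed
  have TT'_ext: "Hc ?M (\<lambda>v. T (fst v)) (\<lambda>v. T' (fst v)) \<le> d"
    using TT' by (simp add: Hc_ext_fst)
  show thesis
  proof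
    fix \<omega> \<omega>' assume eq: "V \<omega>' = V \<omega>" "W \<omega>' = W \<omega>" "T \<omega>' = T \<omega>"
    then show "k \<omega>' = k \<omega>" by (intro dep) (simp_all add: L_def T'_def E_def)
  next
    have "Hc ?M (\<lambda>v. T (fst v)) (\<lambda>v. (W (fst v), V (fst v), snd v)) \<le> Hc ?M (\<lambda>v. T (fst v)) (\<lambda>v. T' (fst v))"
    proof (rule Hc_mono_cond[OF fin(2)])
      fix v v' assume v: "v \<in> set_pmf ?M" "v' \<in> set_pmf ?M"
        and eq: "(W (fst v'), V (fst v'), snd v') = (W (fst v), V (fst v), snd v)"
      then have "L (fst v') = L (fst v)" by (simp add: L_def)
      then show "T' (fst v') = T' (fst v)"
        using fr[of "fst v" "snd v"] fr[of "fst v'" "snd v'"] v eq by simp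
    qed
    then show "Hc ?M (\<lambda>v. T (fst v)) (\<lambda>v. (W (fst v), V (fst v), snd v)) \<le> \<delta>"
      using TT'_ext d by (simp add: d_def)
  next
    have "Hc ?M (\<lambda>v. T (fst v)) (\<lambda>v. (V (fst v), snd v))
       \<le> Hc ?M (\<lambda>v. T (fst v)) (\<lambda>v. (T' (fst v), V (fst v), snd v)) + Hc ?M (\<lambda>v. T' (fst v)) (\<lambda>v. (V (fst v), snd v))"
      by (rule Hc_triangle[OF fin(2,3)])
    also have "Hc ?M (\<lambda>v. T (fst v)) (\<lambda>v. (T' (fst v), V (fst v), snd v)) \<le> Hc ?M (\<lambda>v. T (fst v)) (\<lambda>v. T' (fst v))"
      by (rule Hc_mono_cond[OF fin(2)]) auto
    finally show "Hc ?M (\<lambda>v. T (fst v)) (\<lambda>v. (V (fst v), snd v)) \<le> I + log 2 (I + 5.51) + 1.06 + \<delta>"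
      using TT'_ext T'_le by (simp add: d_def)
  next
    show "Hc ?M (\<lambda>v. W (fst v)) (\<lambda>v. (V (fst v), snd v)) = Hc M W V"
    proof (rule antisym)
      have "Hc ?M (\<lambda>v. W (fst v)) (\<lambda>v. (V (fst v), snd v)) \<le> Hc ?M (\<lambda>v. W (fst v)) (\<lambda>v. V (fst v))"
        by (rule Hc_mono_cond[OF fin(1)]) auto
      then show "Hc ?M (\<lambda>v. W (fst v)) (\<lambda>v. (V (fst v), snd v)) \<le> Hc M W V" by (simp add: Hc_ext_fst)
      have "Hc M W V = Hc M (\<lambda>\<omega>. (W \<omega>, L \<omega>)) V" by (rule Hc_cong) (auto simp: L_def)
      also have "\<dots> = Hc M W (\<lambda>\<omega>. (L \<omega>, V \<omega>)) + Hc M L V" by (rule Hc_chain[OF finW finL])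
      also have "Hc M W (\<lambda>\<omega>. (L \<omega>, V \<omega>)) = Hc M W (\<lambda>\<omega>. (L \<omega>, V \<omega>, T' \<omega>))"
        unfolding Hc_def
      proof (rule integral_cong_AE, simp, simp, unfold AE_measure_pmf_iff, rule ballI)
        fix \<omega> assume \<omega>: "\<omega> \<in> set_pmf M"
        show "self_info M W (\<lambda>\<omega>. (L \<omega>, V \<omega>)) \<omega> = self_info M W (\<lambda>\<omega>. (L \<omega>, V \<omega>, T' \<omega>)) \<omega>"
        proof (cases "W \<omega> \<in> W ` A")
          case False
          then show ?thesis
            by (intro self_info_cong[OF \<omega>]) (auto simp: L_def T'_def E_def split: if_splits)
        next
          case True
          have "rv_prob M (\<lambda>\<omega>. (W \<omega>, L \<omega>, V \<omega>)) \<omega> = rv_prob M (\<lambda>\<omega>. (L \<omega>, V \<omega>)) \<omega>"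
            by (rule rv_prob_cong[OF \<omega>]) (use True in \<open>auto simp: L_def split: if_splits\<close>)
          moreover have "rv_prob M (\<lambda>\<omega>. (W \<omega>, L \<omega>, V \<omega>, T' \<omega>)) \<omega> = rv_prob M (\<lambda>\<omega>. (L \<omega>, V \<omega>, T' \<omega>)) \<omega>"
            by (rule rv_prob_cong[OF \<omega>]) (use True in \<open>auto simp: L_def split: if_splits\<close>)
          ultimately show ?thesis by (simp add: self_info_def)
        qed
      qed
      \<comment> \<open>The kernel depends only on these three variables, so given them the function
        is independent of W.\<close>
      also have "\<dots> = Hc ?M (\<lambda>v. W (fst v)) (\<lambda>v. ((L (fst v), V (fst v), T' (fst v)), snd v))"
        by (rule Hc_ext_markov[symmetric]) (use dep in blast)
      also have "\<dots> \<le> Hc ?M (\<lambda>v. W (fst v)) (\<lambda>v. (L (fst v), V (fst v), snd v))"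
        by (rule Hc_mono_cond[OF fin(1)]) auto
      also have "Hc M L V = Hc ?M (\<lambda>v. L (fst v)) (\<lambda>v. (V (fst v), snd v))" by (rule HL[symmetric])
      also have "Hc ?M (\<lambda>v. W (fst v)) (\<lambda>v. (L (fst v), V (fst v), snd v)) + Hc ?M (\<lambda>v. L (fst v)) (\<lambda>v. (V (fst v), snd v))
         = Hc ?M (\<lambda>v. (W (fst v), L (fst v))) (\<lambda>v. (V (fst v), snd v))"
        by (rule Hc_chain[symmetric, OF fin(1,4)])
      also have "\<dots> = Hc ?M (\<lambda>v. W (fst v)) (\<lambda>v. (V (fst v), snd v))"
        by (rule Hc_cong, rule refl, unfold L_def, metis prod.inject)
      finally show "Hc M W V \<le> Hc ?M (\<lambda>v. W (fst v)) (\<lambda>v. (V (fst v), snd v))" by simp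
    qed
  qed
qed

section \<open>Construction of the representation\<close>

lemma Hc_map_fst:
  assumes "map_pmf fst N = M"
  shows "Hc N (\<lambda>v. X (fst v)) (\<lambda>v. Y (fst v)) = Hc M X Y"
  using Hc_map[of fst N X Y] assms by simp

lemma fin_rv_map_fst:
  assumes "map_pmf fst N = M"
  shows "fin_rv N (\<lambda>v. X (fst v)) \<longleftrightarrow> fin_rv M X"
  using fin_rv_map[of fst N X] assms by simp

text \<open>The released variable consists of B, erased with probability \<open>1 - \<epsilon> / H(B)\<close>, and of a
  random function, independent of B, that turns B into A up to a small error.\<close>
lemma leaky_representation:
  fixes M :: "'m pmf" and A :: "'m \<Rightarrow> 'a" and B :: "'m \<Rightarrow> 'b" and T :: "'m \<Rightarrow> 't"
  assumes finA: "fin_rv M A" and finB: "fin_rv M B" and finT: "fin_rv M T"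
    and eps: "0 \<le> \<epsilon>" "\<epsilon> < Hc M B (\<lambda>_. ())" and \<delta>: "0 < \<delta>"
  defines "W \<equiv> \<lambda>\<omega>. (A \<omega>, B \<omega>)"
  obtains N :: "('m \<times> 'b option \<times> ('b option \<Rightarrow> 'a option)) pmf" where
    "map_pmf fst N = M"
    "Hc N (\<lambda>v. B (fst v)) snd = Hc M B (\<lambda>_. ()) - \<epsilon>"
    "Hc M W (\<lambda>_. ()) - (Hc M A B + \<epsilon>) \<le> Hc N (\<lambda>v. W (fst v)) snd"
    "Hc N (\<lambda>v. W (fst v)) snd \<le> Hc M W (\<lambda>_. ()) - (Hc M A B + \<epsilon>) + \<delta>"
    "Hc N (\<lambda>v. T (fst v)) (\<lambda>v. (snd v, W (fst v))) = Hc M T W"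
proof -
  define \<beta> where "\<beta> = \<epsilon> / Hc M B (\<lambda>_. ())"
  have \<beta>: "0 \<le> \<beta>" "\<beta> \<le> 1" and \<beta>H: "\<beta> * Hc M B (\<lambda>_. ()) = \<epsilon>"
    using eps by (auto simp: \<beta>_def)
  \<comment> \<open>B in the role of W, A in that of T, and a trivial V: the function is independent
    of B and leaves at most \<delta> of uncertainty about A once B is known.\<close>
  obtain k :: "'m \<Rightarrow> ('b option \<Rightarrow> 'a option) pmf" where
    dep: "\<And>\<omega> \<omega>'. () = () \<Longrightarrow> B \<omega>' = B \<omega> \<Longrightarrow> A \<omega>' = A \<omega> \<Longrightarrow> k \<omega>' = k \<omega>"
    and HB: "Hc (ext_pmf M k) (\<lambda>v. B (fst v)) (\<lambda>v. ((), snd v)) = Hc M B (\<lambda>_. ())"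
    and HA: "Hc (ext_pmf M k) (\<lambda>v. A (fst v)) (\<lambda>v. (B (fst v), (), snd v)) \<le> \<delta>"
    by (rule functional_representation_extension[OF finB finA \<delta>, of "\<lambda>_. ()"]; (rule that; assumption)?)
  define M1 where "M1 = ext_pmf M k"
  define M2 where "M2 = ext_pmf M1 (\<lambda>_. bernoulli_pmf \<beta>)"
  define U where "U = (\<lambda>v. (if snd v then Some (B (fst (fst v))) else None, snd (fst v) :: 'b option \<Rightarrow> 'a option))"
  define N where "N = map_pmf (\<lambda>v. (fst (fst v), U v)) M2"
  have mapM1: "map_pmf fst M1 = M" by (simp add: M1_def map_fst_ext_pmf)
  have mapM2: "map_pmf fst M2 = M1" by (simp add: M2_def map_fst_ext_pmf)
  have mapN: "map_pmf fst N = M"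
  proof -
    have "map_pmf fst N = map_pmf fst (map_pmf fst M2)" by (simp add: N_def map_pmf_comp)
    then show ?thesis by (simp add: mapM1 mapM2)
  qed
  have fin1': "fin_rv M1 (\<lambda>v. A (fst v))" "fin_rv M1 (\<lambda>v. B (fst v))"
    using finA finB fin_rv_map_fst[OF mapM1, of A] fin_rv_map_fst[OF mapM1, of B] by auto
  have finW: "fin_rv M W" unfolding W_def by (rule fin_rv_pair[OF finA finB])
  have HB1: "Hc M1 (\<lambda>v. B (fst v)) snd = Hc M B (\<lambda>_. ())"
    unfolding HB[symmetric] M1_def by (rule Hc_cong) auto
  define h where "h = Hc M1 (\<lambda>v. A (fst v)) (\<lambda>v. (B (fst v), snd v))"
  have h: "0 \<le> h" "h \<le> \<delta>"
  proof -
    show "0 \<le> h" by (simp add: h_def Hc_nonneg)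
    have "h = Hc M1 (\<lambda>v. A (fst v)) (\<lambda>v. (B (fst v), (), snd v))"
      unfolding h_def by (rule Hc_cong) auto
    then show "h \<le> \<delta>" using HA by (simp add: M1_def)
  qed
  have erase: "Hc N (\<lambda>v. X (fst v)) snd
      = (1 - \<beta>) * Hc M1 (\<lambda>v. X (fst v)) snd + \<beta> * Hc M1 (\<lambda>v. X (fst v)) (\<lambda>v. (B (fst v), snd v))"
    if X: "fin_rv M X" for X :: "'m \<Rightarrow> 'c"
  proof -
    have "Hc N (\<lambda>v. X (fst v)) snd = Hc M2 (\<lambda>v. X (fst (fst v))) (\<lambda>v. (if snd v then Some (B (fst (fst v))) else None, snd (fst v)))"
      unfolding N_def Hc_map U_def by simp
    also have "\<dots> = (1 - \<beta>) * Hc M1 (\<lambda>v. X (fst v)) snd + \<beta> * Hc M1 (\<lambda>v. X (fst v)) (\<lambda>v. (B (fst v), snd v))"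
      unfolding M2_def by (rule Hc_erasure[OF \<beta>]) (use X fin_rv_map_fst[OF mapM1, of X] in simp)
    finally show ?thesis .
  qed
  have HBN: "Hc N (\<lambda>v. B (fst v)) snd = Hc M B (\<lambda>_. ()) - \<epsilon>"
  proof -
    have "Hc M1 (\<lambda>v. B (fst v)) (\<lambda>v. (B (fst v), snd v)) = 0" by (rule Hc_determined) auto
    then show ?thesis using erase[OF finB] by (simp add: HB1 left_diff_distrib \<beta>H)
  qed
  have HWN: "Hc N (\<lambda>v. W (fst v)) snd = Hc M W (\<lambda>_. ()) - (Hc M A B + \<epsilon>) + h"
  proof -
    have 1: "Hc M1 (\<lambda>v. W (fst v)) snd = h + Hc M B (\<lambda>_. ())"
      unfolding W_def by (simp add: Hc_chain[OF fin1'] h_def HB1)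
    have 2: "Hc M1 (\<lambda>v. W (fst v)) (\<lambda>v. (B (fst v), snd v)) = h"
      unfolding h_def by (rule Hc_cong) (auto simp: W_def)
    have "Hc M W (\<lambda>_. ()) = Hc M A (\<lambda>\<omega>. (B \<omega>, ())) + Hc M B (\<lambda>_. ())"
      unfolding W_def by (rule Hc_chain[OF finA finB])
    also have "Hc M A (\<lambda>\<omega>. (B \<omega>, ())) = Hc M A B" by (rule Hc_cong) auto
    finally have 3: "Hc M W (\<lambda>_. ()) = Hc M A B + Hc M B (\<lambda>_. ())" .
    have "Hc N (\<lambda>v. W (fst v)) snd = (1 - \<beta>) * (h + Hc M B (\<lambda>_. ())) + \<beta> * h"
      using erase[OF finW] by (simp add: 1 2)
    also have "\<dots> = h + Hc M B (\<lambda>_. ()) - \<beta> * Hc M B (\<lambda>_. ())" by (simp add: algebra_simps)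
    finally show ?thesis using 3 \<beta>H by simp
  qed
  have HTN: "Hc N (\<lambda>v. T (fst v)) (\<lambda>v. (snd v, W (fst v))) = Hc M T W"
  proof -
    have "Hc N (\<lambda>v. T (fst v)) (\<lambda>v. (snd v, W (fst v)))
       = Hc M2 (\<lambda>v. T (fst (fst v))) (\<lambda>v. (if snd v then Some (B (fst (fst v))) else None, (W (fst (fst v)), snd (fst v))))"
      unfolding N_def Hc_map U_def by (rule Hc_cong) auto
    also have "\<dots> = (1 - \<beta>) * Hc M1 (\<lambda>v. T (fst v)) (\<lambda>v. (W (fst v), snd v))
        + \<beta> * Hc M1 (\<lambda>v. T (fst v)) (\<lambda>v. (B (fst v), W (fst v), snd v))"
      unfolding M2_def
      by (rule Hc_erasure[OF \<beta>, of _ "\<lambda>v. T (fst v)" "\<lambda>v. B (fst v)" "\<lambda>v. (W (fst v), snd v)"])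
         (use finT fin_rv_map_fst[OF mapM1, of T] in simp)
    also have "Hc M1 (\<lambda>v. T (fst v)) (\<lambda>v. (B (fst v), W (fst v), snd v)) = Hc M1 (\<lambda>v. T (fst v)) (\<lambda>v. (W (fst v), snd v))"
      by (rule Hc_cong) (auto simp: W_def)
    \<comment> \<open>The function was drawn from (A,B) alone, so given W it says nothing about
      T.\<close>
    also have "Hc M1 (\<lambda>v. T (fst v)) (\<lambda>v. (W (fst v), snd v)) = Hc M T W"
      unfolding M1_def by (rule Hc_ext_markov) (rule dep; simp add: W_def)
    finally show ?thesis by (simp add: algebra_simps)
  qed
  show thesis by (rule that[OF mapN HBN _ _ HTN]) (use HWN h in auto)
qed

text \<open>Z leaves H(W | V) unchanged, so both leakages are read off from V. The two lower bounds
  on I(T;Y) come from two estimates of H(T | Y): through W, as T is almost a function of W and Y,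
  and through the code length of the race. Errors occur only in these.\<close>

lemma representation_lower_bound:
  fixes M :: "'m pmf" and A :: "'m \<Rightarrow> 'a" and B :: "'m \<Rightarrow> 'b" and T :: "'m \<Rightarrow> 't"
  assumes finA: "fin_rv M A" and finB: "fin_rv M B" and finT: "fin_rv M T"
    and eps: "0 \<le> \<epsilon>" "\<epsilon> < Hc M B (\<lambda>_. ())" and r: "0 \<le> r" "r \<le> Hc M A B + \<epsilon>" and e: "0 < e"
  defines "W \<equiv> \<lambda>\<omega>. (A \<omega>, B \<omega>)"
    and "\<alpha> \<equiv> r / (Hc M A B + \<epsilon>)"
  obtains k :: "'m \<Rightarrow> nat pmf" where
    "Hc M A (\<lambda>_. ()) - Hc (ext_pmf M k) (\<lambda>v. A (fst v)) snd \<le> r"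
    "Hc M B (\<lambda>_. ()) - Hc (ext_pmf M k) (\<lambda>v. B (fst v)) snd \<le> \<epsilon>"
    "Hc M T W + r - Hc M W T - e \<le> Hc M T (\<lambda>_. ()) - Hc (ext_pmf M k) (\<lambda>v. T (fst v)) snd"
    "Hc M T W + r - \<alpha> * Hc M W T - 1.06
       - log 2 ((1 - \<alpha>) * (Hc M T (\<lambda>_. ()) - Hc M T W) + \<alpha> * min (Hc M T (\<lambda>_. ())) (Hc M W (\<lambda>_. ())) + 5.51) - e
       \<le> Hc M T (\<lambda>_. ()) - Hc (ext_pmf M k) (\<lambda>v. T (fst v)) snd"
proof -
  define \<delta> where "\<delta> = e / 2"
  have \<delta>: "0 < \<delta>" using e by (simp add: \<delta>_def)
  have finW: "fin_rv M W" unfolding W_def by (rule fin_rv_pair[OF finA finB])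
  obtain NU :: "('m \<times> 'b option \<times> ('b option \<Rightarrow> 'a option)) pmf" where
    mapU: "map_pmf fst NU = M"
    and UB: "Hc NU (\<lambda>v. B (fst v)) snd = Hc M B (\<lambda>_. ()) - \<epsilon>"
    and UW: "Hc M W (\<lambda>_. ()) - (Hc M A B + \<epsilon>) \<le> Hc NU (\<lambda>v. W (fst v)) snd"
      "Hc NU (\<lambda>v. W (fst v)) snd \<le> Hc M W (\<lambda>_. ()) - (Hc M A B + \<epsilon>) + \<delta>"
    and UT: "Hc NU (\<lambda>v. T (fst v)) (\<lambda>v. (snd v, W (fst v))) = Hc M T W"
    unfolding W_def by (rule leaky_representation[OF finA finB finT eps \<delta>]; (rule that; assumption)?)
  have sum0: "0 \<le> Hc M A B + \<epsilon>" using eps Hc_nonneg[of M A B] by simp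
  \<comment> \<open>If \<open>Hc M A B + \<epsilon>\<close> is 0, then so is r, and division by zero
    gives \<alpha> = 0; the identity still holds.\<close>
  have \<alpha>: "0 \<le> \<alpha>" "\<alpha> \<le> 1" "\<alpha> * (Hc M A B + \<epsilon>) = r"
    using r sum0 by (auto simp: \<alpha>_def divide_le_eq_1)
  define M3 where "M3 = ext_pmf NU (\<lambda>_. bernoulli_pmf \<alpha>)"
  define V where "V = (\<lambda>v :: ('m \<times> 'b option \<times> ('b option \<Rightarrow> 'a option)) \<times> bool. if snd v then Some (snd (fst v)) else None)"
  define N where "N = map_pmf (\<lambda>v. (fst (fst v), V v)) M3"
  have map3: "map_pmf fst M3 = NU" by (simp add: M3_def map_fst_ext_pmf)
  have mapN: "map_pmf fst N = M"
  proof -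
    have "map_pmf fst N = map_pmf fst (map_pmf fst M3)" by (simp add: N_def map_pmf_comp)
    then show ?thesis by (simp add: map3 mapU)
  qed
  have erase: "Hc N (\<lambda>v. X (fst v)) snd = (1 - \<alpha>) * Hc M X (\<lambda>_. ()) + \<alpha> * Hc NU (\<lambda>v. X (fst v)) snd"
    if X: "fin_rv M X" for X :: "'m \<Rightarrow> 'c"
  proof -
    have "Hc N (\<lambda>v. X (fst v)) snd = Hc M3 (\<lambda>v. X (fst (fst v))) (\<lambda>v. (if snd v then Some (snd (fst v)) else None, ()))"
      unfolding N_def Hc_map V_def by (rule Hc_cong) auto
    also have "\<dots> = (1 - \<alpha>) * Hc NU (\<lambda>v. X (fst v)) (\<lambda>_. ()) + \<alpha> * Hc NU (\<lambda>v. X (fst v)) (\<lambda>v. (snd v, ()))"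
      unfolding M3_def
      by (rule Hc_erasure[OF \<alpha>(1,2), of _ "\<lambda>v. X (fst v)" snd "\<lambda>_. ()"]) (use X fin_rv_map_fst[OF mapU, of X] in simp)
    also have "Hc NU (\<lambda>v. X (fst v)) (\<lambda>v. (snd v, ())) = Hc NU (\<lambda>v. X (fst v)) snd" by (rule Hc_cong) auto
    also have "Hc NU (\<lambda>v. X (fst v)) (\<lambda>_. ()) = Hc M X (\<lambda>_. ())" by (rule Hc_map_fst[OF mapU])
    finally show ?thesis .
  qed
  have VT: "Hc N (\<lambda>v. T (fst v)) (\<lambda>v. (W (fst v), snd v)) = Hc M T W"
  proof -
    have "Hc N (\<lambda>v. T (fst v)) (\<lambda>v. (W (fst v), snd v))
       = Hc M3 (\<lambda>v. T (fst (fst v))) (\<lambda>v. (if snd v then Some (snd (fst v)) else None, W (fst (fst v))))"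
      unfolding N_def Hc_map V_def by (rule Hc_cong) auto
    also have "\<dots> = (1 - \<alpha>) * Hc NU (\<lambda>v. T (fst v)) (\<lambda>v. W (fst v)) + \<alpha> * Hc NU (\<lambda>v. T (fst v)) (\<lambda>v. (snd v, W (fst v)))"
      unfolding M3_def
      by (rule Hc_erasure[OF \<alpha>(1,2), of _ "\<lambda>v. T (fst v)" snd "\<lambda>v. W (fst v)"]) (use finT fin_rv_map_fst[OF mapU, of T] in simp)
    also have "Hc NU (\<lambda>v. T (fst v)) (\<lambda>v. W (fst v)) = Hc M T W" by (rule Hc_map_fst[OF mapU])
    finally show ?thesis by (simp add: UT algebra_simps)
  qed
  note finN = fin_rv_map_fst[OF mapN, THEN iffD2, OF finA] fin_rv_map_fst[OF mapN, THEN iffD2, OF finB]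
    fin_rv_map_fst[OF mapN, THEN iffD2, OF finT] fin_rv_map_fst[OF mapN, THEN iffD2, OF finW]
  define I where "I = Hc N (\<lambda>v. T (fst v)) snd - Hc N (\<lambda>v. T (fst v)) (\<lambda>v. (W (fst v), snd v))"
  obtain k :: "'m \<times> ('b option \<times> ('b option \<Rightarrow> 'a option)) option \<Rightarrow> (('a \<times> 'b) option \<Rightarrow> 't option) pmf" where
    YW: "Hc (ext_pmf N k) (\<lambda>v. W (fst (fst v))) (\<lambda>v. (snd (fst v), snd v)) = Hc N (\<lambda>v. W (fst v)) snd"
    and YTW: "Hc (ext_pmf N k) (\<lambda>v. T (fst (fst v))) (\<lambda>v. (W (fst (fst v)), snd (fst v), snd v)) \<le> \<delta>"
    and YT: "Hc (ext_pmf N k) (\<lambda>v. T (fst (fst v))) (\<lambda>v. (snd (fst v), snd v)) \<le> I + log 2 (I + 5.51) + 1.06 + \<delta>"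
    unfolding I_def by (rule functional_representation_extension[OF finN(4,3) \<delta>, of snd]; (rule that; assumption)?)
  define M4 where "M4 = ext_pmf N k"
  define Y where "Y = (\<lambda>v :: ('m \<times> ('b option \<times> ('b option \<Rightarrow> 'a option)) option) \<times> (('a \<times> 'b) option \<Rightarrow> 't option). (snd (fst v), snd v))"
  have map4: "map_pmf fst M4 = N" by (simp add: M4_def map_fst_ext_pmf)
  have fin4: "fin_rv M4 (\<lambda>v. A (fst (fst v)))" "fin_rv M4 (\<lambda>v. B (fst (fst v)))"
    "fin_rv M4 (\<lambda>v. T (fst (fst v)))" "fin_rv M4 (\<lambda>v. W (fst (fst v)))"
    using fin_rv_map_fst[OF map4, THEN iffD2, OF finN(1)] fin_rv_map_fst[OF map4, THEN iffD2, OF finN(2)]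
      fin_rv_map_fst[OF map4, THEN iffD2, OF finN(3)] fin_rv_map_fst[OF map4, THEN iffD2, OF finN(4)] by auto
  define \<pi> where "\<pi> = (\<lambda>v :: ('m \<times> ('b option \<times> ('b option \<Rightarrow> 'a option)) option) \<times> (('a \<times> 'b) option \<Rightarrow> 't option). fst (fst v))"
  have map\<pi>: "map_pmf \<pi> M4 = M"
  proof -
    have "map_pmf \<pi> M4 = map_pmf fst (map_pmf fst M4)" by (simp add: \<pi>_def map_pmf_comp)
    then show ?thesis by (simp add: map4 mapN)
  qed
  have H4: "Hc M4 (\<lambda>v. X (fst (fst v))) (\<lambda>v. X' (fst (fst v))) = Hc M X X'" for X :: "'m \<Rightarrow> 'c" and X' :: "'m \<Rightarrow> 'd"
    using Hc_map[of \<pi> M4 X X'] unfolding map\<pi> by (simp add: \<pi>_def)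
  have H4N: "Hc M4 (\<lambda>v. X (fst v)) (\<lambda>v. X' (fst v)) = Hc N X X'" for X :: "'m \<times> ('b option \<times> ('b option \<Rightarrow> 'a option)) option \<Rightarrow> 'c" and X' :: "'m \<times> ('b option \<times> ('b option \<Rightarrow> 'a option)) option \<Rightarrow> 'd"
    by (rule Hc_map_fst[OF map4])
  \<comment> \<open>Y contains random functions, but its support under a pmf is countable. An
    injective code in \<open>nat\<close>, the alphabet of \<open>g_fun\<close>, leaves every entropy
    given Y unchanged.\<close>
  define enc where "enc = to_nat_on (Y ` set_pmf M4)"
  have enc: "inj_on enc (Y ` set_pmf M4)"
    unfolding enc_def by (rule inj_on_to_nat_on) (simp add: countable_set_pmf)
  \<comment> \<open>The conditional law of the code given the base outcome, that is, the kernel of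
    the representation; \<open>ext\<close> recovers the joint law.\<close>
  define K where "K = (\<lambda>\<omega>. map_pmf (\<lambda>v. enc (Y v)) (cond_pmf M4 (\<pi> -` {\<omega>})))"
  have ext: "ext_pmf M K = map_pmf (\<lambda>v. (\<pi> v, enc (Y v))) M4"
    unfolding ext_pmf_def K_def map_pmf_comp
    by (subst map\<pi>[symmetric]) (rule bind_map_cond_pmf[where h="\<lambda>\<omega> v. (\<omega>, enc (Y v))"])
  have HK: "Hc (ext_pmf M K) (\<lambda>v. X (fst v)) snd = Hc M4 (\<lambda>v. X (fst (fst v))) Y" for X :: "'m \<Rightarrow> 'c"
  proof -
    have "Hc (ext_pmf M K) (\<lambda>v. X (fst v)) snd = Hc M4 (\<lambda>v. X (fst (fst v))) (\<lambda>v. enc (Y v))"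
      unfolding ext Hc_map by (simp add: \<pi>_def)
    also have "\<dots> = Hc M4 (\<lambda>v. X (fst (fst v))) Y"
      by (rule Hc_cong) (use inj_on_eq_iff[OF enc] in auto)
    finally show ?thesis .
  qed
  have YW': "Hc M4 (\<lambda>v. W (fst (fst v))) Y = Hc N (\<lambda>v. W (fst v)) snd"
    using YW by (simp add: M4_def Y_def)
  have IW: "Hc M W (\<lambda>_. ()) - Hc M4 (\<lambda>v. W (fst (fst v))) Y \<le> r"
    "r - \<delta> \<le> Hc M W (\<lambda>_. ()) - Hc M4 (\<lambda>v. W (fst (fst v))) Y"
  proof -
    have eq: "Hc M W (\<lambda>_. ()) - Hc M4 (\<lambda>v. W (fst (fst v))) Y = \<alpha> * (Hc M W (\<lambda>_. ()) - Hc NU (\<lambda>v. W (fst v)) snd)"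
      unfolding YW' erase[OF finW] by (simp add: algebra_simps)
    also have "\<dots> \<le> \<alpha> * (Hc M A B + \<epsilon>)" using UW \<alpha> by (intro mult_left_mono) auto
    finally show "Hc M W (\<lambda>_. ()) - Hc M4 (\<lambda>v. W (fst (fst v))) Y \<le> r" using \<alpha> by simp
    have "r - \<delta> \<le> \<alpha> * (Hc M A B + \<epsilon>) - \<alpha> * \<delta>" using \<alpha> \<delta> mult_right_mono[of \<alpha> 1 \<delta>] by simp
    also have "\<dots> = \<alpha> * (Hc M A B + \<epsilon> - \<delta>)" by (simp add: algebra_simps)
    also have "\<dots> \<le> \<alpha> * (Hc M W (\<lambda>_. ()) - Hc NU (\<lambda>v. W (fst v)) snd)" using UW \<alpha> by (intro mult_left_mono) auto
    finally show "r - \<delta> \<le> Hc M W (\<lambda>_. ()) - Hc M4 (\<lambda>v. W (fst (fst v))) Y" using eq by simp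
  qed
  \<comment> \<open>I(A;Y) \<le> I(W;Y), because H(B | A,Y) \<le> H(B | A).\<close>
  have A_le: "Hc M A (\<lambda>_. ()) - Hc M4 (\<lambda>v. A (fst (fst v))) Y \<le> r"
  proof -
    have "Hc M4 (\<lambda>v. W (fst (fst v))) Y = Hc M4 (\<lambda>v. (B (fst (fst v)), A (fst (fst v)))) Y"
      by (rule Hc_cong) (auto simp: W_def)
    also have "\<dots> = Hc M4 (\<lambda>v. B (fst (fst v))) (\<lambda>v. (A (fst (fst v)), Y v)) + Hc M4 (\<lambda>v. A (fst (fst v))) Y"
      by (rule Hc_chain[OF fin4(2,1)])
    also have "Hc M4 (\<lambda>v. B (fst (fst v))) (\<lambda>v. (A (fst (fst v)), Y v)) \<le> Hc M4 (\<lambda>v. B (fst (fst v))) (\<lambda>v. A (fst (fst v)))"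
      by (rule Hc_mono_cond[OF fin4(2)]) auto
    also have "\<dots> = Hc M B A" by (rule H4)
    finally have 1: "Hc M4 (\<lambda>v. W (fst (fst v))) Y \<le> Hc M B A + Hc M4 (\<lambda>v. A (fst (fst v))) Y" by simp
    have "Hc M W (\<lambda>_. ()) = Hc M (\<lambda>\<omega>. (B \<omega>, A \<omega>)) (\<lambda>_. ())" by (rule Hc_cong) (auto simp: W_def)
    also have "\<dots> = Hc M B (\<lambda>\<omega>. (A \<omega>, ())) + Hc M A (\<lambda>_. ())" by (rule Hc_chain[OF finB finA])
    also have "Hc M B (\<lambda>\<omega>. (A \<omega>, ())) = Hc M B A" by (rule Hc_cong) auto
    finally show ?thesis using 1 IW(1) by simp
  qed
  \<comment> \<open>H(W | Y) = H(W | V) and H(A | B,Y) \<le> H(A | B,V) force H(B | V) \<le> H(B |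
    Y). So Y leaks no more about B than V does, and V leaks
    \<open>\<alpha> * \<epsilon>\<close>.\<close>
  have B_le: "Hc M B (\<lambda>_. ()) - Hc M4 (\<lambda>v. B (fst (fst v))) Y \<le> \<epsilon>"
  proof -
    have "Hc M4 (\<lambda>v. W (fst (fst v))) Y
        = Hc M4 (\<lambda>v. A (fst (fst v))) (\<lambda>v. (B (fst (fst v)), Y v)) + Hc M4 (\<lambda>v. B (fst (fst v))) Y"
      unfolding W_def by (rule Hc_chain[OF fin4(1,2)])
    also have "Hc M4 (\<lambda>v. A (fst (fst v))) (\<lambda>v. (B (fst (fst v)), Y v))
       \<le> Hc M4 (\<lambda>v. A (fst (fst v))) (\<lambda>v. (B (fst (fst v)), snd (fst v)))"
      by (rule Hc_mono_cond[OF fin4(1)]) (auto simp: Y_def)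
    also have "\<dots> = Hc N (\<lambda>v. A (fst v)) (\<lambda>v. (B (fst v), snd v))" by (rule H4N)
    finally have "Hc N (\<lambda>v. W (fst v)) snd \<le> Hc N (\<lambda>v. A (fst v)) (\<lambda>v. (B (fst v), snd v)) + Hc M4 (\<lambda>v. B (fst (fst v))) Y"
      by (simp add: YW')
    moreover have "Hc N (\<lambda>v. W (fst v)) snd = Hc N (\<lambda>v. A (fst v)) (\<lambda>v. (B (fst v), snd v)) + Hc N (\<lambda>v. B (fst v)) snd"
      unfolding W_def by (rule Hc_chain[OF finN(1,2)])
    ultimately have "Hc N (\<lambda>v. B (fst v)) snd \<le> Hc M4 (\<lambda>v. B (fst (fst v))) Y" by simp
    moreover have "Hc N (\<lambda>v. B (fst v)) snd = Hc M B (\<lambda>_. ()) - \<alpha> * \<epsilon>"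
      unfolding erase[OF finB] UB by (simp add: algebra_simps)
    moreover have "\<alpha> * \<epsilon> \<le> \<epsilon>" using \<alpha> eps by (simp add: mult_left_le_one_le)
    ultimately show ?thesis by simp
  qed
  have exch: "Hc M T W + Hc M W (\<lambda>_. ()) = Hc M W T + Hc M T (\<lambda>_. ())"
  proof -
    have "Hc M T (\<lambda>\<omega>. (W \<omega>, ())) = Hc M T W" "Hc M W (\<lambda>\<omega>. (T \<omega>, ())) = Hc M W T"
      by (rule Hc_cong; simp)+
    then show ?thesis using Hc_exchange[OF finT finW, of "\<lambda>_. ()"] by simp
  qed
  have L1: "Hc M T W + r - Hc M W T - e \<le> Hc M T (\<lambda>_. ()) - Hc M4 (\<lambda>v. T (fst (fst v))) Y"
  proof -
    have "Hc M4 (\<lambda>v. T (fst (fst v))) Y \<le> Hc M4 (\<lambda>v. T (fst (fst v))) (\<lambda>v. (W (fst (fst v)), Y v)) + Hc M4 (\<lambda>v. W (fst (fst v))) Y"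
      by (rule Hc_triangle[OF fin4(3,4)])
    also have "Hc M4 (\<lambda>v. T (fst (fst v))) (\<lambda>v. (W (fst (fst v)), Y v)) \<le> \<delta>"
      using YTW by (simp add: M4_def Y_def)
    finally show ?thesis using IW(2) exch by (simp add: \<delta>_def)
  qed
  define uT where "uT = Hc NU (\<lambda>v. T (fst v)) snd"
  note finU = fin_rv_map_fst[OF mapU, THEN iffD2, OF finT] fin_rv_map_fst[OF mapU, THEN iffD2, OF finW]
  \<comment> \<open>Erasure makes I(W;T | V) a mixture of I(W;T) and I(W;T | U). The latter is at
    most both H(T) and H(W), the source of the minimum under the logarithm.\<close>
  have I_eq: "I = (1 - \<alpha>) * (Hc M T (\<lambda>_. ()) - Hc M T W) + \<alpha> * (uT - Hc M T W)"
    unfolding I_def erase[OF finT] VT uT_def by (simp add: algebra_simps)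
  have uT1: "uT \<le> Hc M T W + Hc NU (\<lambda>v. W (fst v)) snd"
  proof -
    have "uT \<le> Hc NU (\<lambda>v. T (fst v)) (\<lambda>v. (W (fst v), snd v)) + Hc NU (\<lambda>v. W (fst v)) snd"
      unfolding uT_def by (rule Hc_triangle[OF finU])
    also have "Hc NU (\<lambda>v. T (fst v)) (\<lambda>v. (W (fst v), snd v)) = Hc M T W"
      unfolding UT[symmetric] by (rule Hc_cong) auto
    finally show ?thesis .
  qed
  have uW: "Hc NU (\<lambda>v. W (fst v)) snd \<le> Hc M W (\<lambda>_. ())"
  proof -
    have "Hc NU (\<lambda>v. W (fst v)) snd \<le> Hc NU (\<lambda>v. W (fst v)) (\<lambda>v. ())"
      by (rule Hc_mono_cond[OF finU(2)]) auto
    also have "\<dots> = Hc M W (\<lambda>_. ())" by (rule Hc_map_fst[OF mapU])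
    finally show ?thesis .
  qed
  have uT2: "uT \<le> Hc M T (\<lambda>_. ())"
  proof -
    have "uT \<le> Hc NU (\<lambda>v. T (fst v)) (\<lambda>v. ())"
      unfolding uT_def by (rule Hc_mono_cond[OF finU(1)]) auto
    also have "\<dots> = Hc M T (\<lambda>_. ())" by (rule Hc_map_fst[OF mapU])
    finally show ?thesis .
  qed
  have I0: "0 \<le> I" unfolding I_def using Hc_mono_cond[OF finN(3), of "\<lambda>v. (W (fst v), snd v)" snd] by simp
  define C where "C = (1 - \<alpha>) * (Hc M T (\<lambda>_. ()) - Hc M T W) + \<alpha> * min (Hc M T (\<lambda>_. ())) (Hc M W (\<lambda>_. ()))"
  have "uT - Hc M T W \<le> min (Hc M T (\<lambda>_. ())) (Hc M W (\<lambda>_. ()))"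
    using uT1 uT2 uW Hc_nonneg[of M T W] by simp
  then have "I \<le> C" unfolding I_eq C_def using \<alpha> by (simp add: mult_left_mono)
  then have logC: "log 2 (I + 5.51) \<le> log 2 (C + 5.51)" using I0 by simp
  have L2: "Hc M T W + r - \<alpha> * Hc M W T - 1.06 - log 2 (C + 5.51) - e
       \<le> Hc M T (\<lambda>_. ()) - Hc M4 (\<lambda>v. T (fst (fst v))) Y"
  proof -
    have "Hc M4 (\<lambda>v. T (fst (fst v))) Y \<le> I + log 2 (C + 5.51) + 1.06 + \<delta>"
      using YT logC by (simp add: M4_def Y_def)
    \<comment> \<open>In essence I(T;U) \<ge> I(W;U) - H(W | T), with I(W;U) at least H(A | B) +
      \<epsilon> - \<delta>, multiplied by \<alpha>.\<close>
    moreover have "r - \<alpha> * Hc M W T - \<delta> \<le> Hc M T (\<lambda>_. ()) - I - Hc M T W"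
    proof -
      have "r - \<alpha> * Hc M W T - \<delta> \<le> \<alpha> * (Hc M A B + \<epsilon>) - \<alpha> * Hc M W T - \<alpha> * \<delta>"
        using \<alpha> \<delta> mult_right_mono[of \<alpha> 1 \<delta>] by simp
      also have "\<dots> = \<alpha> * (Hc M A B + \<epsilon> - Hc M W T - \<delta>)" by (simp add: algebra_simps)
      also have "\<dots> \<le> \<alpha> * (Hc M T (\<lambda>_. ()) - uT)"
        using uT1 UW exch \<alpha> by (intro mult_left_mono) auto
      also have "\<dots> = Hc M T (\<lambda>_. ()) - I - Hc M T W" unfolding I_eq by (simp add: algebra_simps)
      finally show ?thesis .
    qed
    ultimately show ?thesis by (simp add: \<delta>_def)
  qed
  show thesis
    by (rule that[of K]) (use A_le B_le L1 L2[unfolded C_def] in \<open>simp_all only: HK\<close>)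
qed

section \<open>From kernels to the supremum\<close>

definition info :: "'m pmf \<Rightarrow> ('m \<Rightarrow> 'a) \<Rightarrow> ('m \<Rightarrow> nat pmf) \<Rightarrow> real" where
  "info M X k = Hc M X (\<lambda>_. ()) - Hc (ext_pmf M k) (\<lambda>v. X (fst v)) snd"

lemma mut_info_ext:
  assumes "fin_rv M X"
  shows "mut_info (map_pmf (\<lambda>v. (X (fst v), snd v)) (ext_pmf M k)) = info M X k"
    and "mut_info (map_pmf (\<lambda>v. (snd v, X (fst v))) (ext_pmf M k)) = info M X k"
proof -
  show 1: "mut_info (map_pmf (\<lambda>v. (X (fst v), snd v)) (ext_pmf M k)) = info M X k"
    using assms Hc_ext_fst[of M k X "\<lambda>_. ()"]
    by (subst Hc_mut_info) (simp_all add: fin_rv_map fin_rv_ext_fst Hc_map info_def)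
  show "mut_info (map_pmf (\<lambda>v. (snd v, X (fst v))) (ext_pmf M k)) = info M X k"
    using mut_info_swap[of "map_pmf (\<lambda>v. (X (fst v), snd v)) (ext_pmf M k)"] 1 by (simp add: map_pmf_comp)
qed

text \<open>Since H(T | S) + H(S) = H(S | T) + H(T), the claim amounts to H(S | Y) \<le> H(S | T) +
  H(T | Y), a triangle inequality.\<close>

lemma info_le:
  assumes "fin_rv M T" "fin_rv M S"
  shows "info M T k \<le> Hc M T S + info M S k"
proof -
  let ?N = "ext_pmf M k"
  have fin: "fin_rv ?N (\<lambda>v. T (fst v))" "fin_rv ?N (\<lambda>v. S (fst v))" using assms by (simp_all add: fin_rv_ext_fst)
  have "Hc ?N (\<lambda>v. S (fst v)) snd \<le> Hc ?N (\<lambda>v. S (fst v)) (\<lambda>v. (T (fst v), snd v)) + Hc ?N (\<lambda>v. T (fst v)) snd"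
    by (rule Hc_triangle[OF fin(2,1)])
  also have "Hc ?N (\<lambda>v. S (fst v)) (\<lambda>v. (T (fst v), snd v)) \<le> Hc ?N (\<lambda>v. S (fst v)) (\<lambda>v. T (fst v))"
    by (rule Hc_mono_cond[OF fin(2)]) auto
  also have "\<dots> = Hc M S T" by (rule Hc_ext_fst)
  finally have "Hc ?N (\<lambda>v. S (fst v)) snd \<le> Hc M S T + Hc ?N (\<lambda>v. T (fst v)) snd" by simp
  moreover have "Hc M T S + Hc M S (\<lambda>_. ()) = Hc M S T + Hc M T (\<lambda>_. ())"
  proof -
    have "Hc M T (\<lambda>\<omega>. (S \<omega>, ())) = Hc M T S" "Hc M S (\<lambda>\<omega>. (T \<omega>, ())) = Hc M S T"
      by (rule Hc_cong; simp)+
    then show ?thesis using Hc_exchange[OF assms, of "\<lambda>_. ()"] by simp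
  qed
  ultimately show ?thesis by (simp add: info_def)
qed

text \<open>A constant representation leaks nothing, so the set under the supremum is
  nonempty.\<close>

lemma info_const: "info M X (\<lambda>_. return_pmf 0) = 0"
proof -
  let ?N = "ext_pmf M (\<lambda>_. return_pmf (0 :: nat))"
  have "Hc ?N (\<lambda>v. X (fst v)) snd = Hc ?N (\<lambda>v. X (fst v)) (\<lambda>v. (\<lambda>_. ()) (fst v))"
    by (rule Hc_cong) (auto simp: set_ext_pmf)
  also have "\<dots> = Hc M X (\<lambda>_. ())" by (rule Hc_ext_fst)
  finally show ?thesis by (simp add: info_def)
qed

text \<open>Uncurrying the kernels is surjective, so both suprema run over the same values.\<close>

lemma g_fun_info:
  fixes P :: "('s \<times> 'x \<times> 't) pmf"
  assumes "fin_rv P fst" "fin_rv P (\<lambda>\<omega>. fst (snd \<omega>))" "fin_rv P (\<lambda>\<omega>. snd (snd \<omega>))"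
  shows "g_fun r \<epsilon> P = Sup (info P (\<lambda>\<omega>. snd (snd \<omega>)) `
    {k. info P fst k \<le> \<epsilon> \<and> info P (\<lambda>\<omega>. fst (snd \<omega>)) k \<le> r})"
proof -
  define u :: "('s \<Rightarrow> 'x \<Rightarrow> 't \<Rightarrow> nat pmf) \<Rightarrow> 's \<times> 'x \<times> 't \<Rightarrow> nat pmf" where
    "u = (\<lambda>K \<omega>. K (fst \<omega>) (fst (snd \<omega>)) (snd (snd \<omega>)))"
  have surj: "surj u"
    by (rule surjI[of _ "\<lambda>k s x t. k (s, x, t)"]) (simp add: u_def)
  have J: "joint_Y P K = map_pmf (\<lambda>v. (fst (fst v), fst (snd (fst v)), snd (snd (fst v)), snd v)) (ext_pmf P (u K))" for K
    unfolding joint_Y_def ext_pmf_def map_bind_pmf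
    by (rule bind_pmf_cong) (auto simp: map_pmf_comp u_def)
  have S: "mut_info (map_pmf (\<lambda>(s, x, t, y). (y, s)) (joint_Y P K)) = info P fst (u K)" for K
    unfolding J map_pmf_comp using mut_info_ext(2)[OF assms(1), of "u K"] by (simp add: case_prod_unfold)
  have X: "mut_info (map_pmf (\<lambda>(s, x, t, y). (x, y)) (joint_Y P K)) = info P (\<lambda>\<omega>. fst (snd \<omega>)) (u K)" for K
    unfolding J map_pmf_comp using mut_info_ext(1)[OF assms(2), of "u K"] by (simp add: case_prod_unfold)
  have T: "mut_info (map_pmf (\<lambda>(s, x, t, y). (y, t)) (joint_Y P K)) = info P (\<lambda>\<omega>. snd (snd \<omega>)) (u K)" for K
    unfolding J map_pmf_comp using mut_info_ext(2)[OF assms(3), of "u K"] by (simp add: case_prod_unfold)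
  have "{k. Q k} = u ` {K. Q (u K)}" for Q
    using surj_image_vimage_eq[OF surj, of "Collect Q"] by (simp only: vimage_Collect_eq)
  then have "info P (\<lambda>\<omega>. snd (snd \<omega>)) ` {k. Q k} = (\<lambda>K. info P (\<lambda>\<omega>. snd (snd \<omega>)) (u K)) ` {K. Q (u K)}" for Q
    by (simp only: image_image)
  then show ?thesis unfolding g_fun_def S X T by (simp only:)
qed

text \<open>By monotonicity in the rate, the first and the last bound are the instances \<open>r = 0\<close> and
  \<open>r = H(A | B) + \<epsilon>\<close> of the two middle ones.\<close>
lemma feasible_lower_bounds:
  fixes M :: "'m pmf" and A :: "'m \<Rightarrow> 'a" and B :: "'m \<Rightarrow> 'b" and T :: "'m \<Rightarrow> 't"
  assumes fin: "fin_rv M A" "fin_rv M B" "fin_rv M T"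
    and eps: "0 \<le> \<epsilon>" "\<epsilon> < Hc M B (\<lambda>_. ())" and r: "0 \<le> r"
    and g: "\<And>k. info M A k \<le> r \<Longrightarrow> info M B k \<le> \<epsilon> \<Longrightarrow> info M T k \<le> g"
  defines "W \<equiv> \<lambda>\<omega>. (A \<omega>, B \<omega>)"
    and "I \<equiv> Hc M T (\<lambda>_. ()) - Hc M T (\<lambda>\<omega>. (A \<omega>, B \<omega>))"
    and "\<alpha> \<equiv> r / (Hc M A B + \<epsilon>)"
  shows "Hc M T W - (log 2 (I + 5.51) + 1.06) \<le> g"
    and "r \<le> Hc M A B + \<epsilon> \<Longrightarrow> Hc M T W + r - Hc M W T \<le> g"
    and "r \<le> Hc M A B + \<epsilon> \<Longrightarrow> Hc M T W + r - \<alpha> * Hc M W T - 1.06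
       - log 2 ((1 - \<alpha>) * I + \<alpha> * min (Hc M T (\<lambda>_. ())) (Hc M W (\<lambda>_. ())) + 5.51) \<le> g"
    and "Hc M A B + \<epsilon> \<le> r \<Longrightarrow> Hc M T B - Hc M B T + \<epsilon> \<le> g"
proof -
  have sum0: "0 \<le> Hc M A B + \<epsilon>" using eps Hc_nonneg[of M A B] by simp
  define L where "L = (\<lambda>q. Hc M T W + q - q / (Hc M A B + \<epsilon>) * Hc M W T - 1.06
       - log 2 ((1 - q / (Hc M A B + \<epsilon>)) * I + q / (Hc M A B + \<epsilon>) * min (Hc M T (\<lambda>_. ())) (Hc M W (\<lambda>_. ())) + 5.51))"
  have bounds: "Hc M T W + q - Hc M W T \<le> g" "L q \<le> g"
    if q: "0 \<le> q" "q \<le> Hc M A B + \<epsilon>" "q \<le> r" for q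
  proof -
    \<comment> \<open>Each construction may miss the bounds by e, but g dominates all feasible
      values, so e can tend to 0.\<close>
    have approx: "Hc M T W + q - Hc M W T \<le> g + e \<and> L q \<le> g + e" if e: "0 < e" for e
    proof (rule representation_lower_bound[OF fin eps q(1,2) e, folded W_def info_def])
      fix k assume k: "info M A k \<le> q" "info M B k \<le> \<epsilon>"
        and le: "Hc M T W + q - Hc M W T - e \<le> info M T k"
        "Hc M T W + q - q / (Hc M A B + \<epsilon>) * Hc M W T - 1.06
       - log 2 ((1 - q / (Hc M A B + \<epsilon>)) * (Hc M T (\<lambda>_. ()) - Hc M T W) + q / (Hc M A B + \<epsilon>) * min (Hc M T (\<lambda>_. ())) (Hc M W (\<lambda>_. ())) + 5.51) - e
          \<le> info M T k"
      have "info M T k \<le> g" using k q by (intro g) auto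
      with le show ?thesis unfolding L_def I_def W_def by (intro conjI; linarith)
    qed
    show "Hc M T W + q - Hc M W T \<le> g" by (rule field_le_epsilon) (use approx in blast)
    show "L q \<le> g" by (rule field_le_epsilon) (use approx in blast)
  qed
  show "Hc M T W - (log 2 (I + 5.51) + 1.06) \<le> g" using bounds(2)[of 0] sum0 r by (simp add: L_def)
  show "r \<le> Hc M A B + \<epsilon> \<Longrightarrow> Hc M T W + r - Hc M W T \<le> g" using bounds(1)[of r] r by simp
  show "r \<le> Hc M A B + \<epsilon> \<Longrightarrow> Hc M T W + r - \<alpha> * Hc M W T - 1.06
       - log 2 ((1 - \<alpha>) * I + \<alpha> * min (Hc M T (\<lambda>_. ())) (Hc M W (\<lambda>_. ())) + 5.51) \<le> g"
    unfolding \<alpha>_def using bounds(2)[of r] r by (simp add: L_def)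
  assume le: "Hc M A B + \<epsilon> \<le> r"
  \<comment> \<open>At rate H(A | B) + \<epsilon> the bound without logarithm is H(T | W) + H(A | B)
    + \<epsilon> - H(W | T); in the two expansions H(A | B,T) cancels.\<close>
  have "Hc M T W + Hc M A B = Hc M A (\<lambda>\<omega>. (T \<omega>, B \<omega>)) + Hc M T B"
    unfolding W_def by (rule Hc_exchange[OF fin(3,1)])
  moreover have "Hc M W T = Hc M A (\<lambda>\<omega>. (B \<omega>, T \<omega>)) + Hc M B T"
    unfolding W_def by (rule Hc_chain[OF fin(1,2)])
  moreover have "Hc M A (\<lambda>\<omega>. (B \<omega>, T \<omega>)) = Hc M A (\<lambda>\<omega>. (T \<omega>, B \<omega>))" by (rule Hc_cong) auto
  ultimately show "Hc M T B - Hc M B T + \<epsilon> \<le> g" using bounds(1)[OF sum0 _ le] by simp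
qed

theorem theorem2:
  fixes P :: "('s::finite \<times> 'x::countable \<times> 't::countable) pmf"
    and r \<epsilon> :: real
  defines "HS \<equiv> ent (map_pmf (\<lambda>(s,x,t). s) P)"
    and "HX \<equiv> ent (map_pmf (\<lambda>(s,x,t). x) P)"
    and "HT \<equiv> ent (map_pmf (\<lambda>(s,x,t). t) P)"
    and "HXS \<equiv> ent (map_pmf (\<lambda>(s,x,t). (x,s)) P)"
    and "HT_S \<equiv> cond_ent (map_pmf (\<lambda>(s,x,t). (t,s)) P)"
    and "HT_X \<equiv> cond_ent (map_pmf (\<lambda>(s,x,t). (t,x)) P)"
    and "HT_XS \<equiv> cond_ent (map_pmf (\<lambda>(s,x,t). (t,(x,s))) P)"
    and "HXS_T \<equiv> cond_ent (map_pmf (\<lambda>(s,x,t). ((x,s),t)) P)"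
    and "HS_T \<equiv> cond_ent (map_pmf (\<lambda>(s,x,t). (s,t)) P)"
    and "HX_T \<equiv> cond_ent (map_pmf (\<lambda>(s,x,t). (x,t)) P)"
    and "HX_S \<equiv> cond_ent (map_pmf (\<lambda>(s,x,t). (x,s)) P)"
    and "HS_X \<equiv> cond_ent (map_pmf (\<lambda>(s,x,t). (s,x)) P)"
    and "IXST \<equiv> mut_info (map_pmf (\<lambda>(s,x,t). ((x,s),t)) P)"
    and "g \<equiv> g_fun r \<epsilon> P"
  assumes finX: "finite_ent (map_pmf (\<lambda>(s,x,t). x) P)"
    and finT: "finite_ent (map_pmf (\<lambda>(s,x,t). t) P)"
    and r_nonneg: "0 \<le> r" and eps_nonneg: "0 \<le> \<epsilon>"
    and r_lt: "r < HX" and eps_lt: "\<epsilon> < HS"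
  shows "let L0 = HT_XS - (log 2 (IXST + 5.51) + 1.06) in
    g \<le> min (HT_S + \<epsilon>) (HT_X + r)
    \<and> (r \<le> HX_S + \<epsilon> \<longrightarrow>
         (let \<alpha> = r / (HX_S + \<epsilon>);
              L1 = HT_XS + r - HXS_T;
              L2 = HT_XS + r - \<alpha> * HXS_T - 1.06
                   - log 2 ((1 - \<alpha>) * IXST + \<alpha> * min HT HXS + 5.51)
          in max L0 (max L1 L2) \<le> g))
    \<and> (HX_S + \<epsilon> \<le> r \<and> r < HX \<longrightarrow> max L0 (HT_S - HS_T + \<epsilon>) \<le> g)
    \<and> (r \<le> \<epsilon> \<and> \<epsilon> \<le> HS_X + r \<longrightarrow>
         (let \<alpha>' = \<epsilon> / (HS_X + r);
              L3 = HT_XS + \<epsilon> - HXS_T;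
              L4 = HT_XS + \<epsilon> - \<alpha>' * HXS_T - 1.06
                   - log 2 ((1 - \<alpha>') * IXST + \<alpha>' * min HT HXS + 5.51)
          in max L0 (max L3 L4) \<le> g))
    \<and> (HS_X + r \<le> \<epsilon> \<and> \<epsilon> < HS \<longrightarrow> max L0 (HT_X - HX_T + r) \<le> g)"
proof -
  define S where "S = (\<lambda>\<omega> :: 's \<times> 'x \<times> 't. fst \<omega>)"
  define X where "X = (\<lambda>\<omega> :: 's \<times> 'x \<times> 't. fst (snd \<omega>))"
  define T where "T = (\<lambda>\<omega> :: 's \<times> 'x \<times> 't. snd (snd \<omega>))"
  define W where "W = (\<lambda>\<omega>. (X \<omega>, S \<omega>))"
  have fS: "fin_rv P S" by (rule fin_rv_finite) simp
  have fX: "fin_rv P X" using finX unfolding fin_rv_finite_ent X_def by (simp add: case_prod_unfold)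
  have fT: "fin_rv P T" using finT unfolding fin_rv_finite_ent T_def by (simp add: case_prod_unfold)
  have fW: "fin_rv P W" unfolding W_def by (rule fin_rv_pair[OF fX fS])
  have ce: "cond_ent (map_pmf (\<lambda>\<omega>. (X' \<omega>, Y' \<omega>)) P) = Hc P X' Y'" if "fin_rv P X'"
    for X' :: "'s \<times> 'x \<times> 't \<Rightarrow> 'c" and Y' :: "'s \<times> 'x \<times> 't \<Rightarrow> 'd"
    using that by (subst Hc_cond_ent) (simp_all add: fin_rv_map Hc_map)
  have HS: "HS = Hc P S (\<lambda>_. ())" and HX: "HX = Hc P X (\<lambda>_. ())"
    and HT: "HT = Hc P T (\<lambda>_. ())" and HXS: "HXS = Hc P W (\<lambda>_. ())"
    unfolding Hc_ent[OF fS] Hc_ent[OF fX] Hc_ent[OF fT] Hc_ent[OF fW]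
    by (simp_all add: HS_def HX_def HT_def HXS_def S_def X_def T_def W_def case_prod_unfold)
  have conds: "HT_S = Hc P T S" "HT_X = Hc P T X" "HT_XS = Hc P T W" "HXS_T = Hc P W T"
    "HS_T = Hc P S T" "HX_T = Hc P X T" "HX_S = Hc P X S" "HS_X = Hc P S X"
    using ce[OF fT, of S] ce[OF fT, of X] ce[OF fT, of W] ce[OF fW, of T] ce[OF fS, of T] ce[OF fX, of T]
      ce[OF fX, of S] ce[OF fS, of X]
    by (simp_all add: HT_S_def HT_X_def HT_XS_def HXS_T_def HS_T_def HX_T_def HX_S_def HS_X_def
        S_def X_def T_def W_def case_prod_unfold)
  have IXST: "IXST = Hc P T (\<lambda>_. ()) - Hc P T W"
  proof -
    have "IXST = mut_info (map_pmf (\<lambda>\<omega>. (W \<omega>, T \<omega>)) P)"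
      by (simp add: IXST_def W_def S_def X_def T_def case_prod_unfold)
    also have "\<dots> = Hc P W (\<lambda>_. ()) - Hc P W T"
      using fW by (subst Hc_mut_info) (simp_all add: fin_rv_map Hc_map)
    also have "\<dots> = Hc P T (\<lambda>_. ()) - Hc P T W"
    proof -
      have "Hc P T (\<lambda>\<omega>. (W \<omega>, ())) = Hc P T W" "Hc P W (\<lambda>\<omega>. (T \<omega>, ())) = Hc P W T"
        by (rule Hc_cong; simp)+
      then show ?thesis using Hc_exchange[OF fT fW, of "\<lambda>_. ()"] by simp
    qed
    finally show ?thesis .
  qed
  have swap: "Hc P T (\<lambda>\<omega>. (S \<omega>, X \<omega>)) = Hc P T W" "Hc P (\<lambda>\<omega>. (S \<omega>, X \<omega>)) T = Hc P W T"
    "Hc P (\<lambda>\<omega>. (S \<omega>, X \<omega>)) (\<lambda>_. ()) = Hc P W (\<lambda>_. ())"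
    by (rule Hc_cong; auto simp: W_def)+
  let ?F = "{k. info P S k \<le> \<epsilon> \<and> info P X k \<le> r}"
  have g_eq: "g = Sup (info P T ` ?F)"
    unfolding g_def S_def X_def T_def
    by (rule g_fun_info) (use fS fX fT in \<open>simp_all add: S_def X_def T_def\<close>)
  have upper: "info P T k \<le> min (HT_S + \<epsilon>) (HT_X + r)" if "k \<in> ?F" for k
    using info_le[OF fT fS, of k] info_le[OF fT fX, of k] that by (auto simp: conds)
  \<comment> \<open>The upper bound also shows that the set of values is bounded above, as is
    required to compare its elements with a real \<open>Sup\<close>.\<close>
  have feas: "info P T k \<le> g" if "info P X k \<le> r" "info P S k \<le> \<epsilon>" for k
    unfolding g_eq using upper that by (intro cSup_upper bdd_aboveI2[where M="min (HT_S + \<epsilon>) (HT_X + r)"]) auto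
  have "g \<le> min (HT_S + \<epsilon>) (HT_X + r)"
    unfolding g_eq
  proof (rule cSup_least)
    have "(\<lambda>_. return_pmf 0) \<in> ?F" using r_nonneg eps_nonneg by (simp add: info_const)
    then show "info P T ` ?F \<noteq> {}" by blast
  qed (use upper in blast)
  have feas': "info P T k \<le> g" if "info P S k \<le> \<epsilon>" "info P X k \<le> r" for k
    using feas that by blast
  note XS = feasible_lower_bounds[OF fX fS fT eps_nonneg eps_lt[unfolded HS] r_nonneg feas,
      folded W_def]
  \<comment> \<open>Interchanging S and X interchanges r and \<epsilon>, so \<open>r_lt\<close>
    takes the place of \<open>eps_lt\<close>.\<close>
  note SX = feasible_lower_bounds[OF fS fX fT r_nonneg r_lt[unfolded HX] eps_nonneg feas',
      unfolded swap]
  show ?thesis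
    using \<open>g \<le> min (HT_S + \<epsilon>) (HT_X + r)\<close>
    unfolding Let_def conds IXST HT HXS
    by (intro conjI impI max.boundedI; (elim conjE)?) (assumption | (rule XS SX; assumption) | rule XS)+
qed

end
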